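(* Let $f=\frac1n\sum_{i=1}^nf_i:\mathbb{R}^d\to\mathbb{R}$, where $f$ is $L$-smooth, each $f_i$ is $L_i$-smooth, $f(x)\ge f^*$ for all $x\in\mathbb{R}^d$, and $\Delta:=f(x^0)-f^*$, where $x^0$ is the starting point; let the stochastic gradients of every $f_i$ be unbiased with $\sigma^2$-bounded variance, and let the Functional $(L_A,L_B)$ similarity hold. Put $L_{\max}:=\max\{\max_{i\in[n]}L_i,L_A,L_B\}$. Assume that each worker requires at most $h$ seconds to compute a stochastic gradient, that communication from the server to any worker takes at most $\kappa$ seconds per coordinate, and that communication from any worker to the server takes at most $\tau$ seconds per coordinate. Let $$t=\max\left\{h,\tau,\kappa,\left(\tfrac{d^2\tau^2h\sigma^2}{n\varepsilon}\right)^{1/3}\right\}.$$ Consider the M4 method in which the workers use Rand$K$ compressors with $K=\lfloor t/\tau\rfloor$ and the server uses Rand$K$ compressors with $K=\lfloor t/\kappa\rfloor$ (with corresponding variance parameters $\omega$ and $\omega_s$), with batch size $b=\lfloor t/h\rfloor$, parameters $$\nu=\mu=\eta:=\min\left\{\tfrac16\sqrt{\tfrac{bn\varepsilon}{\omega(\omega+1)\sigma^2}},\ \tfrac{bn\varepsilon}{6\sigma^2},\ \left(\tfrac{n}{\omega(\omega+1)\omega_s}\right)^{1/3},\ 1\right\},\qquad p_s=\tfrac1{\omega_s+1},\qquad p=\tfrac1{\omega+1},$$ initialization $v_i^0=\frac1{b_{\rm init}}\sum_{r=1}^{b_{\rm init}}\nabla f_i(x_i^0;\xi_{i,r}^0)$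 with $b_{\rm init}=\Theta\left(\sqrt{\frac b\nu\left(1+\frac{\sigma^2}{n\varepsilon}\right)}\right)$, and step size $$\gamma=\Theta\left(\sqrt{\omega_s(\omega_s+1)L_A^2+\tfrac{\omega_s}{n}(\omega_s+1)L_B^2+\left(\tfrac{\omega(\omega+1)}n+\tfrac1{\eta^2}\right)L_{\max}^2}\right)^{-1}.$$ Then the expected time for M4 to find an $\varepsilon$-stationary point of $f$, including the initial computation of the minibatches of size $b_{\rm init}$, is at most $$\mathcal{O}\left(\max\left\{h,\tau,\kappa,\frac{d\kappa}{\sqrt n},\frac{d\tau}{\sqrt n},\left(\frac{d^3\tau^2\kappa}{n}\right)^{1/3},\left(\frac{d^2\tau^2h\sigma^2}{n\varepsilon}\right)^{1/3},\frac{\sigma^2h}{n\varepsilon}\right\}\frac{L_{\max}\Delta}\varepsilon+\frac{d\kappa L_A\Delta}{\varepsilon}\right)$$ seconds.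
   Context: Norms are Euclidean; $[n]=\{1,\dots,n\}$, where $n$ is the number of workers, connected to a central server; $\varepsilon,h,\tau,\kappa,\sigma>0$ and $L_A,L_B\ge0$ are constants. $\mathcal{O}$ and $\Theta$ hide absolute constants. A function $\phi$ is $M$-smooth if $\|\nabla\phi(x)-\nabla\phi(y)\|\le M\|x-y\|$ for all $x,y\in\mathbb{R}^d$. Stochastic gradients: for all $i\in[n]$ and $x\in\mathbb{R}^d$, $\mathbb{E}_\xi[\nabla f_i(x;\xi)]=\nabla f_i(x)$ and $\mathbb{E}_\xi\|\nabla f_i(x;\xi)-\nabla f_i(x)\|^2\le\sigma^2$. Functional $(L_A,L_B)$ similarity: for all $x,u_1,\dots,u_n\in\mathbb{R}^d$, $$\Big\|\tfrac1n\sum_{i=1}^n(\nabla f_i(x+u_i)-\nabla f_i(x))\Big\|^2\le L_A^2\,\tfrac1n\sum_{i=1}^n\|u_i\|^2+L_B^2\Big\|\tfrac1n\sum_{i=1}^nu_i\Big\|^2.$$ An $\varepsilon$-stationary point is a (random) point $\bar x\in\mathbb{R}^d$ with $\mathbb{E}\|\nabla f(\bar x)\|^2\le\varepsilon$. Unbiased compressor: $\mathcal{C}\in\mathbb{U}(\omega)$ is a random map $\mathbb{R}^d\to\mathbb{R}^d$ with $\mathbb{E}[\mathcal{C}(x)]=x$ and $\mathbb{E}\|\mathcal{C}(x)-x\|^2\le\omega\|x\|^2$ for all $x$. All compressors are statistically independent, and stochastic gradient samples are independent. Rand$K$ (for $K\in[d]$): $\mathcal{C}(x)=\frac dK\sum_{j\in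 S}x_je_j$ with $S$ a uniformly random $K$-element subset of $[d]$ and $e_j$ the standard basis vectors; Rand$K\in\mathbb{U}(d/K-1)$, and $\omega$ (workers), $\omega_s$ (server) denote the corresponding values $d/K-1$. A term with zero denominator inside a minimum is read as $+\infty$. M4 method: parameters: step size $\gamma>0$, $p_s,p\in(0,1]$, $b\in\mathbb{N}$, $\nu,\mu\in(0,1]$, compressors $\mathcal{C}_i^k\in\mathbb{U}(\omega)$ (workers), $\mathcal{C}_{s,i}^k\in\mathbb{U}(\omega_s)$ (server). Initialize $x^0$, $w_i^0=x_i^0=x^0$, vectors $v_i^0$ for $i\in[n]$, and $g^0=\frac1n\sum_{i=1}^nv_i^0$. For $k=0,1,\dots$: $x^{k+1}=x^k-\gamma g^k$; $w_i^{k+1}=x^{k+1}$ with probability $p_s$ and $w_i^{k+1}=w_i^k+\mathcal{C}^k_{s,i}(x^{k+1}-x^k)$ with probability $1-p_s$ (one coin common to all workers $i\in[n]$); $x_i^{k+1}=(1-\mu)x_i^k+\mu w_i^{k+1}$; $v_i^{k+1}=(1-\nu)v_i^k+\frac\nu b\sum_{r=1}^b\nabla f_i(x_i^{k+1};\xi_{ir}^{k+1})$; $g^{k+1}=\frac1n\sum_{i=1}^nv_i^{k+1}$ with probability $p$ and $g^{k+1}=g^k+\frac1n\sum_{i=1}^n\mathcal{C}_i^k(v_i^{k+1}-v_i^k)$ with probability $1-p$ (coin independent of the first one). Time model: in each iteration the workers compute $b$ stochastic gradients in parallel (at most $bh$ seconds); the server sends each worker the full vector ($d$ coordinates) if the $p_s$-coin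 triggers synchronization and otherwise one Rand$K$-compressed vector ($K$ coordinates), at $\kappa$ seconds per coordinate; each worker sends the server the full vector ($d$ coordinates) if the $p$-coin triggers synchronization and otherwise one Rand$K$-compressed vector ($K$ coordinates), at $\tau$ seconds per coordinate. The initialization costs at most $b_{\rm init}h$ seconds.
   Formalization: If x^0 is already ε-stationary it may be output at time 0 without charging the initial minibatches (only possible when ε > L_max Δ); always charging them would be false, e.g. for Δ = 0, where the bound is 0. *)

theory Defs
  imports "HOL-Probability.Probability"
begin

text \<open>
  Workers are the elements of a finite type \<open>'n\<close> (so the number of workers is \<open>CARD('n)\<close>), and
  the ambient space is \<open>real ^ 'd\<close> (so the dimension is \<open>CARD('d)\<close>).
\<close>

definition gradient :: "('a::real_inner \<Rightarrow> real) \<Rightarrow> 'a \<Rightarrow> 'a" where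
  "gradient \<phi> x = (THE D. GDERIV \<phi> x :> D)"

definition smooth :: "real \<Rightarrow> ('a::real_inner \<Rightarrow> real) \<Rightarrow> bool" where
  "smooth L \<phi> \<longleftrightarrow> (\<forall>x. GDERIV \<phi> x :> gradient \<phi> x) \<and> L-lipschitz_on UNIV (gradient \<phi>)"

definition worker_mean :: "('n::finite \<Rightarrow> 'a::real_vector) \<Rightarrow> 'a" where
  "worker_mean u = (1 / real CARD('n)) *\<^sub>R (\<Sum>i\<in>UNIV. u i)"

definition functional_similarity ::
    "('n::finite \<Rightarrow> 'a::real_inner \<Rightarrow> real) \<Rightarrow> real \<Rightarrow> real \<Rightarrow> bool" where
  "functional_similarity f L\<^sub>A L\<^sub>B \<longleftrightarrow>
     (\<forall>x u. (norm (worker_mean (\<lambda>i. gradient (f i) (x + u i) - gradient (f i) x)))\<^sup>2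
             \<le> L\<^sub>A\<^sup>2 * worker_mean (\<lambda>i. (norm (u i))\<^sup>2) + L\<^sub>B\<^sup>2 * (norm (worker_mean u))\<^sup>2)"

text \<open>
  \<open>G x z\<close> is the stochastic gradient at \<open>x\<close> for the sample \<open>z\<close>, drawn from \<open>D\<close>.
  Joint measurability in \<open>(x, z)\<close> is what makes \<open>G\<close> meaningful at random points.
\<close>

definition stochastic_gradient ::
    "'z measure \<Rightarrow> real \<Rightarrow> ('a::euclidean_space \<Rightarrow> real) \<Rightarrow> ('a \<Rightarrow> 'z \<Rightarrow> 'a) \<Rightarrow> bool" where
  "stochastic_gradient D \<sigma> \<phi> G \<longleftrightarrow>
     prob_space D \<and> (\<lambda>(x, z). G x z) \<in> borel_measurable (borel \<Otimes>\<^sub>M D) \<and>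
     (\<forall>x. integrable D (G x) \<and> (\<integral>z. G x z \<partial>D) = gradient \<phi> x \<and>
          integrable D (\<lambda>z. (norm (G x z - gradient \<phi> x))\<^sup>2) \<and>
          (\<integral>z. (norm (G x z - gradient \<phi> x))\<^sup>2 \<partial>D) \<le> \<sigma>\<^sup>2)"

text \<open>The random point \<open>X\<close> lives on the probability space \<open>P\<close>.\<close>

definition stationary_point ::
    "'w measure \<Rightarrow> ('a::euclidean_space \<Rightarrow> real) \<Rightarrow> real \<Rightarrow> ('w \<Rightarrow> 'a) \<Rightarrow> bool" where
  "stationary_point P \<phi> \<epsilon> X \<longleftrightarrow>
     X \<in> borel_measurable P \<and>
     integrable P (\<lambda>\<omega>. (norm (gradient \<phi> (X \<omega>)))\<^sup>2) \<and>
     (\<integral>\<omega>. (norm (gradient \<phi> (X \<omega>)))\<^sup>2 \<partial>P) \<le> \<epsilon>"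

definition rand_compress :: "nat \<Rightarrow> 'd::finite set \<Rightarrow> real ^ 'd \<Rightarrow> real ^ 'd" where
  "rand_compress K S x = (real CARD('d) / real K) *\<^sub>R (\<Sum>j\<in>S. (x $ j) *\<^sub>R axis j 1)"

definition minibatch :: "('a::real_vector \<Rightarrow> 'z \<Rightarrow> 'a) \<Rightarrow> nat \<Rightarrow> (nat \<Rightarrow> 'z) \<Rightarrow> 'a \<Rightarrow> 'a" where
  "minibatch G m z y = (1 / real m) *\<^sub>R (\<Sum>r = 1..m. G y (z r))"

record ('n, 'a) m4_state =
  server_x :: 'a
  worker_w :: "'n \<Rightarrow> 'a"
  worker_x :: "'n \<Rightarrow> 'a"
  worker_v :: "'n \<Rightarrow> 'a"
  server_g :: 'a

text \<open>
  The recursion is deterministic once the outcomes of the random sources are given: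
  \<open>cs k\<close>, \<open>cw k\<close> say whether the server and the worker coin trigger synchronization, \<open>Cs k i\<close>,
  \<open>Cw k i\<close> are the compressors, and \<open>mb k i y\<close> is the minibatch gradient of worker \<open>i\<close> at \<open>y\<close>
  formed from the samples with upper index \<open>k\<close>.
\<close>

primrec m4 ::
    "real \<Rightarrow> real \<Rightarrow> real \<Rightarrow> (nat \<Rightarrow> bool) \<Rightarrow> (nat \<Rightarrow> bool) \<Rightarrow>
     (nat \<Rightarrow> 'n::finite \<Rightarrow> 'a \<Rightarrow> 'a) \<Rightarrow> (nat \<Rightarrow> 'n \<Rightarrow> 'a \<Rightarrow> 'a) \<Rightarrow> (nat \<Rightarrow> 'n \<Rightarrow> 'a \<Rightarrow> 'a) \<Rightarrow>
     'a::real_vector \<Rightarrow> nat \<Rightarrow> ('n, 'a) m4_state" where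
  "m4 \<gamma> \<nu> \<mu> cs cw Cs Cw mb x0 0 =
     \<lparr>server_x = x0, worker_w = (\<lambda>_. x0), worker_x = (\<lambda>_. x0),
      worker_v = (\<lambda>i. mb 0 i x0), server_g = worker_mean (\<lambda>i. mb 0 i x0)\<rparr>"
| "m4 \<gamma> \<nu> \<mu> cs cw Cs Cw mb x0 (Suc k) =
     (let s = m4 \<gamma> \<nu> \<mu> cs cw Cs Cw mb x0 k;
          x' = server_x s - \<gamma> *\<^sub>R server_g s;
          w' = (\<lambda>i. if cs k then x' else worker_w s i + Cs k i (x' - server_x s));
          y' = (\<lambda>i. (1 - \<mu>) *\<^sub>R worker_x s i + \<mu> *\<^sub>R w' i);
          v' = (\<lambda>i. (1 - \<nu>) *\<^sub>R worker_v s i + \<nu> *\<^sub>R mb (Suc k) i (y' i));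
          g' = (if cw k then worker_mean v'
                else server_g s + worker_mean (\<lambda>i. Cw k i (v' i - worker_v s i)))
      in \<lparr>server_x = x', worker_w = w', worker_x = y', worker_v = v', server_g = g'\<rparr>)"

record ('w, 'n, 'd, 'z) m4_random =
  server_coin :: "nat \<Rightarrow> 'w \<Rightarrow> bool"
  worker_coin :: "nat \<Rightarrow> 'w \<Rightarrow> bool"
  server_set :: "nat \<Rightarrow> 'n \<Rightarrow> 'w \<Rightarrow> 'd set"
  worker_set :: "nat \<Rightarrow> 'n \<Rightarrow> 'w \<Rightarrow> 'd set"
  data_sample :: "nat \<Rightarrow> 'n \<Rightarrow> nat \<Rightarrow> 'w \<Rightarrow> 'z"

datatype 'n source =
    Server_Coin nat | Worker_Coin nat | Server_Set nat 'n | Worker_Set nat 'n | Data nat 'n nat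

definition events_of :: "'w measure \<Rightarrow> 'b measure \<Rightarrow> ('w \<Rightarrow> 'b) \<Rightarrow> 'w set set" where
  "events_of M N X = {X -` A \<inter> space M | A. A \<in> sets N}"

primrec source_events ::
    "'w measure \<Rightarrow> ('n \<Rightarrow> 'z measure) \<Rightarrow> ('w, 'n, 'd, 'z) m4_random \<Rightarrow> 'n source \<Rightarrow> 'w set set" where
  "source_events M D R (Server_Coin k) = events_of M (count_space UNIV) (server_coin R k)"
| "source_events M D R (Worker_Coin k) = events_of M (count_space UNIV) (worker_coin R k)"
| "source_events M D R (Server_Set k i) = events_of M (count_space UNIV) (server_set R k i)"
| "source_events M D R (Worker_Set k i) = events_of M (count_space UNIV) (worker_set R k i)"
| "source_events M D R (Data k i r) = events_of M (D i) (data_sample R k i r)"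

text \<open>\<open>batch k\<close> is the number of samples that each worker draws with upper index \<open>k\<close>.\<close>

definition sources :: "(nat \<Rightarrow> nat) \<Rightarrow> 'n source set" where
  "sources batch =
     range Server_Coin \<union> range Worker_Coin \<union>
     {Server_Set k i | k i. True} \<union> {Worker_Set k i | k i. True} \<union>
     {Data k i r | k i r. r \<in> {1..batch k}}"

definition m4_randomness ::
    "'w measure \<Rightarrow> ('n \<Rightarrow> 'z measure) \<Rightarrow> real \<Rightarrow> real \<Rightarrow> nat \<Rightarrow> nat \<Rightarrow> (nat \<Rightarrow> nat) \<Rightarrow>
     ('w, 'n::finite, 'd::finite, 'z) m4_random \<Rightarrow> bool" where
  "m4_randomness M D p\<^sub>s p K\<^sub>s K batch R \<longleftrightarrow>
     prob_space M \<and>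
     (\<forall>k. server_coin R k \<in> M \<rightarrow>\<^sub>M count_space UNIV \<and>
          distr M (count_space UNIV) (server_coin R k) = measure_pmf (bernoulli_pmf p\<^sub>s)) \<and>
     (\<forall>k. worker_coin R k \<in> M \<rightarrow>\<^sub>M count_space UNIV \<and>
          distr M (count_space UNIV) (worker_coin R k) = measure_pmf (bernoulli_pmf p)) \<and>
     (\<forall>k i. server_set R k i \<in> M \<rightarrow>\<^sub>M count_space UNIV \<and>
            distr M (count_space UNIV) (server_set R k i) =
              measure_pmf (pmf_of_set {S :: 'd set. card S = K\<^sub>s})) \<and>
     (\<forall>k i. worker_set R k i \<in> M \<rightarrow>\<^sub>M count_space UNIV \<and>
            distr M (count_space UNIV) (worker_set R k i) =
              measure_pmf (pmf_of_set {S :: 'd set. card S = K})) \<and>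
     (\<forall>k i. \<forall>r\<in>{1..batch k}.
        data_sample R k i r \<in> M \<rightarrow>\<^sub>M D i \<and> distr M (D i) (data_sample R k i r) = D i) \<and>
     prob_space.indep_sets M (source_events M D R) (sources batch)"

definition m4_iterate ::
    "real \<Rightarrow> real \<Rightarrow> real \<Rightarrow> nat \<Rightarrow> nat \<Rightarrow> (nat \<Rightarrow> nat) \<Rightarrow>
     ('n::finite \<Rightarrow> real ^ 'd \<Rightarrow> 'z \<Rightarrow> real ^ 'd) \<Rightarrow> ('w, 'n, 'd::finite, 'z) m4_random \<Rightarrow>
     real ^ 'd \<Rightarrow> nat \<Rightarrow> 'w \<Rightarrow> real ^ 'd" where
  "m4_iterate \<gamma> \<nu> \<mu> K\<^sub>s K batch G R x0 k \<omega> =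
     server_x (m4 \<gamma> \<nu> \<mu>
       (\<lambda>k. server_coin R k \<omega>) (\<lambda>k. worker_coin R k \<omega>)
       (\<lambda>k i. rand_compress K\<^sub>s (server_set R k i \<omega>))
       (\<lambda>k i. rand_compress K (worker_set R k i \<omega>))
       (\<lambda>k i. minibatch (G i) (batch k) (\<lambda>r. data_sample R k i r \<omega>)) x0 k)"

text \<open>
  The output of a run with iterates \<open>X 0, \<dots>, X N\<close> is an iterate whose index is drawn uniformly from
  \<open>{0..N}\<close>, independently of the run; it is a random point on the product space.
\<close>

definition output_space :: "'w measure \<Rightarrow> nat \<Rightarrow> ('w \<times> nat) measure" where
  "output_space M N = M \<Otimes>\<^sub>M measure_pmf (pmf_of_set {0..N})"

text \<open>
  On the outcome \<open>\<omega>\<close>, \<open>tg k i r \<omega>\<close> is the time worker \<open>i\<close> needs for its \<open>r\<close>-th stochastic gradient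
  with upper index \<open>k\<close>; \<open>ts k i \<omega>\<close> and \<open>tw k i \<omega>\<close> are the times per coordinate that communication
  from the server to worker \<open>i\<close> and back takes in iteration \<open>k\<close>. The workers act in parallel, and
  the three phases of an iteration (download, computation, upload) follow each other.
\<close>

definition gradient_time ::
    "(nat \<Rightarrow> nat) \<Rightarrow> (nat \<Rightarrow> 'n::finite \<Rightarrow> nat \<Rightarrow> 'w \<Rightarrow> real) \<Rightarrow> nat \<Rightarrow> 'w \<Rightarrow> real" where
  "gradient_time batch tg k \<omega> = (MAX i. \<Sum>r = 1..batch k. tg k i r \<omega>)"

definition iteration_time ::
    "nat \<Rightarrow> nat \<Rightarrow> (nat \<Rightarrow> nat) \<Rightarrow> ('w, 'n::finite, 'd::finite, 'z) m4_random \<Rightarrow>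
     (nat \<Rightarrow> 'n \<Rightarrow> nat \<Rightarrow> 'w \<Rightarrow> real) \<Rightarrow> (nat \<Rightarrow> 'n \<Rightarrow> 'w \<Rightarrow> real) \<Rightarrow> (nat \<Rightarrow> 'n \<Rightarrow> 'w \<Rightarrow> real) \<Rightarrow>
     nat \<Rightarrow> 'w \<Rightarrow> real" where
  "iteration_time K\<^sub>s K batch R tg ts tw k \<omega> =
     (MAX i. real (if server_coin R k \<omega> then CARD('d) else K\<^sub>s) * ts k i \<omega>)
     + gradient_time batch tg (Suc k) \<omega>
     + (MAX i. real (if worker_coin R k \<omega> then CARD('d) else K) * tw k i \<omega>)"

text \<open>
  The time after which the iterates with indices \<open>0, \<dots>, N\<close> are all known. The starting point is known
  at time \<open>0\<close>, before anything is computed. Charging the initial minibatches for \<open>N = 0\<close> too would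
  make every bound proportional to \<open>F x0 - fstar\<close> false when that gap is close to \<open>0\<close>.
\<close>

definition m4_time ::
    "nat \<Rightarrow> nat \<Rightarrow> (nat \<Rightarrow> nat) \<Rightarrow> ('w, 'n::finite, 'd::finite, 'z) m4_random \<Rightarrow>
     (nat \<Rightarrow> 'n \<Rightarrow> nat \<Rightarrow> 'w \<Rightarrow> real) \<Rightarrow> (nat \<Rightarrow> 'n \<Rightarrow> 'w \<Rightarrow> real) \<Rightarrow> (nat \<Rightarrow> 'n \<Rightarrow> 'w \<Rightarrow> real) \<Rightarrow>
     nat \<Rightarrow> 'w \<Rightarrow> real" where
  "m4_time K\<^sub>s K batch R tg ts tw N \<omega> =
     (if N = 0 then 0
      else gradient_time batch tg 0 \<omega> + (\<Sum>k<N. iteration_time K\<^sub>s K batch R tg ts tw k \<omega>))"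

text \<open>
  \<open>quotient_terms a b\<close> drops a term with denominator \<open>0\<close> from a minimum, i.e. reads it as \<open>+\<infinity>\<close>.
\<close>

definition quotient_terms :: "(real \<Rightarrow> real) \<Rightarrow> real \<Rightarrow> real \<Rightarrow> real set" where
  "quotient_terms \<psi> a b = (if b = 0 then {} else {\<psi> (a / b)})"

definition m4_eta :: "real \<Rightarrow> real \<Rightarrow> real \<Rightarrow> real \<Rightarrow> real \<Rightarrow> real \<Rightarrow> real" where
  "m4_eta n b \<epsilon> \<sigma> \<omega> \<omega>\<^sub>s =
     Min (quotient_terms (\<lambda>q. 1 / 6 * sqrt q) (b * n * \<epsilon>) (\<omega> * (\<omega> + 1) * \<sigma>\<^sup>2) \<union>
          quotient_terms (\<lambda>q. q) (b * n * \<epsilon>) (6 * \<sigma>\<^sup>2) \<union>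
          quotient_terms (root 3) n (\<omega> * (\<omega> + 1) * \<omega>\<^sub>s) \<union>
          {1})"

text \<open>
  \<open>theta c C y z\<close> is \<open>y = \<Theta>(z)\<close> with hidden constants \<open>c\<close> and \<open>C\<close>. Since the dimension and the number
  of workers are types, a hidden constant that is existentially quantified in a theorem could depend on
  them; hidden constants are therefore given as numerals or as explicit functions of others.
\<close>

definition theta :: "real \<Rightarrow> real \<Rightarrow> real \<Rightarrow> real \<Rightarrow> bool" where
  "theta c C y z \<longleftrightarrow> 0 < c \<and> c * z \<le> y \<and> y \<le> C * z"

end

theory Submission
  imports Defs
begin

text \<open>
  The descent lemma shows that an iteration decreases \<open>F\<close>, up to \<open>\<gamma> / 2\<close> times the squared error
  of the search direction \<open>g\<close>, by \<open>\<gamma> / 2\<close> times the squared gradient plus about \<open>1 / (2 * \<gamma>)\<close> times the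
  squared step. Everything rests on bounding the sum of the mean squared errors of \<open>g\<close> by a
  multiple of \<open>A\<close> times the sum of the mean squared steps, \<open>A\<close> being the radicand of the step
  size, plus a fraction of \<open>\<epsilon>\<close> per iteration. As \<open>\<gamma>\<^sup>2 * A\<close> is small, the first part is absorbed by
  the descent (\<open>sum_gradient_le\<close>, \<open>average_gradient\<close>).

  The error of \<open>g\<close> splits into two parts. The momentum error compares the mean of the workers'
  gradient estimators \<open>v\<close> with the gradient of \<open>F\<close> at the server's point. It is a geometric
  average of past changes of the gradient and of the difference between the workers' gradients taken at their own points
  and at the server's point. Functional similarity bounds that difference by the deviations of the
  workers' points, with \<open>L\<^sub>A\<close> for the individual deviations and \<open>L\<^sub>B\<close> for their mean, in which the
  independent compression errors of the workers cancel up to a factor \<open>1 / n\<close> (\<open>sum_momentum_err\<close>).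

  The compression error is the difference between \<open>g\<close> and the mean of the \<open>v\<close>. It is driven by the
  changes of the \<open>v\<close>, hence by the movements of the workers' points (\<open>sum_compress_err\<close>). A crude bound
  of these movements costs a factor of order \<open>\<eta>\<^sup>2 * \<omega>\<^sub>s\<^sup>2\<close>. But the synchronization error \<open>w - x\<close> is nearly a
  martingale, since the conditional mean of its change is only \<open>- p\<^sub>s\<close> times itself, so in the momentum
  average its changes add up in quadrature, and the factor is \<open>1 + \<eta> * \<omega>\<^sub>s\<close> (\<open>gap_step\<close>,
  \<open>sum_move_sq\<close>). The third term in the definition of \<open>\<eta>\<close> is chosen for this product.

  The noise of the initial minibatches decays geometrically. In the compression error it is bounded
  uniformly in time instead of being summed over the \<open>1 / p\<close> iterations between synchronizations
  (\<open>compress_err_le\<close>); only so does the small initial batch suffice.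

  About \<open>\<Delta> / (\<gamma> * \<epsilon>)\<close> iterations are then enough. Since \<open>p * d\<close> and \<open>p\<^sub>s * d\<close> equal the numbers of
  coordinates sent by the compressors, synchronizations at most double the expected communication
  and an iteration lasts at most \<open>5 * t\<close> in expectation (\<open>expected_time\<close>). The choice of \<open>t\<close> balances the
  terms of \<open>sqrt A * t\<close> (\<open>momentum_time\<close>, \<open>step_size_time\<close>).

  In all one-step estimates the fresh randomness is independent of the past and centered, so that it adds its
  variance to the squared norm. \<open>noise_step\<close> derives this from Fubini's theorem for a single source,
  \<open>noise_sum\<close> adds the sources of an iteration one after the other.
\<close>

section \<open>Elementary inequalities\<close>

lemma norm_add_sq_le:
  fixes a b :: "'a::real_inner"
  assumes "0 < s"
  shows "(norm (a + b))\<^sup>2 \<le> (1 + s) * (norm a)\<^sup>2 + (1 + 1 / s) * (norm b)\<^sup>2"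
proof -
  have "0 \<le> (norm (sqrt s *\<^sub>R a - (1 / sqrt s) *\<^sub>R b))\<^sup>2" by simp
  also have "\<dots> = s * (norm a)\<^sup>2 + (1 / s) * (norm b)\<^sup>2 - 2 * (a \<bullet> b)"
    using assms
    by (simp add: power2_norm_eq_inner inner_diff_left inner_diff_right inner_commute
        power2_eq_square[symmetric] power_divide)
  finally show ?thesis
    by (simp add: power2_norm_eq_inner inner_add_left inner_add_right inner_commute algebra_simps)
qed

lemma norm_add_sq_le2:
  fixes a b :: "'a::real_inner"
  shows "(norm (a + b))\<^sup>2 \<le> 2 * (norm a)\<^sup>2 + 2 * (norm b)\<^sup>2"
  using norm_add_sq_le[of 1 a b] by simp

lemma norm_diff_sq_le2:
  fixes a b :: "'a::real_inner"
  shows "(norm (a - b))\<^sup>2 \<le> 2 * (norm a)\<^sup>2 + 2 * (norm b)\<^sup>2"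
  using norm_add_sq_le2[of a "-b"] by simp

text \<open>
  Young's inequality with weight \<open>\<mu>\<close>: the loss \<open>1 + \<mu>\<close> is paid by one of the two factors \<open>1 - \<mu>\<close>.
\<close>

lemma momentum_norm_sq_le:
  fixes a u :: "'a::real_inner"
  assumes "0 < \<mu>" "\<mu> \<le> 1"
  shows "(norm ((1 - \<mu>) *\<^sub>R a + u))\<^sup>2 \<le> (1 - \<mu>) * (norm a)\<^sup>2 + (2 / \<mu>) * (norm u)\<^sup>2"
proof -
  have "(norm ((1 - \<mu>) *\<^sub>R a + u))\<^sup>2 \<le> (1 + \<mu>) * ((1 - \<mu>)\<^sup>2 * (norm a)\<^sup>2) + (1 + 1 / \<mu>) * (norm u)\<^sup>2"
    using norm_add_sq_le[of \<mu> "(1 - \<mu>) *\<^sub>R a" u] assms by (simp add: power_mult_distrib)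
  also have "(1 + \<mu>) * ((1 - \<mu>)\<^sup>2 * (norm a)\<^sup>2) \<le> (1 - \<mu>) * (norm a)\<^sup>2"
  proof -
    have "(1 + \<mu>) * (1 - \<mu>)\<^sup>2 = (1 - \<mu>) * (1 - \<mu>\<^sup>2)" by (simp add: power2_eq_square algebra_simps)
    also have "\<dots> \<le> (1 - \<mu>) * 1" using assms by (intro mult_left_mono) auto
    finally have "(1 + \<mu>) * (1 - \<mu>)\<^sup>2 * (norm a)\<^sup>2 \<le> (1 - \<mu>) * 1 * (norm a)\<^sup>2"
      by (rule mult_right_mono) simp
    thus ?thesis by (simp add: mult.assoc)
  qed
  also have "(1 + 1 / \<mu>) * (norm u)\<^sup>2 \<le> (2 / \<mu>) * (norm u)\<^sup>2"
    using assms by (intro mult_right_mono) (auto simp: field_simps)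
  finally show ?thesis by simp
qed

text \<open>
  A recursion contracting by \<open>1 - q\<close> amplifies the sum of its inputs by at most \<open>1 / q\<close>. The last
  term is allowed on the left because \<open>q * a T\<close> is at most \<open>a T\<close>.
\<close>

lemma sum_geometric_recursion_le:
  fixes a c :: "nat \<Rightarrow> real"
  assumes "0 < q" "q \<le> 1" "\<And>k. 0 \<le> a k" "\<And>k. a (Suc k) \<le> (1 - q) * a k + c k"
  shows "q * (\<Sum>k\<le>T. a k) \<le> a 0 + (\<Sum>k<T. c k)"
proof -
  have "q * (\<Sum>k<T. a k) + a T \<le> a 0 + (\<Sum>k<T. c k)"
  proof (induction T)
    case (Suc T)
    have "q * (\<Sum>k<Suc T. a k) + a (Suc T) = q * (\<Sum>k<T. a k) + q * a T + a (Suc T)"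
      by (simp add: distrib_left)
    also have "\<dots> \<le> q * (\<Sum>k<T. a k) + a T + c T" using assms(4)[of T] by (simp add: algebra_simps)
    also have "\<dots> \<le> a 0 + (\<Sum>k<Suc T. c k)" using Suc by simp
    finally show ?case .
  qed simp
  moreover have "q * a T \<le> 1 * a T" using assms by (intro mult_right_mono) auto
  ultimately show ?thesis by (simp add: lessThan_Suc_atMost[symmetric] distrib_left)
qed

section \<open>Independence\<close>

locale independent_sources = prob_space M for M :: "'w measure" +
  fixes E :: "'s \<Rightarrow> 'w set set" and S :: "'s set"
  assumes independent: "indep_sets E S"
    and stable: "\<And>s. s \<in> S \<Longrightarrow> Int_stable (E s)"
begin

text \<open>
  \<open>gen P\<close> is the information carried by the sources in \<open>P\<close>: a random variable that depends only on
  these sources is one that is measurable with respect to \<open>gen P\<close>.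
\<close>

definition gen :: "'s set \<Rightarrow> 'w measure" where
  "gen P = sigma (space M) (\<Union>s\<in>P. E s)"

lemma E_events: "s \<in> S \<Longrightarrow> E s \<subseteq> events"
  using independent by (auto simp: indep_sets_def)

lemma E_Pow: "P \<subseteq> S \<Longrightarrow> (\<Union>s\<in>P. E s) \<subseteq> Pow (space M)"
  using E_events sets.sets_into_space by blast

lemma space_gen [simp]: "space (gen P) = space M"
  by (simp add: gen_def space_measure_of_conv)

lemma sets_gen: "P \<subseteq> S \<Longrightarrow> sets (gen P) = sigma_sets (space M) (\<Union>s\<in>P. E s)"
  unfolding gen_def by (rule sets_measure_of) (rule E_Pow)

lemma measurable_gen_mono: "f \<in> gen P \<rightarrow>\<^sub>M N \<Longrightarrow> P \<subseteq> Q \<Longrightarrow> Q \<subseteq> S \<Longrightarrow> f \<in> gen Q \<rightarrow>\<^sub>M N"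
  unfolding gen_def using measurable_mono1[of "(\<Union>s\<in>Q. E s)" "space M" "(\<Union>s\<in>P. E s)" "\<lambda>_. 0" N "\<lambda>_. 0"] E_Pow[of Q]
  by blast

lemma measurable_genD: "f \<in> gen P \<rightarrow>\<^sub>M N \<Longrightarrow> P \<subseteq> S \<Longrightarrow> f \<in> M \<rightarrow>\<^sub>M N"
proof -
  assume f: "f \<in> gen P \<rightarrow>\<^sub>M N" and P: "P \<subseteq> S"
  have "sets (gen P) \<subseteq> events"
    unfolding sets_gen[OF P] by (rule sets.sigma_sets_subset) (use P E_events in blast)
  thus ?thesis using f by (auto simp: measurable_def)
qed

lemma measurable_gen_source:
  assumes "s \<in> S" "events_of M N X \<subseteq> E s" "X \<in> M \<rightarrow>\<^sub>M N"
  shows "X \<in> gen {s} \<rightarrow>\<^sub>M N"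
proof (rule measurableI)
  show "X x \<in> space N" if "x \<in> space (gen {s})" for x
    using that assms(3) by (auto simp: measurable_def)
  show "X -` A \<inter> space (gen {s}) \<in> sets (gen {s})" if "A \<in> sets N" for A
  proof -
    have "X -` A \<inter> space M \<in> E s" using assms(2) that by (auto simp: events_of_def)
    thus ?thesis using assms(1) by (simp add: sets_gen)
  qed
qed

text \<open>
  The identity maps into the two \<open>\<sigma>\<close>-algebras represent all random variables that depend on \<open>P\<close> and on \<open>Q\<close>,
  whatever the types of their values.
\<close>

lemma indep_var_gen:
  assumes "P \<subseteq> S" "Q \<subseteq> S" "P \<inter> Q = {}"
  shows "indep_var (gen P) (\<lambda>\<omega>. \<omega>) (gen Q) (\<lambda>\<omega>. \<omega>)"
proof -
  let ?I = "case_bool P Q"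
  have "indep_sets (\<lambda>j. sigma_sets (space M) (\<Union>s\<in>?I j. E s)) UNIV"
  proof (rule indep_sets_collect_sigma)
    show "indep_sets E (\<Union>j\<in>UNIV. ?I j)"
      by (rule indep_sets_mono_index[OF _ independent]) (use assms in \<open>auto split: bool.splits\<close>)
    show "Int_stable (E i)" if "i \<in> ?I j" for i j
      using that stable assms by (auto split: bool.splits)
    show "disjoint_family_on ?I UNIV"
      using assms by (auto simp: disjoint_family_on_def split: bool.splits)
  qed
  hence *: "indep_sets (case_bool (sets (gen P)) (sets (gen Q))) UNIV"
    by (rule indep_sets_mono_sets) (use assms in \<open>auto simp: sets_gen split: bool.splits\<close>)
  have sub: "sigma_sets (space M) {(\<lambda>\<omega>. \<omega>) -` A \<inter> space M |A. A \<in> sets (gen R)} \<subseteq> sets (gen R)" for R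
  proof -
    have "A \<inter> space M = A" if "A \<in> sets (gen R)" for A
      using sets.sets_into_space[OF that] by auto
    hence "sigma_sets (space (gen R)) {(\<lambda>\<omega>. \<omega>) -` A \<inter> space M |A. A \<in> sets (gen R)} \<subseteq> sets (gen R)"
      by (intro sets.sigma_sets_subset) auto
    thus ?thesis by simp
  qed
  have "indep_set (sigma_sets (space M) {(\<lambda>\<omega>. \<omega>) -` A \<inter> space M |A. A \<in> sets (gen P)})
          (sigma_sets (space M) {(\<lambda>\<omega>. \<omega>) -` A \<inter> space M |A. A \<in> sets (gen Q)})"
    unfolding indep_set_def
    by (rule indep_sets_mono_sets[OF *]) (use sub[of P] sub[of Q] in \<open>auto split: bool.splits\<close>)
  thus ?thesis using assms measurable_genD[OF measurable_ident] by (simp add: indep_var_eq id_def)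
qed

lemma nn_integral_decouple:
  assumes sub: "P \<subseteq> S" "Q \<subseteq> S" "P \<inter> Q = {}" and Y: "Y \<in> gen P \<rightarrow>\<^sub>M N1" and Z: "Z \<in> gen Q \<rightarrow>\<^sub>M N2"
    and \<phi>: "\<phi> \<in> borel_measurable (N1 \<Otimes>\<^sub>M N2)"
  shows "(\<integral>\<^sup>+\<omega>. \<phi> (Y \<omega>, Z \<omega>) \<partial>M) = (\<integral>\<^sup>+\<omega>. (\<integral>\<^sup>+\<omega>'. \<phi> (Y \<omega>, Z \<omega>') \<partial>M) \<partial>M)"
proof -
  note [measurable] = \<phi> Y Z
  have [measurable]: "(\<lambda>\<omega>. \<omega>) \<in> M \<rightarrow>\<^sub>M gen P" "(\<lambda>\<omega>. \<omega>) \<in> M \<rightarrow>\<^sub>M gen Q"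
    using measurable_genD[OF measurable_ident, of P] measurable_genD[OF measurable_ident, of Q] sub
    by (auto simp: id_def)
  interpret Q: prob_space "distr M (gen Q) (\<lambda>\<omega>. \<omega>)" by (rule prob_space_distr) measurable
  define \<Phi> where "\<Phi> = (\<lambda>x. \<phi> (Y (fst x), Z (snd x)))"
  have [measurable]: "\<Phi> \<in> borel_measurable (gen P \<Otimes>\<^sub>M gen Q)" unfolding \<Phi>_def by measurable
  have eq: "distr M (gen P \<Otimes>\<^sub>M gen Q) (\<lambda>\<omega>. (\<omega>, \<omega>)) =
      distr M (gen P) (\<lambda>\<omega>. \<omega>) \<Otimes>\<^sub>M distr M (gen Q) (\<lambda>\<omega>. \<omega>)"
    using indep_var_gen[OF sub] by (simp add: indep_var_distribution_eq)
  have "(\<integral>\<^sup>+\<omega>. \<phi> (Y \<omega>, Z \<omega>) \<partial>M) = (\<integral>\<^sup>+x. \<Phi> x \<partial>distr M (gen P \<Otimes>\<^sub>M gen Q) (\<lambda>\<omega>. (\<omega>, \<omega>)))"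
    by (simp add: nn_integral_distr) (simp add: \<Phi>_def)
  also have "\<dots> = (\<integral>\<^sup>+y. (\<integral>\<^sup>+z. \<Phi> (y, z) \<partial>distr M (gen Q) (\<lambda>\<omega>. \<omega>)) \<partial>distr M (gen P) (\<lambda>\<omega>. \<omega>))"
    unfolding eq by (rule Q.nn_integral_fst[symmetric]) measurable
  also have "\<dots> = (\<integral>\<^sup>+\<omega>. (\<integral>\<^sup>+z. \<Phi> (\<omega>, z) \<partial>distr M (gen Q) (\<lambda>\<omega>. \<omega>)) \<partial>M)"
    by (rule nn_integral_distr) measurable
  also have "\<dots> = (\<integral>\<^sup>+\<omega>. (\<integral>\<^sup>+\<omega>'. \<Phi> (\<omega>, \<omega>') \<partial>M) \<partial>M)"
    by (intro nn_integral_cong nn_integral_distr) auto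
  finally show ?thesis by (simp add: \<Phi>_def)
qed

text \<open>
  Conditioning without conditional expectations: an estimate that holds when the past \<open>Y\<close> is frozen at
  any value \<open>y\<close> may be integrated over \<open>Y\<close>. Integrability comes out of the same Tonelli argument, which is
  what lets square integrability be propagated along the run.
\<close>

lemma expectation_decouple_le:
  fixes \<phi> :: "'b \<times> 'c \<Rightarrow> real"
  assumes "P \<subseteq> S" "Q \<subseteq> S" "P \<inter> Q = {}" and Y: "Y \<in> gen P \<rightarrow>\<^sub>M N1" and Z: "Z \<in> gen Q \<rightarrow>\<^sub>M N2"
    and \<phi>: "\<phi> \<in> borel_measurable (N1 \<Otimes>\<^sub>M N2)" and nonneg: "\<And>x. 0 \<le> \<phi> x"
    and int: "\<And>y. y \<in> space N1 \<Longrightarrow> integrable M (\<lambda>\<omega>. \<phi> (y, Z \<omega>))"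
    and le: "\<And>y. y \<in> space N1 \<Longrightarrow> expectation (\<lambda>\<omega>. \<phi> (y, Z \<omega>)) \<le> \<psi> y"
    and \<psi>: "integrable M (\<lambda>\<omega>. \<psi> (Y \<omega>))"
  shows "integrable M (\<lambda>\<omega>. \<phi> (Y \<omega>, Z \<omega>))"
    and "expectation (\<lambda>\<omega>. \<phi> (Y \<omega>, Z \<omega>)) \<le> expectation (\<lambda>\<omega>. \<psi> (Y \<omega>))"
proof -
  note [measurable] = \<phi> measurable_genD[OF Y \<open>P \<subseteq> S\<close>] measurable_genD[OF Z \<open>Q \<subseteq> S\<close>]
  have Ysp: "Y \<omega> \<in> space N1" if "\<omega> \<in> space M" for \<omega>
    using measurable_space[OF measurable_genD[OF Y \<open>P \<subseteq> S\<close>]] that by blast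
  have \<psi>0: "0 \<le> \<psi> (Y \<omega>)" if "\<omega> \<in> space M" for \<omega>
    by (rule order_trans[OF _ le[OF Ysp[OF that]]]) (simp add: nonneg)
  have "(\<integral>\<^sup>+\<omega>. ennreal (\<phi> (Y \<omega>, Z \<omega>)) \<partial>M) = (\<integral>\<^sup>+\<omega>. (\<integral>\<^sup>+\<omega>'. ennreal (\<phi> (Y \<omega>, Z \<omega>')) \<partial>M) \<partial>M)"
    by (rule nn_integral_decouple[OF assms(1-5)]) measurable
  also have "\<dots> \<le> (\<integral>\<^sup>+\<omega>. ennreal (\<psi> (Y \<omega>)) \<partial>M)"
    by (intro nn_integral_mono)
       (simp add: nn_integral_eq_integral[OF int[OF Ysp]] nonneg ennreal_leI le Ysp)
  also have "\<dots> = ennreal (expectation (\<lambda>\<omega>. \<psi> (Y \<omega>)))"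
    by (rule nn_integral_eq_integral[OF \<psi>]) (simp add: \<psi>0)
  finally have le': "(\<integral>\<^sup>+\<omega>. ennreal (\<phi> (Y \<omega>, Z \<omega>)) \<partial>M) \<le> ennreal (expectation (\<lambda>\<omega>. \<psi> (Y \<omega>)))" .
  show int': "integrable M (\<lambda>\<omega>. \<phi> (Y \<omega>, Z \<omega>))"
    by (rule integrableI_nonneg) (use le' nonneg in \<open>auto simp: top_unique intro!: le_less_trans[OF le']\<close>)
  have "0 \<le> expectation (\<lambda>\<omega>. \<psi> (Y \<omega>))"
    using \<psi>0 by (intro integral_nonneg_AE AE_I2) 
  thus "expectation (\<lambda>\<omega>. \<phi> (Y \<omega>, Z \<omega>)) \<le> expectation (\<lambda>\<omega>. \<psi> (Y \<omega>))"
    using le' by (simp add: nn_integral_eq_integral[OF int'] nonneg)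
qed

end

section \<open>Square integrable random vectors\<close>

definition square_integrable :: "'w measure \<Rightarrow> ('w \<Rightarrow> 'a::euclidean_space) \<Rightarrow> bool" where
  "square_integrable M X \<longleftrightarrow> X \<in> borel_measurable M \<and> integrable M (\<lambda>\<omega>. (norm (X \<omega>))\<^sup>2)"

lemma square_integrable_measurable: "square_integrable M X \<Longrightarrow> X \<in> borel_measurable M"
  and square_integrable_integrable: "square_integrable M X \<Longrightarrow> integrable M (\<lambda>\<omega>. (norm (X \<omega>))\<^sup>2)"
  by (auto simp: square_integrable_def)

lemma square_integrable_bound:
  assumes "X \<in> borel_measurable M" "integrable M g" "\<And>\<omega>. (norm (X \<omega>))\<^sup>2 \<le> g \<omega>"
  shows "square_integrable M X"
proof -
  note [measurable] = assms(1)
  have "integrable M (\<lambda>\<omega>. (norm (X \<omega>))\<^sup>2)"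
    by (rule Bochner_Integration.integrable_bound[OF assms(2)])
       (measurable, use assms(3) in \<open>auto intro: order_trans[OF _ abs_ge_self]\<close>)
  thus ?thesis using assms(1) by (simp add: square_integrable_def)
qed

lemma square_integrable_const: "finite_measure M \<Longrightarrow> square_integrable M (\<lambda>_. c)"
  by (simp add: square_integrable_def finite_measure.integrable_const)

lemma square_integrable_scaleR: "square_integrable M X \<Longrightarrow> square_integrable M (\<lambda>\<omega>. c *\<^sub>R X \<omega>)"
  by (auto simp: square_integrable_def power_mult_distrib)

lemma square_integrable_add:
  assumes "square_integrable M X" "square_integrable M Y"
  shows "square_integrable M (\<lambda>\<omega>. X \<omega> + Y \<omega>)"
proof (rule square_integrable_bound)
  show "(norm (X \<omega> + Y \<omega>))\<^sup>2 \<le> 2 * (norm (X \<omega>))\<^sup>2 + 2 * (norm (Y \<omega>))\<^sup>2" for \<omega>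
    by (rule norm_add_sq_le2)
qed (use assms in \<open>auto simp: square_integrable_def\<close>)

lemma square_integrable_diff:
  assumes "square_integrable M X" "square_integrable M Y"
  shows "square_integrable M (\<lambda>\<omega>. X \<omega> - Y \<omega>)"
  using square_integrable_add[OF assms(1) square_integrable_scaleR[OF assms(2), of "-1"]] by simp

lemma square_integrable_sum:
  assumes "finite_measure M" "\<And>i. i \<in> I \<Longrightarrow> square_integrable M (X i)"
  shows "square_integrable M (\<lambda>\<omega>. \<Sum>i\<in>I. X i \<omega>)"
  using assms(2)
proof (induction I rule: infinite_finite_induct)
  case (insert i I)
  thus ?case by (simp add: square_integrable_add)
qed (simp_all add: square_integrable_const assms(1))

lemma square_integrable_worker_mean:
  "finite_measure M \<Longrightarrow> (\<And>i. square_integrable M (X i)) \<Longrightarrow>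
    square_integrable M (\<lambda>\<omega>. worker_mean (\<lambda>i. X i \<omega>))"
  unfolding worker_mean_def by (intro square_integrable_scaleR square_integrable_sum)

lemma square_integrable_if:
  assumes "c \<in> M \<rightarrow>\<^sub>M count_space UNIV" "square_integrable M X" "square_integrable M Y"
  shows "square_integrable M (\<lambda>\<omega>. if c \<omega> then X \<omega> else Y \<omega>)"
proof (rule square_integrable_bound)
  note [measurable] = assms(1) assms(2,3)[THEN square_integrable_measurable]
  show "(\<lambda>\<omega>. if c \<omega> then X \<omega> else Y \<omega>) \<in> borel_measurable M" by measurable
  show "integrable M (\<lambda>\<omega>. (norm (X \<omega>))\<^sup>2 + (norm (Y \<omega>))\<^sup>2)"
    using assms(2,3) by (auto simp: square_integrable_def)
qed auto

lemma square_integrable_Lipschitz: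
  assumes fin: "finite_measure M" and "C-lipschitz_on UNIV g" and "square_integrable M X"
  shows "square_integrable M (\<lambda>\<omega>. g (X \<omega>))"
proof -
  interpret finite_measure M by fact
  have [measurable]: "X \<in> borel_measurable M" "g \<in> borel_measurable borel"
    using assms by (auto simp: square_integrable_def
        intro: borel_measurable_continuous_onI lipschitz_on_continuous_on)
  have "square_integrable M (\<lambda>\<omega>. g (X \<omega>) - g 0)"
  proof (rule square_integrable_bound)
    show "integrable M (\<lambda>\<omega>. C\<^sup>2 * (norm (X \<omega>))\<^sup>2)" using assms(3) by (auto simp: square_integrable_def)
    fix \<omega>
    have "norm (g (X \<omega>) - g 0) \<le> C * norm (X \<omega>)"
      using lipschitz_onD[OF assms(2), of "X \<omega>" 0] by (simp add: dist_norm)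
    thus "(norm (g (X \<omega>) - g 0))\<^sup>2 \<le> C\<^sup>2 * (norm (X \<omega>))\<^sup>2"
      unfolding power_mult_distrib[symmetric] by (rule power_mono) simp
  qed measurable
  from square_integrable_add[OF this square_integrable_const[OF fin, of "g 0"]] show ?thesis by simp
qed

context independent_sources
begin

text \<open>
  With the past frozen, the cross term between \<open>A\<close> and the noise has mean zero.
\<close>

lemma noise_step:
  fixes A :: "'w \<Rightarrow> 'a::euclidean_space" and X :: "'w \<Rightarrow> 'b::euclidean_space"
  assumes sub: "P \<subseteq> S" "Q \<subseteq> S" "P \<inter> Q = {}"
    and A: "A \<in> borel_measurable (gen P)" and X: "X \<in> borel_measurable (gen P)"
    and Z: "Z \<in> gen Q \<rightarrow>\<^sub>M N" and \<zeta>: "\<zeta> \<in> borel_measurable (borel \<Otimes>\<^sub>M N)"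
    and A2: "square_integrable M A"
    and int: "\<And>x. integrable M (\<lambda>\<omega>. \<zeta> (x, Z \<omega>))"
    and centered: "\<And>x. expectation (\<lambda>\<omega>. \<zeta> (x, Z \<omega>)) = 0"
    and int2: "\<And>x. integrable M (\<lambda>\<omega>. (norm (\<zeta> (x, Z \<omega>)))\<^sup>2)"
    and var: "\<And>x. expectation (\<lambda>\<omega>. (norm (\<zeta> (x, Z \<omega>)))\<^sup>2) \<le> s x"
    and s: "integrable M (\<lambda>\<omega>. s (X \<omega>))"
  shows "square_integrable M (\<lambda>\<omega>. A \<omega> + \<zeta> (X \<omega>, Z \<omega>))"
    and "expectation (\<lambda>\<omega>. (norm (A \<omega> + \<zeta> (X \<omega>, Z \<omega>)))\<^sup>2) \<le>
           expectation (\<lambda>\<omega>. (norm (A \<omega>))\<^sup>2) + expectation (\<lambda>\<omega>. s (X \<omega>))"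
proof -
  note [measurable] = A X Z \<zeta>
  let ?\<phi> = "\<lambda>y. (norm (fst (fst y) + \<zeta> (snd (fst y), snd y)))\<^sup>2"
  let ?\<psi> = "\<lambda>y. (norm (fst y))\<^sup>2 + s (snd y)"
  have expand: "(norm (a + \<zeta> (x, Z \<omega>)))\<^sup>2 = (norm a)\<^sup>2 + 2 * (a \<bullet> \<zeta> (x, Z \<omega>)) + (norm (\<zeta> (x, Z \<omega>)))\<^sup>2"
    for a x \<omega>
    by (simp add: power2_norm_eq_inner inner_add_left inner_add_right inner_commute)
  have int': "integrable M (\<lambda>\<omega>. (norm (a + \<zeta> (x, Z \<omega>)))\<^sup>2)" for a x
    unfolding expand using int int2 by (intro Bochner_Integration.integrable_add) auto
  have le': "expectation (\<lambda>\<omega>. (norm (a + \<zeta> (x, Z \<omega>)))\<^sup>2) \<le> (norm a)\<^sup>2 + s x" for a x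
    unfolding expand using int[of x] int2[of x] centered[of x] var[of x]
    by (subst Bochner_Integration.integral_add Bochner_Integration.integral_mult_right)+ (auto simp: prob_space)
  have 1: "integrable M (\<lambda>\<omega>. ?\<psi> (A \<omega>, X \<omega>))"
    using s A2 by (auto simp: square_integrable_def)
  have 2: "integrable M (\<lambda>\<omega>. ?\<phi> (y, Z \<omega>))" for y using int' by simp
  have 3: "expectation (\<lambda>\<omega>. ?\<phi> (y, Z \<omega>)) \<le> ?\<psi> y" for y using le' by simp
  have 4: "(\<lambda>\<omega>. (A \<omega>, X \<omega>)) \<in> gen P \<rightarrow>\<^sub>M (borel \<Otimes>\<^sub>M borel)" by measurable
  have 5: "?\<phi> \<in> borel_measurable ((borel \<Otimes>\<^sub>M borel) \<Otimes>\<^sub>M N)" by measurable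
  have 6: "0 \<le> ?\<phi> y" for y by simp
  note * = expectation_decouple_le[OF sub 4 Z 5 6 2 3 1]
  note [measurable] = measurable_genD[OF A sub(1)] measurable_genD[OF X sub(1)] measurable_genD[OF Z sub(2)]
  show "square_integrable M (\<lambda>\<omega>. A \<omega> + \<zeta> (X \<omega>, Z \<omega>))"
    using *(1) by (auto simp: square_integrable_def)
  show "expectation (\<lambda>\<omega>. (norm (A \<omega> + \<zeta> (X \<omega>, Z \<omega>)))\<^sup>2) \<le>
           expectation (\<lambda>\<omega>. (norm (A \<omega>))\<^sup>2) + expectation (\<lambda>\<omega>. s (X \<omega>))"
    using *(2) s A2 by (simp add: square_integrable_def)
qed

text \<open>
  Independent noises are added one at a time; the ones already added count as past for the next one.
\<close>

lemma noise_sum: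
  fixes A :: "'w \<Rightarrow> 'a::euclidean_space" and X :: "'j \<Rightarrow> 'w \<Rightarrow> 'b::euclidean_space"
  assumes P: "P \<subseteq> S" and A: "A \<in> borel_measurable (gen P)" and A2: "square_integrable M A"
    and J: "finite J" "src ` J \<subseteq> S" "src ` J \<inter> P = {}" "inj_on src J"
    and X: "\<And>j. j \<in> J \<Longrightarrow> X j \<in> borel_measurable (gen P)"
    and Z: "\<And>j. j \<in> J \<Longrightarrow> Z j \<in> gen {src j} \<rightarrow>\<^sub>M N j"
    and \<zeta>: "\<And>j. j \<in> J \<Longrightarrow> \<zeta> j \<in> borel_measurable (borel \<Otimes>\<^sub>M N j)"
    and int: "\<And>j x. j \<in> J \<Longrightarrow> integrable M (\<lambda>\<omega>. \<zeta> j (x, Z j \<omega>))"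
    and centered: "\<And>j x. j \<in> J \<Longrightarrow> expectation (\<lambda>\<omega>. \<zeta> j (x, Z j \<omega>)) = 0"
    and int2: "\<And>j x. j \<in> J \<Longrightarrow> integrable M (\<lambda>\<omega>. (norm (\<zeta> j (x, Z j \<omega>)))\<^sup>2)"
    and var: "\<And>j x. j \<in> J \<Longrightarrow> expectation (\<lambda>\<omega>. (norm (\<zeta> j (x, Z j \<omega>)))\<^sup>2) \<le> s j x"
    and s: "\<And>j. j \<in> J \<Longrightarrow> integrable M (\<lambda>\<omega>. s j (X j \<omega>))"
  shows "(\<lambda>\<omega>. A \<omega> + (\<Sum>j\<in>J. \<zeta> j (X j \<omega>, Z j \<omega>))) \<in> borel_measurable (gen (P \<union> src ` J)) \<and>
         square_integrable M (\<lambda>\<omega>. A \<omega> + (\<Sum>j\<in>J. \<zeta> j (X j \<omega>, Z j \<omega>))) \<and>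
         expectation (\<lambda>\<omega>. (norm (A \<omega> + (\<Sum>j\<in>J. \<zeta> j (X j \<omega>, Z j \<omega>))))\<^sup>2) \<le>
           expectation (\<lambda>\<omega>. (norm (A \<omega>))\<^sup>2) + (\<Sum>j\<in>J. expectation (\<lambda>\<omega>. s j (X j \<omega>)))"
  using J(1) order.refl[of J]
proof (induction J rule: finite_subset_induct')
  case empty
  thus ?case using A A2 by simp
next
  case (insert j I)
  let ?P = "P \<union> src ` I"
  have srcs: "src ` I \<subseteq> src ` J" "src j \<in> src ` J" "src j \<notin> src ` I"
    using insert.hyps(2-4) inj_on_image_mem_iff[OF J(4) insert.hyps(2,3)] by (blast, blast, blast)
  have "src j \<notin> P" using J(3) srcs(2) disjoint_iff by metis
  hence sub: "?P \<subseteq> S" "{src j} \<subseteq> S" "?P \<inter> {src j} = {}" "P \<subseteq> ?P"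
    using Un_least[OF P order_trans[OF srcs(1) J(2)]] subsetD[OF J(2) srcs(2)] srcs(3)
    by simp_all
  have *: "(\<lambda>\<omega>. A \<omega> + (\<Sum>j\<in>I. \<zeta> j (X j \<omega>, Z j \<omega>))) \<in> borel_measurable (gen ?P)"
    "square_integrable M (\<lambda>\<omega>. A \<omega> + (\<Sum>j\<in>I. \<zeta> j (X j \<omega>, Z j \<omega>)))"
    and le: "expectation (\<lambda>\<omega>. (norm (A \<omega> + (\<Sum>j\<in>I. \<zeta> j (X j \<omega>, Z j \<omega>))))\<^sup>2) \<le>
           expectation (\<lambda>\<omega>. (norm (A \<omega>))\<^sup>2) + (\<Sum>j\<in>I. expectation (\<lambda>\<omega>. s j (X j \<omega>)))"
    using insert.IH by blast+
  have Xj: "X j \<in> borel_measurable (gen ?P)" by (rule measurable_gen_mono[OF X sub(4,1)]) fact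
  note jJ = \<open>j \<in> J\<close>
  note step = noise_step[OF sub(1-3) *(1) Xj Z[OF jJ] \<zeta>[OF jJ] *(2) int[OF jJ] centered[OF jJ] int2[OF jJ] var[OF jJ] s[OF jJ]]
  have eq: "A \<omega> + (\<Sum>j\<in>insert j I. \<zeta> j (X j \<omega>, Z j \<omega>)) =
     (A \<omega> + (\<Sum>j\<in>I. \<zeta> j (X j \<omega>, Z j \<omega>))) + \<zeta> j (X j \<omega>, Z j \<omega>)" for \<omega>
    using insert.hyps by (simp add: add_ac)
  have un: "P \<union> src ` insert j I \<subseteq> S" "?P \<subseteq> P \<union> src ` insert j I" "{src j} \<subseteq> P \<union> src ` insert j I"
    using sub by auto
  have meas: "(\<lambda>\<omega>. (A \<omega> + (\<Sum>j\<in>I. \<zeta> j (X j \<omega>, Z j \<omega>))) + \<zeta> j (X j \<omega>, Z j \<omega>))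
      \<in> borel_measurable (gen (P \<union> src ` insert j I))"
    by (intro borel_measurable_add measurable_gen_mono[OF *(1) un(2,1)]
        measurable_compose[OF measurable_Pair \<zeta>[OF jJ]]
        measurable_gen_mono[OF Xj un(2,1)] measurable_gen_mono[OF Z[OF jJ] un(3,1)])
  show ?case
    unfolding eq using meas step le insert.hyps(1,4) by simp
qed

lemma expectation_coin:
  fixes U V :: "'w \<Rightarrow> real"
  assumes sub: "P \<subseteq> S" "Q \<subseteq> S" "P \<inter> Q = {}"
    and c: "c \<in> gen Q \<rightarrow>\<^sub>M count_space UNIV" and prob: "prob {\<omega> \<in> space M. c \<omega>} = q"
    and U: "U \<in> borel_measurable (gen P)" "integrable M U"
    and V: "V \<in> borel_measurable (gen P)" "integrable M V"
  shows "expectation (\<lambda>\<omega>. if c \<omega> then U \<omega> else V \<omega>) = q * expectation U + (1 - q) * expectation V"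
proof -
  have cM [measurable]: "c \<in> M \<rightarrow>\<^sub>M count_space UNIV" by (rule measurable_genD[OF c sub(2)])
  let ?I = "\<lambda>b \<omega>. of_bool (c \<omega> = b) :: real"
  have ind: "indep_var borel W borel (?I b)" if "W \<in> borel_measurable (gen P)" for W :: "'w \<Rightarrow> real" and b
  proof -
    have "(?I b) \<in> borel_measurable (gen Q)" using c by measurable
    from indep_var_compose[OF indep_var_gen[OF sub] that this] show ?thesis
      by (simp add: comp_def)
  qed
  have intI: "integrable M (?I b)" for b
    by (rule integrable_const_bound[where B = 1]) auto
  have E1: "expectation (?I True) = q"
  proof -
    have "expectation (?I True) = expectation (indicator {\<omega> \<in> space M. c \<omega>})"
      by (rule Bochner_Integration.integral_cong) (auto simp: indicator_def)
    thus ?thesis using prob by simp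
  qed
  have E2: "expectation (?I False) = 1 - q"
  proof -
    have "expectation (?I False) = expectation (\<lambda>\<omega>. 1 - ?I True \<omega>)"
      by (rule Bochner_Integration.integral_cong) auto
    thus ?thesis using E1 intI[of True] by (simp add: prob_space)
  qed
  have "expectation (\<lambda>\<omega>. if c \<omega> then U \<omega> else V \<omega>) = expectation (\<lambda>\<omega>. U \<omega> * ?I True \<omega> + V \<omega> * ?I False \<omega>)"
    by (rule Bochner_Integration.integral_cong) auto
  also have "\<dots> = expectation (\<lambda>\<omega>. U \<omega> * ?I True \<omega>) + expectation (\<lambda>\<omega>. V \<omega> * ?I False \<omega>)"
    by (rule Bochner_Integration.integral_add; rule indep_var_integrable[OF ind]) (rule U V intI)+
  also have "\<dots> = expectation U * q + expectation V * (1 - q)"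
    using indep_var_lebesgue_integral[OF ind[OF U(1), of True] U(2) intI]
      indep_var_lebesgue_integral[OF ind[OF V(1), of False] V(2) intI] E1 E2 by simp
  finally show ?thesis by (simp add: mult.commute)
qed

end

section \<open>Random sparsification\<close>

text \<open>
  Double counting of the pairs \<open>(j, S)\<close> with \<open>j \<in> S\<close>, in the form of the absorption identity of binomial
  coefficients.
\<close>

lemma card_subsets_containing:
  fixes j :: "'d::finite"
  assumes "K \<le> CARD('d)"
  shows "real (card {S :: 'd set. card S = K \<and> j \<in> S}) * real CARD('d) =
         real K * real (card {S :: 'd set. card S = K})"
proof -
  have all: "card {S :: 'd set. card S = K} = CARD('d) choose K"
    using n_subsets[of "UNIV :: 'd set" K] by simp
  show ?thesis
  proof (cases K)
    case 0
    hence "{S :: 'd set. card S = K \<and> j \<in> S} = {}" by auto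
    thus ?thesis using 0 by simp
  next
    case (Suc K')
    have "bij_betw (insert j) {B. B \<subseteq> UNIV - {j} \<and> card B = K'} {S. card S = K \<and> j \<in> S}"
      by (rule bij_betw_byWitness[where f' = "\<lambda>S. S - {j}"]) (auto simp: Suc card_insert_if subset_Diff_insert)
    hence "card {S :: 'd set. card S = K \<and> j \<in> S} = card {B. B \<subseteq> UNIV - {j} \<and> card B = K'}"
      by (simp add: bij_betw_same_card)
    also have "\<dots> = (CARD('d) - 1) choose K'"
      by (subst n_subsets) (auto simp: card_Diff_singleton)
    finally have one: "card {S :: 'd set. card S = K \<and> j \<in> S} = (CARD('d) - 1) choose K'" .
    have "Suc K' * (Suc (CARD('d) - 1) choose Suc K') = Suc (CARD('d) - 1) * ((CARD('d) - 1) choose K')"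
      by (rule Suc_times_binomial)
    hence "K * (CARD('d) choose K) = CARD('d) * ((CARD('d) - 1) choose K')"
      using Suc by simp
    thus ?thesis unfolding one all by (metis mult.commute of_nat_mult)
  qed
qed

lemma rand_compress_nth:
  "rand_compress K S x $ j = (if j \<in> S then real CARD('d) / real K * x $ j else 0)"
  for x :: "real ^ 'd::finite"
  by (auto simp: rand_compress_def axis_def if_distrib[of "\<lambda>z. _ * z"] cong: if_cong)

lemma norm_sq_vec: "(norm x)\<^sup>2 = (\<Sum>j\<in>UNIV. (x $ j)\<^sup>2)" for x :: "real ^ 'd::finite"
  by (simp add: norm_vec_def L2_set_def sum_nonneg)

lemma expectation_uniform_subset:
  fixes K :: nat and j :: "'d::finite" and u v :: real
  assumes K: "1 \<le> K" "K \<le> CARD('d)"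
  shows "(\<integral>S. (if j \<in> S then u else v) \<partial>measure_pmf (pmf_of_set {S :: 'd set. card S = K})) =
         real K / real CARD('d) * u + (1 - real K / real CARD('d)) * v"
proof -
  let ?A = "{S :: 'd set. card S = K}"
  have ne: "?A \<noteq> {}"
    using obtain_subset_with_card_n[of K "UNIV :: 'd set"] K by auto
  have pos: "card ?A > 0" using ne by (simp add: card_gt_0_iff)
  have "(\<Sum>S\<in>?A. if j \<in> S then u else v) =
      real (card (?A \<inter> {S. j \<in> S})) * u + real (card (?A \<inter> - {S. j \<in> S})) * v"
    by (subst sum.If_cases) auto
  also have "card (?A \<inter> {S. j \<in> S}) = card {S :: 'd set. card S = K \<and> j \<in> S}"
    by (rule arg_cong[of _ _ card]) auto
  also have "card (?A \<inter> - {S. j \<in> S}) = card ?A - card {S :: 'd set. card S = K \<and> j \<in> S}"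
    by (subst card_Diff_subset[symmetric]) (auto intro!: arg_cong[of _ _ card])
  also have "real (card ?A - card {S :: 'd set. card S = K \<and> j \<in> S}) =
      real (card ?A) - real (card {S :: 'd set. card S = K \<and> j \<in> S})"
    by (rule of_nat_diff) (auto intro: card_mono)
  also have "real (card {S :: 'd set. card S = K \<and> j \<in> S}) = real K / real CARD('d) * card ?A"
    using card_subsets_containing[OF K(2), of j] by (simp add: field_simps)
  finally have "(\<Sum>S\<in>?A. if j \<in> S then u else v) =
     card ?A * (real K / real CARD('d) * u + (1 - real K / real CARD('d)) * v)"
    by (simp add: algebra_simps)
  thus ?thesis using pos ne by (subst integral_pmf_of_set[OF ne]) auto
qed

text \<open>
  Coordinatewise, the compression error is \<open>d / K - 1\<close> with probability \<open>K / d\<close> and \<open>- 1\<close> otherwise, in units of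
  the coordinate.
\<close>

lemma expectation_rand_compress:
  fixes x :: "real ^ 'd::finite"
  assumes K: "1 \<le> K" "K \<le> CARD('d)"
  shows "(\<integral>S. rand_compress K S x - x \<partial>measure_pmf (pmf_of_set {S :: 'd set. card S = K})) = 0"
    and "(\<integral>S. (norm (rand_compress K S x - x))\<^sup>2 \<partial>measure_pmf (pmf_of_set {S :: 'd set. card S = K})) =
         (real CARD('d) / real K - 1) * (norm x)\<^sup>2"
proof -
  let ?\<mu> = "measure_pmf (pmf_of_set {S :: 'd set. card S = K})" and ?c = "real CARD('d) / real K"
  have int: "integrable ?\<mu> h" for h :: "'d set \<Rightarrow> 'b::{banach,second_countable_topology}"
    by (rule integrable_measure_pmf_finite) simp
  have c: "real K / real CARD('d) * ?c = 1" using K by simp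
  show "(\<integral>S. rand_compress K S x - x \<partial>?\<mu>) = 0"
  proof (rule vec_eq_iff[THEN iffD2], rule allI)
    fix j
    have "(\<integral>S. rand_compress K S x - x \<partial>?\<mu>) $ j = (\<integral>S. (rand_compress K S x - x) $ j \<partial>?\<mu>)"
      by (rule integral_bounded_linear[OF bounded_linear_vec_nth int, symmetric])
    also have "\<dots> = (\<integral>S. (if j \<in> S then (?c - 1) * x $ j else - x $ j) \<partial>?\<mu>)"
      by (rule Bochner_Integration.integral_cong) (auto simp: rand_compress_nth algebra_simps)
    also have "\<dots> = 0"
      unfolding expectation_uniform_subset[OF K] using K by (simp add: field_simps)
    finally show "(\<integral>S. rand_compress K S x - x \<partial>?\<mu>) $ j = 0 $ j" by simp
  qed
  have "(\<integral>S. (norm (rand_compress K S x - x))\<^sup>2 \<partial>?\<mu>) = (\<integral>S. (\<Sum>j\<in>UNIV. ((rand_compress K S x - x) $ j)\<^sup>2) \<partial>?\<mu>)"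
    by (simp only: norm_sq_vec)
  also have "\<dots> = (\<Sum>j\<in>UNIV. \<integral>S. ((rand_compress K S x - x) $ j)\<^sup>2 \<partial>?\<mu>)"
    by (rule Bochner_Integration.integral_sum) (rule int)
  also have "\<dots> = (\<Sum>j\<in>UNIV. (?c - 1) * (x $ j)\<^sup>2)"
  proof (rule sum.cong[OF refl])
    fix j
    have "(\<integral>S. ((rand_compress K S x - x) $ j)\<^sup>2 \<partial>?\<mu>) =
          (\<integral>S. (if j \<in> S then (?c - 1)\<^sup>2 * (x $ j)\<^sup>2 else (x $ j)\<^sup>2) \<partial>?\<mu>)"
      by (rule Bochner_Integration.integral_cong)
         (auto simp: rand_compress_nth power_mult_distrib[symmetric] left_diff_distrib)
    also have "\<dots> = (?c - 1) * (x $ j)\<^sup>2"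
    proof -
      have "real K / real CARD('d) * (?c - 1)\<^sup>2 + (1 - real K / real CARD('d)) = ?c - 1"
        using K by (simp add: power2_eq_square field_simps)
      thus ?thesis unfolding expectation_uniform_subset[OF K] 
        by (metis (no_types, opaque_lifting) distrib_right mult.assoc)
    qed
    finally show "(\<integral>S. ((rand_compress K S x - x) $ j)\<^sup>2 \<partial>?\<mu>) = (?c - 1) * (x $ j)\<^sup>2" .
  qed
  finally show "(\<integral>S. (norm (rand_compress K S x - x))\<^sup>2 \<partial>?\<mu>) = (?c - 1) * (norm x)\<^sup>2"
    by (simp add: norm_sq_vec sum_distrib_left)
qed

section \<open>Smooth functions\<close>

lemma gradient_eqI: "GDERIV \<phi> x :> D \<Longrightarrow> gradient \<phi> x = D"
proof -
  assume D: "GDERIV \<phi> x :> D"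
  have "D' = D" if "GDERIV \<phi> x :> D'" for D'
  proof -
    have "(\<lambda>h. h \<bullet> D') = (\<lambda>h. h \<bullet> D)"
      using that D unfolding gderiv_def by (rule has_derivative_unique)
    hence "(D' - D) \<bullet> D' = (D' - D) \<bullet> D" by (rule fun_cong)
    hence "(D' - D) \<bullet> (D' - D) = 0" by (simp add: inner_diff_right)
    thus ?thesis by simp
  qed
  thus ?thesis unfolding gradient_def using D by (intro the_equality)
qed

lemma gradient_worker_mean:
  fixes f :: "'n::finite \<Rightarrow> 'a::real_inner \<Rightarrow> real"
  assumes "\<And>i. smooth (Li i) (f i)"
  shows "GDERIV (\<lambda>x. worker_mean (\<lambda>i. f i x)) x :> worker_mean (\<lambda>i. gradient (f i) x)"
    and "gradient (\<lambda>x. worker_mean (\<lambda>i. f i x)) x = worker_mean (\<lambda>i. gradient (f i) x)"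
proof -
  have "(f i has_derivative (\<lambda>h. h \<bullet> gradient (f i) x)) (at x)" for i
    using assms[of i] by (simp add: smooth_def gderiv_def)
  hence "((\<lambda>x. worker_mean (\<lambda>i. f i x)) has_derivative
     (\<lambda>h. (1 / real CARD('n)) *\<^sub>R (\<Sum>i\<in>UNIV. h \<bullet> gradient (f i) x))) (at x)"
    unfolding worker_mean_def by (intro has_derivative_scaleR_right has_derivative_sum)
  thus "GDERIV (\<lambda>x. worker_mean (\<lambda>i. f i x)) x :> worker_mean (\<lambda>i. gradient (f i) x)"
    by (simp add: gderiv_def worker_mean_def inner_sum_right)
  thus "gradient (\<lambda>x. worker_mean (\<lambda>i. f i x)) x = worker_mean (\<lambda>i. gradient (f i) x)"
    by (rule gradient_eqI)
qed

lemma norm_worker_mean_le: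
  fixes u :: "'n::finite \<Rightarrow> 'a::real_normed_vector"
  assumes "\<And>i. norm (u i) \<le> c"
  shows "norm (worker_mean u) \<le> c"
proof -
  have "norm (worker_mean u) = (1 / real CARD('n)) * norm (\<Sum>i\<in>UNIV. u i)"
    by (simp add: worker_mean_def)
  also have "\<dots> \<le> (1 / real CARD('n)) * (\<Sum>i\<in>(UNIV::'n set). c)"
    by (intro mult_left_mono order_trans[OF norm_sum] sum_mono assms) simp
  finally show ?thesis by simp
qed

lemma smooth_worker_mean:
  fixes f :: "'n::finite \<Rightarrow> 'a::real_inner \<Rightarrow> real"
  assumes "\<And>i. smooth (Li i) (f i)" "\<And>i. Li i \<le> C"
  shows "smooth C (\<lambda>x. worker_mean (\<lambda>i. f i x))"
  unfolding smooth_def gradient_worker_mean(2)[OF assms(1)]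
proof (intro conjI allI lipschitz_onI gradient_worker_mean(1)[OF assms(1)])
  have lip: "(Li i)-lipschitz_on UNIV (gradient (f i))" for i using assms(1) by (simp add: smooth_def)
  show "0 \<le> C" using lipschitz_on_nonneg[OF lip] assms(2) by (meson order_trans)
  fix x y :: 'a
  have "norm (gradient (f i) x - gradient (f i) y) \<le> C * norm (x - y)" for i
    using lipschitz_onD[OF lip[of i], of x y] assms(2)[of i]
    by (simp add: dist_norm) (meson mult_right_mono norm_ge_zero order_trans)
  hence "norm (worker_mean (\<lambda>i. gradient (f i) x - gradient (f i) y)) \<le> C * norm (x - y)"
    by (rule norm_worker_mean_le)
  thus "dist (worker_mean (\<lambda>i. gradient (f i) x)) (worker_mean (\<lambda>i. gradient (f i) y)) \<le> C * dist x y"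
    by (simp add: dist_norm worker_mean_def sum_subtractf scaleR_diff_right)
qed

lemma smooth_upper_bound:
  fixes \<phi> :: "'a::real_inner \<Rightarrow> real"
  assumes "smooth C \<phi>"
  shows "\<phi> (x + v) \<le> \<phi> x + gradient \<phi> x \<bullet> v + C / 2 * (norm v)\<^sup>2"
proof -
  have lip: "C-lipschitz_on UNIV (gradient \<phi>)" using assms by (simp add: smooth_def)
  define \<psi> where "\<psi> t = \<phi> (x + t *\<^sub>R v) - t * (gradient \<phi> x \<bullet> v) - C / 2 * t\<^sup>2 * (norm v)\<^sup>2" for t
  have der: "(\<psi> has_real_derivative
      (gradient \<phi> (x + t *\<^sub>R v) \<bullet> v - gradient \<phi> x \<bullet> v - C * t * (norm v)\<^sup>2)) (at t)" for t
  proof -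
    have "(\<phi> has_derivative (\<lambda>h. h \<bullet> gradient \<phi> (x + t *\<^sub>R v))) (at (x + t *\<^sub>R v))"
      using assms by (simp add: smooth_def gderiv_def)
    hence "((\<lambda>t. \<phi> (x + t *\<^sub>R v)) has_derivative (\<lambda>h. (h *\<^sub>R v) \<bullet> gradient \<phi> (x + t *\<^sub>R v))) (at t)"
      by (rule has_derivative_compose[rotated]) (auto intro!: derivative_eq_intros)
    hence "((\<lambda>t. \<phi> (x + t *\<^sub>R v)) has_real_derivative (gradient \<phi> (x + t *\<^sub>R v) \<bullet> v)) (at t)"
      by (simp add: has_field_derivative_def inner_commute mult.commute[of _ "_ \<bullet> _"])
    thus ?thesis unfolding \<psi>_def by (auto intro!: derivative_eq_intros simp: power2_eq_square)
  qed
  have "\<psi> 1 \<le> \<psi> 0"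
  proof (rule DERIV_nonpos_imp_nonincreasing[of 0 1])
    fix t :: real assume t: "0 \<le> t" "t \<le> 1"
    have "gradient \<phi> (x + t *\<^sub>R v) \<bullet> v - gradient \<phi> x \<bullet> v \<le> norm (gradient \<phi> (x + t *\<^sub>R v) - gradient \<phi> x) * norm v"
      unfolding inner_diff_left[symmetric] by (rule norm_cauchy_schwarz)
    also have "\<dots> \<le> (C * norm (t *\<^sub>R v)) * norm v"
      using lipschitz_onD[OF lip, of "x + t *\<^sub>R v" x] by (intro mult_right_mono) (auto simp: dist_norm)
    also have "\<dots> = C * t * (norm v)\<^sup>2" using t by (simp add: power2_eq_square)
    finally show "\<exists>y. (\<psi> has_real_derivative y) (at t) \<and> y \<le> 0" using der by force
  qed simp
  thus ?thesis by (simp add: \<psi>_def)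
qed

text \<open>
  One gradient step of length \<open>1 / C\<close> decreases \<open>\<phi>\<close> by the squared gradient over \<open>2 * C\<close>, but not below \<open>m\<close>.
\<close>

lemma smooth_gradient_bound:
  fixes \<phi> :: "'a::real_inner \<Rightarrow> real"
  assumes "smooth C \<phi>" "0 < C" "\<And>x. m \<le> \<phi> x"
  shows "(norm (gradient \<phi> x))\<^sup>2 \<le> 2 * C * (\<phi> x - m)"
proof -
  have "m \<le> \<phi> (x + (- (1 / C) *\<^sub>R gradient \<phi> x))" by (rule assms(3))
  also have "\<dots> \<le> \<phi> x - (1 / C) * (norm (gradient \<phi> x))\<^sup>2 + C / 2 * ((1 / C)\<^sup>2 * (norm (gradient \<phi> x))\<^sup>2)"
    using smooth_upper_bound[OF assms(1), of x "- (1 / C) *\<^sub>R gradient \<phi> x"] assms(2)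
    by (simp add: power2_norm_eq_inner[symmetric] power_divide)
  also have "\<dots> = \<phi> x - (norm (gradient \<phi> x))\<^sup>2 / (2 * C)"
    using assms(2) by (simp add: field_simps power2_eq_square)
  finally show ?thesis using assms(2) by (simp add: field_simps)
qed

section \<open>The method as a random process\<close>

lemma Int_stable_events_of: "Int_stable (events_of M N X)"
proof (rule Int_stableI)
  fix A B assume "A \<in> events_of M N X" "B \<in> events_of M N X"
  then obtain A' B' where "A = X -` A' \<inter> space M" "B = X -` B' \<inter> space M" "A' \<in> sets N" "B' \<in> sets N"
    by (auto simp: events_of_def)
  hence "A \<inter> B = X -` (A' \<inter> B') \<inter> space M" "A' \<inter> B' \<in> sets N" by auto
  thus "A \<inter> B \<in> events_of M N X" unfolding events_of_def by blast
qed

lemma norm_rand_compress_le: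
  "norm (rand_compress K S x) \<le> real CARD('d) / real K * norm x" for x :: "real ^ 'd::finite"
proof (rule power2_le_imp_le)
  have "(norm (rand_compress K S x))\<^sup>2 \<le> (\<Sum>j\<in>UNIV. (real CARD('d) / real K * x $ j)\<^sup>2)"
    unfolding norm_sq_vec by (rule sum_mono) (auto simp: rand_compress_nth)
  also have "\<dots> = (real CARD('d) / real K * norm x)\<^sup>2"
    unfolding power_mult_distrib norm_sq_vec by (simp add: sum_distrib_left)
  finally show "(norm (rand_compress K S x))\<^sup>2 \<le> (real CARD('d) / real K * norm x)\<^sup>2" .
qed simp

lemma measurable_rand_compress:
  fixes X :: "'w \<Rightarrow> real ^ 'd::finite"
  assumes "S \<in> N \<rightarrow>\<^sub>M count_space UNIV" "X \<in> borel_measurable N"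
  shows "(\<lambda>\<omega>. rand_compress K (S \<omega>) (X \<omega>)) \<in> borel_measurable N"
proof (rule measurable_compose_countable'[OF _ assms(1)])
  fix S' :: "'d set"
  have "continuous_on UNIV (rand_compress K S' :: real ^ 'd \<Rightarrow> _)"
    unfolding rand_compress_def by (intro continuous_intros)
  from measurable_compose[OF assms(2) borel_measurable_continuous_onI[OF this]]
  show "(\<lambda>\<omega>. rand_compress K S' (X \<omega>)) \<in> borel_measurable N" .
qed (simp add: countable_finite)

lemma worker_mean_sum: "worker_mean u = (\<Sum>i\<in>UNIV. (1 / real CARD('n)) *\<^sub>R u i)" for u :: "'n::finite \<Rightarrow> 'a::real_vector"
  by (simp add: worker_mean_def scaleR_sum_right)

lemma worker_mean_add: "worker_mean (\<lambda>i. u i + v i) = worker_mean u + worker_mean v"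
  and worker_mean_diff: "worker_mean (\<lambda>i. u i - v i) = worker_mean u - worker_mean v"
  and worker_mean_scaleR: "worker_mean (\<lambda>i. c *\<^sub>R u i) = c *\<^sub>R worker_mean u"
  and worker_mean_const: "worker_mean (\<lambda>i. x) = x"
  for u v :: "'n::finite \<Rightarrow> 'a::real_vector"
  by (simp_all add: worker_mean_def sum.distrib sum_subtractf scaleR_add_right scaleR_diff_right
      scaleR_sum_right[symmetric] sum_constant_scaleR)

lemma worker_mean_mult: "worker_mean (\<lambda>i. c * u i) = c * worker_mean u" for u :: "'n::finite \<Rightarrow> real"
  using worker_mean_scaleR[of c u] by simp

lemma worker_mean_mono: "(\<And>i. u i \<le> v i) \<Longrightarrow> worker_mean u \<le> worker_mean v" for u v :: "'n::finite \<Rightarrow> real"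
  by (auto simp: worker_mean_def intro!: divide_right_mono sum_mono)

lemma worker_mean_nonneg: "(\<And>i. 0 \<le> u i) \<Longrightarrow> 0 \<le> worker_mean u" for u :: "'n::finite \<Rightarrow> real"
  by (auto simp: worker_mean_def intro!: divide_nonneg_nonneg sum_nonneg)

text \<open>
  The two momentum parameters are kept apart, because they play different roles: \<open>\<mu>\<close> smooths the
  workers' points and \<open>\<nu>\<close> their gradient estimators. The constant \<open>L\<close> is a common smoothness constant of the
  \<open>f i\<close>.
\<close>

locale m4_run =
  fixes M :: "'w measure"
    and R :: "('w, 'n::finite, 'd::finite, 'z) m4_random"
    and D :: "'n \<Rightarrow> 'z measure"
    and f :: "'n \<Rightarrow> real ^ 'd \<Rightarrow> real"
    and G :: "'n \<Rightarrow> real ^ 'd \<Rightarrow> 'z \<Rightarrow> real ^ 'd"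
    and x0 :: "real ^ 'd"
    and \<gamma> \<nu> \<mu> \<sigma> p p\<^sub>s \<omega> \<omega>\<^sub>s L L\<^sub>A L\<^sub>B :: real and K K\<^sub>s b :: nat and batch :: "nat \<Rightarrow> nat"
  assumes randomness: "m4_randomness M D p\<^sub>s p K\<^sub>s K batch R"
    and stoch_grad: "\<And>i. stochastic_gradient (D i) \<sigma> (f i) (G i)"
    and f_smooth: "\<And>i. smooth L (f i)"
    and similarity: "functional_similarity f L\<^sub>A L\<^sub>B"
    and K: "1 \<le> K" "K \<le> CARD('d)" "1 \<le> K\<^sub>s" "K\<^sub>s \<le> CARD('d)"
    and \<omega>: "\<omega> = real CARD('d) / real K - 1" "p = 1 / (\<omega> + 1)"
    and \<omega>\<^sub>s: "\<omega>\<^sub>s = real CARD('d) / real K\<^sub>s - 1" "p\<^sub>s = 1 / (\<omega>\<^sub>s + 1)"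
    and batch: "1 \<le> batch 0" "1 \<le> b" "\<And>k. batch (Suc k) = b"
    and momentum: "0 < \<nu>" "\<nu> \<le> 1" "0 < \<mu>" "\<mu> \<le> 1"
begin

lemma \<omega>_nonneg: "0 \<le> \<omega>" "0 \<le> \<omega>\<^sub>s"
  using K by (auto simp: \<omega>(1) \<omega>\<^sub>s(1) field_simps)

lemma p_bounds: "0 < p" "p \<le> 1" "0 < p\<^sub>s" "p\<^sub>s \<le> 1"
  using \<omega>_nonneg by (auto simp: \<omega>(2) \<omega>\<^sub>s(2))

lemma batch_pos: "1 \<le> batch k"
  using batch by (cases k) auto

sublocale independent_sources M "source_events M D R" "sources batch"
proof -
  interpret prob_space M using randomness by (simp add: m4_randomness_def)
  show "independent_sources M (source_events M D R) (sources batch)"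
  proof
    show "indep_sets (source_events M D R) (sources batch)"
      using randomness by (simp add: m4_randomness_def)
    show "Int_stable (source_events M D R s)" for s
      by (cases s) (simp_all add: Int_stable_events_of)
  qed
qed

abbreviation state :: "nat \<Rightarrow> 'w \<Rightarrow> ('n, real ^ 'd) m4_state" where
  "state k \<xi> \<equiv> m4 \<gamma> \<nu> \<mu>
       (\<lambda>k. server_coin R k \<xi>) (\<lambda>k. worker_coin R k \<xi>)
       (\<lambda>k i. rand_compress K\<^sub>s (server_set R k i \<xi>))
       (\<lambda>k i. rand_compress K (worker_set R k i \<xi>))
       (\<lambda>k i. minibatch (G i) (batch k) (\<lambda>r. data_sample R k i r \<xi>)) x0 k"

text \<open>
  \<open>y k i\<close> is the point at which worker \<open>i\<close> evaluates its gradients, \<open>w k i\<close> its copy of the server's point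
  \<open>x k\<close>, which is maintained by compressed updates.
\<close>

definition x :: "nat \<Rightarrow> 'w \<Rightarrow> real ^ 'd" where "x k \<xi> = server_x (state k \<xi>)"
definition w :: "nat \<Rightarrow> 'n \<Rightarrow> 'w \<Rightarrow> real ^ 'd" where "w k i \<xi> = worker_w (state k \<xi>) i"
definition y :: "nat \<Rightarrow> 'n \<Rightarrow> 'w \<Rightarrow> real ^ 'd" where "y k i \<xi> = worker_x (state k \<xi>) i"
definition v :: "nat \<Rightarrow> 'n \<Rightarrow> 'w \<Rightarrow> real ^ 'd" where "v k i \<xi> = worker_v (state k \<xi>) i"
definition g :: "nat \<Rightarrow> 'w \<Rightarrow> real ^ 'd" where "g k \<xi> = server_g (state k \<xi>)"
definition mb :: "nat \<Rightarrow> 'n \<Rightarrow> 'w \<Rightarrow> real ^ 'd \<Rightarrow> real ^ 'd" where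
  "mb k i \<xi> = minibatch (G i) (batch k) (\<lambda>r. data_sample R k i r \<xi>)"
definition dx :: "nat \<Rightarrow> 'w \<Rightarrow> real ^ 'd" where "dx k \<xi> = x (Suc k) \<xi> - x k \<xi>"

lemma iterate_eq: "m4_iterate \<gamma> \<nu> \<mu> K\<^sub>s K batch G R x0 k \<xi> = x k \<xi>"
  by (simp add: m4_iterate_def x_def)

lemma start: "x 0 \<xi> = x0" "w 0 i \<xi> = x0" "y 0 i \<xi> = x0" "v 0 i \<xi> = mb 0 i \<xi> x0"
  "g 0 \<xi> = worker_mean (\<lambda>i. v 0 i \<xi>)"
  by (simp_all add: x_def w_def y_def v_def g_def mb_def)

lemma x_Suc: "x (Suc k) \<xi> = x k \<xi> - \<gamma> *\<^sub>R g k \<xi>"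
  by (simp add: x_def g_def Let_def)

lemma dx_eq: "dx k \<xi> = - \<gamma> *\<^sub>R g k \<xi>"
  by (simp add: dx_def x_Suc)

lemma w_Suc: "w (Suc k) i \<xi> = (if server_coin R k \<xi> then x (Suc k) \<xi>
    else w k i \<xi> + rand_compress K\<^sub>s (server_set R k i \<xi>) (dx k \<xi>))"
  by (simp add: x_def g_def w_def dx_def Let_def)

lemma y_Suc: "y (Suc k) i \<xi> = (1 - \<mu>) *\<^sub>R y k i \<xi> + \<mu> *\<^sub>R w (Suc k) i \<xi>"
  by (simp add: y_def w_def Let_def)

lemma v_Suc: "v (Suc k) i \<xi> = (1 - \<nu>) *\<^sub>R v k i \<xi> + \<nu> *\<^sub>R mb (Suc k) i \<xi> (y (Suc k) i \<xi>)"
  by (simp add: y_def v_def mb_def Let_def)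

lemma g_Suc: "g (Suc k) \<xi> = (if worker_coin R k \<xi> then worker_mean (\<lambda>i. v (Suc k) i \<xi>)
    else g k \<xi> + worker_mean (\<lambda>i. rand_compress K (worker_set R k i \<xi>) (v (Suc k) i \<xi> - v k i \<xi>)))"
  by (simp add: g_def v_def Let_def)

text \<open>
  The order in which the sources are revealed. The state with index \<open>k\<close> depends on the stamps up to
  \<open>5 * k\<close>; iteration \<open>k\<close> then reveals the server's sets, the server's coin, the data with index \<open>Suc k\<close>, the
  workers' sets and the workers' coin. A coin comes after the sets of its phase, so that the two branches of
  the phase are known before it is tossed. For \<open>k = 0\<close> the stamp of the data truncates to \<open>0\<close>.
\<close>

primrec stamp :: "'n source \<Rightarrow> nat" where
  "stamp (Server_Set k i) = 5 * k + 1"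
| "stamp (Server_Coin k) = 5 * k + 2"
| "stamp (Data k i r) = 5 * k - 2"
| "stamp (Worker_Set k i) = 5 * k + 4"
| "stamp (Worker_Coin k) = 5 * k + 5"

definition history :: "nat \<Rightarrow> 'n source set" where
  "history m = {s \<in> sources batch. stamp s \<le> m}"

lemma history_sources: "history m \<subseteq> sources batch"
  by (auto simp: history_def)

lemma source_mem:
  "Server_Coin k \<in> sources batch" "Worker_Coin k \<in> sources batch" "Server_Set k i \<in> sources batch"
  "Worker_Set k i \<in> sources batch" "r \<in> {1..batch k} \<Longrightarrow> Data k i r \<in> sources batch"
  by (auto simp: sources_def)

lemma measurable_history_mono: "h \<in> gen (history m) \<rightarrow>\<^sub>M N \<Longrightarrow> m \<le> m' \<Longrightarrow> h \<in> gen (history m') \<rightarrow>\<^sub>M N"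
  by (rule measurable_gen_mono) (auto simp: history_def)

lemma measurable_historyD: "h \<in> gen (history m) \<rightarrow>\<^sub>M N \<Longrightarrow> h \<in> M \<rightarrow>\<^sub>M N"
  by (rule measurable_genD) (auto simp: history_def)

lemma server_coin_gen: "server_coin R k \<in> gen {Server_Coin k} \<rightarrow>\<^sub>M count_space UNIV"
  and worker_coin_gen: "worker_coin R k \<in> gen {Worker_Coin k} \<rightarrow>\<^sub>M count_space UNIV"
  and server_set_gen: "server_set R k i \<in> gen {Server_Set k i} \<rightarrow>\<^sub>M count_space UNIV"
  and worker_set_gen: "worker_set R k i \<in> gen {Worker_Set k i} \<rightarrow>\<^sub>M count_space UNIV"
  and data_gen: "r \<in> {1..batch k} \<Longrightarrow> data_sample R k i r \<in> gen {Data k i r} \<rightarrow>\<^sub>M D i"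
  using randomness by (auto intro!: measurable_gen_source source_mem simp: m4_randomness_def)

lemma measurable_source_history: "h \<in> gen {s} \<rightarrow>\<^sub>M N \<Longrightarrow> s \<in> sources batch \<Longrightarrow> stamp s \<le> m \<Longrightarrow> h \<in> gen (history m) \<rightarrow>\<^sub>M N"
  by (rule measurable_gen_mono) (auto simp: history_def)

lemma prob_server_coin: "prob {\<xi> \<in> space M. server_coin R k \<xi>} = p\<^sub>s"
  and prob_worker_coin: "prob {\<xi> \<in> space M. worker_coin R k \<xi>} = p"
proof -
  have *: "prob {\<xi> \<in> space M. c \<xi>} = q"
    if [measurable]: "c \<in> M \<rightarrow>\<^sub>M count_space UNIV"
      and "distr M (count_space UNIV) c = measure_pmf (bernoulli_pmf q)" and q: "0 \<le> q" "q \<le> 1"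
    for c :: "'w \<Rightarrow> bool" and q
  proof -
    have "prob {\<xi> \<in> space M. c \<xi>} = measure (distr M (count_space UNIV) c) {True}"
      by (subst measure_distr) (auto intro!: arg_cong[of _ _ prob])
    also have "\<dots> = pmf (bernoulli_pmf q) True" unfolding that(2) by (simp add: measure_pmf_single)
    finally show ?thesis using q by simp
  qed
  show "prob {\<xi> \<in> space M. server_coin R k \<xi>} = p\<^sub>s" "prob {\<xi> \<in> space M. worker_coin R k \<xi>} = p"
    using randomness p_bounds by (auto simp: m4_randomness_def intro!: *)
qed

lemma finite_M: "finite_measure M" by unfold_locales

lemma grad_Lipschitz: "L-lipschitz_on UNIV (gradient (f i))"
  using f_smooth by (simp add: smooth_def)

lemma grad_diff_le: "(norm (gradient (f i) u - gradient (f i) u'))\<^sup>2 \<le> L\<^sup>2 * (norm (u - u'))\<^sup>2"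
  unfolding power_mult_distrib[symmetric]
  using lipschitz_onD[OF grad_Lipschitz, of u u' i] by (intro power_mono) (auto simp: dist_norm)

lemma grad_measurable [measurable]: "gradient (f i) \<in> borel_measurable borel"
  by (intro borel_measurable_continuous_onI lipschitz_on_continuous_on[OF grad_Lipschitz])

text \<open>
  The weights \<open>\<beta>\<close> cover at once a single worker (an indicator) and the mean over the workers (the constant
  \<open>1 / n\<close>), where independence gains a factor \<open>1 / n\<close>.
\<close>

lemma compressor_noise:
  fixes Z :: "'n \<Rightarrow> 'w \<Rightarrow> 'd set" and A :: "'w \<Rightarrow> real ^ 'd" and \<beta> :: "'n \<Rightarrow> real"
    and X :: "'n \<Rightarrow> 'w \<Rightarrow> real ^ 'd"
  assumes P: "P \<subseteq> sources batch" and A: "A \<in> borel_measurable (gen P)" "square_integrable M A"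
    and src: "range src \<subseteq> sources batch" "range src \<inter> P = {}" "inj src"
    and X: "\<And>i. X i \<in> borel_measurable (gen P)" "\<And>i. square_integrable M (X i)"
    and Z: "\<And>i. Z i \<in> gen {src i} \<rightarrow>\<^sub>M count_space UNIV"
      "\<And>i. distr M (count_space UNIV) (Z i) = measure_pmf (pmf_of_set {S. card S = \<kappa>})"
    and \<kappa>: "1 \<le> \<kappa>" "\<kappa> \<le> CARD('d)"
  defines "T \<equiv> \<lambda>\<xi>. A \<xi> + (\<Sum>i\<in>UNIV. \<beta> i *\<^sub>R (rand_compress \<kappa> (Z i \<xi>) (X i \<xi>) - X i \<xi>))"
  shows "T \<in> borel_measurable (gen (P \<union> range src))" "square_integrable M T"
    "expectation (\<lambda>\<xi>. (norm (T \<xi>))\<^sup>2) \<le> expectation (\<lambda>\<xi>. (norm (A \<xi>))\<^sup>2) +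
       (\<Sum>i\<in>UNIV. (\<beta> i)\<^sup>2 * ((real CARD('d) / real \<kappa> - 1) * expectation (\<lambda>\<xi>. (norm (X i \<xi>))\<^sup>2)))"
proof -
  let ?c = "real CARD('d) / real \<kappa> - 1"
  define \<zeta> where "\<zeta> i a = \<beta> i *\<^sub>R (rand_compress \<kappa> (snd a) (fst a) - fst a)" for i and a :: "(real ^ 'd) \<times> 'd set"
  define s where "s i a = (\<beta> i)\<^sup>2 * (?c * (norm a)\<^sup>2)" for i and a :: "real ^ 'd"
  have Zm: "Z i \<in> M \<rightarrow>\<^sub>M count_space UNIV" for i
    using measurable_genD[OF Z(1)] src(1) by blast
  have int: "integrable M (\<lambda>\<xi>. h (Z i \<xi>))" for h :: "'d set \<Rightarrow> 'b::{banach,second_countable_topology}" and i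
  proof -
    have "integrable (distr M (count_space UNIV) (Z i)) h"
      unfolding Z(2) by (rule integrable_measure_pmf_finite) simp
    thus ?thesis using Zm by (simp add: integrable_distr_eq)
  qed
  have E: "expectation (\<lambda>\<xi>. h (Z i \<xi>)) = (\<integral>S. h S \<partial>measure_pmf (pmf_of_set {S. card S = \<kappa>}))"
    for h :: "'d set \<Rightarrow> 'b::{banach,second_countable_topology}" and i
    unfolding Z(2)[of i, symmetric] using Zm by (simp add: integral_distr)
  have \<zeta>m: "\<zeta> i \<in> borel_measurable (borel \<Otimes>\<^sub>M count_space UNIV)" for i
    unfolding \<zeta>_def by (intro borel_measurable_scaleR borel_measurable_diff measurable_rand_compress) measurable
  have i1: "integrable M (\<lambda>\<xi>. \<zeta> i (a, Z i \<xi>))" for i a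
    by (rule int[of "\<lambda>S. \<zeta> i (a, S)" i])
  have i2: "integrable M (\<lambda>\<xi>. (norm (\<zeta> i (a, Z i \<xi>)))\<^sup>2)" for i a
    by (rule int[of "\<lambda>S. (norm (\<zeta> i (a, S)))\<^sup>2" i])
  have c1: "expectation (\<lambda>\<xi>. \<zeta> i (a, Z i \<xi>)) = 0" for i a
    using expectation_rand_compress(1)[OF \<kappa>, of a]
    by (subst E[of "\<lambda>S. \<zeta> i (a, S)" i]) (simp add: \<zeta>_def)
  have c2: "expectation (\<lambda>\<xi>. (norm (\<zeta> i (a, Z i \<xi>)))\<^sup>2) \<le> s i a" for i a
    using expectation_rand_compress(2)[OF \<kappa>, of a]
    by (subst E[of "\<lambda>S. (norm (\<zeta> i (a, S)))\<^sup>2" i]) (simp add: \<zeta>_def s_def power_mult_distrib)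
  have sint: "integrable M (\<lambda>\<xi>. s i (X i \<xi>))" for i
    unfolding s_def using square_integrable_integrable[OF X(2)] by auto
  have T: "T = (\<lambda>\<xi>. A \<xi> + (\<Sum>i\<in>UNIV. \<zeta> i (X i \<xi>, Z i \<xi>)))"
    by (simp add: T_def \<zeta>_def fun_eq_iff)
  have fin: "finite (UNIV :: 'n set)" by simp
  note N = noise_sum[OF P A(1,2) fin src X(1) Z(1) \<zeta>m i1 c1
      i2 c2 sint]
  show "T \<in> borel_measurable (gen (P \<union> range src))" "square_integrable M T"
    using N by (simp_all add: T)
  have "expectation (\<lambda>\<xi>. s i (X i \<xi>)) = (\<beta> i)\<^sup>2 * (?c * expectation (\<lambda>\<xi>. (norm (X i \<xi>))\<^sup>2))" for i
    by (simp add: s_def)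
  thus "expectation (\<lambda>\<xi>. (norm (T \<xi>))\<^sup>2) \<le> expectation (\<lambda>\<xi>. (norm (A \<xi>))\<^sup>2) +
       (\<Sum>i\<in>UNIV. (\<beta> i)\<^sup>2 * (?c * expectation (\<lambda>\<xi>. (norm (X i \<xi>))\<^sup>2)))"
    using N by (simp add: T)
qed

text \<open>
  Each sample contributes its own centered noise, so a batch divides the variance by its size.
\<close>

lemma data_noise:
  fixes A :: "'w \<Rightarrow> real ^ 'd" and \<beta> :: "'n \<Rightarrow> real" and X :: "'n \<Rightarrow> 'w \<Rightarrow> real ^ 'd"
  assumes P: "P \<subseteq> sources batch" "\<And>i r. Data k i r \<notin> P"
    and A: "A \<in> borel_measurable (gen P)" "square_integrable M A"
    and X: "\<And>i. X i \<in> borel_measurable (gen P)"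
  defines "T \<equiv> \<lambda>\<xi>. A \<xi> + (\<Sum>i\<in>UNIV. \<beta> i *\<^sub>R (mb k i \<xi> (X i \<xi>) - gradient (f i) (X i \<xi>)))"
  shows "T \<in> borel_measurable (gen (P \<union> {Data k i r | i r. r \<in> {1..batch k}}))" "square_integrable M T"
    "expectation (\<lambda>\<xi>. (norm (T \<xi>))\<^sup>2) \<le>
       expectation (\<lambda>\<xi>. (norm (A \<xi>))\<^sup>2) + (\<Sum>i\<in>UNIV. (\<beta> i)\<^sup>2) * (\<sigma>\<^sup>2 / real (batch k))"
proof -
  define J where "J = (UNIV :: 'n set) \<times> {1..batch k}"
  define src :: "'n \<times> nat \<Rightarrow> 'n source" where "src j = Data k (fst j) (snd j)" for j
  define \<zeta> where "\<zeta> j a = (\<beta> (fst j) / real (batch k)) *\<^sub>R (G (fst j) (fst a) (snd a) - gradient (f (fst j)) (fst a))"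
    for j :: "'n \<times> nat" and a :: "(real ^ 'd) \<times> 'z"
  define s where "s j a = (\<beta> (fst j) / real (batch k))\<^sup>2 * \<sigma>\<^sup>2" for j :: "'n \<times> nat" and a :: "real ^ 'd"
  define Z where "Z j = data_sample R k (fst j) (snd j)" for j
  have srcs: "src ` J \<subseteq> sources batch" "src ` J \<inter> P = {}" "inj_on src J" "finite J"
    and srcJ: "src ` J = {Data k i r | i r. r \<in> {1..batch k}}"
    using P by (auto simp: src_def J_def inj_on_def source_mem image_iff)
  have Zm: "Z j \<in> gen {src j} \<rightarrow>\<^sub>M D (fst j)" if "j \<in> J" for j
    using that by (auto simp: Z_def src_def J_def intro!: data_gen)
  have Zm' [measurable]: "Z j \<in> M \<rightarrow>\<^sub>M D (fst j)" if "j \<in> J" for j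
    using measurable_genD[OF Zm[OF that]] srcs(1) that by blast
  have Zd: "distr M (D (fst j)) (Z j) = D (fst j)" if "j \<in> J" for j
    using that randomness by (auto simp: Z_def J_def m4_randomness_def)
  have Gm [measurable]: "(\<lambda>(a, z). G i a z) \<in> borel_measurable (borel \<Otimes>\<^sub>M D i)" for i
    using stoch_grad by (simp add: stochastic_gradient_def)
  have Gi: "integrable (D i) (G i a)" and GE: "(\<integral>z. G i a z \<partial>D i) = gradient (f i) a"
    and G2: "integrable (D i) (\<lambda>z. (norm (G i a z - gradient (f i) a))\<^sup>2)"
    and GV: "(\<integral>z. (norm (G i a z - gradient (f i) a))\<^sup>2 \<partial>D i) \<le> \<sigma>\<^sup>2"
    and pD: "prob_space (D i)" for i a
    using stoch_grad by (auto simp: stochastic_gradient_def)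
  have \<zeta>m: "\<zeta> j \<in> borel_measurable (borel \<Otimes>\<^sub>M D (fst j))" for j
    unfolding \<zeta>_def by measurable
  have Gm': "(\<lambda>z. G i a z) \<in> borel_measurable (D i)" for i a
    using Gi by (rule borel_measurable_integrable)
  have intD: "integrable M (\<lambda>\<xi>. h (Z j \<xi>))" and ED: "expectation (\<lambda>\<xi>. h (Z j \<xi>)) = (\<integral>z. h z \<partial>D (fst j))"
    if "integrable (D (fst j)) h" "j \<in> J" for h :: "'z \<Rightarrow> 'b::{banach,second_countable_topology}" and j
  proof -
    have hm: "h \<in> borel_measurable (D (fst j))" using that(1) by (rule borel_measurable_integrable)
    have "integrable (distr M (D (fst j)) (Z j)) h" using that by (simp add: Zd)
    thus "integrable M (\<lambda>\<xi>. h (Z j \<xi>))" using integrable_distr_eq[OF Zm'[OF that(2)] hm] by simp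
    show "expectation (\<lambda>\<xi>. h (Z j \<xi>)) = (\<integral>z. h z \<partial>D (fst j))"
      using integral_distr[OF Zm'[OF that(2)] hm] Zd[OF that(2)] by simp
  qed
  have dc: "integrable (D i) (\<lambda>_. c :: real ^ 'd)" "(\<integral>z. c \<partial>D i) = c" for i and c :: "real ^ 'd"
    using pD[of i] by (simp_all add: finite_measure.integrable_const prob_space.finite_measure prob_space.prob_space)
  have i1: "integrable (D (fst j)) (\<lambda>z. \<zeta> j (a, z))" for j a
    unfolding \<zeta>_def using Gi[of "fst j" a] dc by simp
  have e1: "(\<integral>z. \<zeta> j (a, z) \<partial>D (fst j)) = 0" for j a
    unfolding \<zeta>_def using Gi[of "fst j" a] dc by (simp add: GE)
  have nz: "(norm (\<zeta> j (a, z)))\<^sup>2 = (\<beta> (fst j) / real (batch k))\<^sup>2 * (norm (G (fst j) a z - gradient (f (fst j)) a))\<^sup>2"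
    for j a z
    by (simp add: \<zeta>_def power_mult_distrib power_divide)
  have i2: "integrable (D (fst j)) (\<lambda>z. (norm (\<zeta> j (a, z)))\<^sup>2)" for j a
    unfolding nz using G2[of "fst j" a] by simp
  have e2: "(\<integral>z. (norm (\<zeta> j (a, z)))\<^sup>2 \<partial>D (fst j)) \<le> s j a" for j a
    unfolding nz s_def using mult_left_mono[OF GV[of "fst j" a], of "(\<beta> (fst j) / real (batch k))\<^sup>2"]
    by simp
  have c1: "expectation (\<lambda>\<xi>. \<zeta> j (a, Z j \<xi>)) = 0" if "j \<in> J" for j a
    using ED[OF i1 that] e1 by metis
  have c2: "expectation (\<lambda>\<xi>. (norm (\<zeta> j (a, Z j \<xi>)))\<^sup>2) \<le> s j a" if "j \<in> J" for j a
    using ED[OF i2 that] e2 by metis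
  have sint: "integrable M (\<lambda>\<xi>. s j (X (fst j) \<xi>))" for j
    unfolding s_def by simp
  have T: "T = (\<lambda>\<xi>. A \<xi> + (\<Sum>j\<in>J. \<zeta> j (X (fst j) \<xi>, Z j \<xi>)))"
  proof
    fix \<xi>
    have "(\<Sum>j\<in>J. \<zeta> j (X (fst j) \<xi>, Z j \<xi>)) =
       (\<Sum>i\<in>UNIV. \<Sum>r = 1..batch k. \<zeta> (i, r) (X i \<xi>, Z (i, r) \<xi>))"
      unfolding J_def by (subst sum.cartesian_product) (simp add: case_prod_unfold)
    also have "\<dots> = (\<Sum>i\<in>UNIV. \<beta> i *\<^sub>R (mb k i \<xi> (X i \<xi>) - gradient (f i) (X i \<xi>)))"
    proof (rule sum.cong[OF refl])
      fix i
      have "(\<Sum>r = 1..batch k. \<zeta> (i, r) (X i \<xi>, Z (i, r) \<xi>)) =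
        (\<beta> i / real (batch k)) *\<^sub>R (\<Sum>r = 1..batch k. G i (X i \<xi>) (Z (i, r) \<xi>) - gradient (f i) (X i \<xi>))"
        by (simp add: \<zeta>_def scaleR_sum_right)
      also have "(\<Sum>r = 1..batch k. G i (X i \<xi>) (Z (i, r) \<xi>) - gradient (f i) (X i \<xi>)) =
          real (batch k) *\<^sub>R (mb k i \<xi> (X i \<xi>) - gradient (f i) (X i \<xi>))"
        using batch_pos[of k]
        by (simp add: mb_def minibatch_def Z_def sum_subtractf scaleR_diff_right sum_constant_scaleR
            del: sum_constant)
      finally show "(\<Sum>r = 1..batch k. \<zeta> (i, r) (X i \<xi>, Z (i, r) \<xi>)) =
          \<beta> i *\<^sub>R (mb k i \<xi> (X i \<xi>) - gradient (f i) (X i \<xi>))"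
        using batch_pos[of k] by simp
    qed
    finally show "T \<xi> = A \<xi> + (\<Sum>j\<in>J. \<zeta> j (X (fst j) \<xi>, Z j \<xi>))" by (simp add: T_def)
  qed
  have N: "T \<in> borel_measurable (gen (P \<union> src ` J)) \<and> square_integrable M T \<and>
     expectation (\<lambda>\<xi>. (norm (T \<xi>))\<^sup>2) \<le>
       expectation (\<lambda>\<xi>. (norm (A \<xi>))\<^sup>2) + (\<Sum>j\<in>J. expectation (\<lambda>\<xi>. s j (X (fst j) \<xi>)))"
    unfolding T
    by (rule noise_sum[where N = "\<lambda>j. D (fst j)", OF P(1) A(1,2) srcs(4,1-3) X Zm \<zeta>m _ c1 _ c2 sint])
       (use intD[OF i1] intD[OF i2] in auto)
  show "T \<in> borel_measurable (gen (P \<union> {Data k i r | i r. r \<in> {1..batch k}}))" "square_integrable M T"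
    using N unfolding srcJ by auto
  have "(\<Sum>j\<in>J. expectation (\<lambda>\<xi>. s j (X (fst j) \<xi>))) =
      (\<Sum>i\<in>UNIV. \<Sum>r = 1..batch k. (\<beta> i / real (batch k))\<^sup>2 * \<sigma>\<^sup>2)"
    unfolding J_def s_def by (subst sum.cartesian_product) (simp add: case_prod_unfold prob_space)
  also have "\<dots> = (\<Sum>i\<in>UNIV. (\<beta> i)\<^sup>2) * (\<sigma>\<^sup>2 / real (batch k))"
    using batch_pos[of k] unfolding sum_distrib_right
    by (intro sum.cong) (simp_all add: power_divide power2_eq_square)
  finally show "expectation (\<lambda>\<xi>. (norm (T \<xi>))\<^sup>2) \<le>
       expectation (\<lambda>\<xi>. (norm (A \<xi>))\<^sup>2) + (\<Sum>i\<in>UNIV. (\<beta> i)\<^sup>2) * (\<sigma>\<^sup>2 / real (batch k))"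
    using N by simp
qed

end

lemma sum_single_scaleR:
  "(\<Sum>j\<in>UNIV. (if j = i then c else 0) *\<^sub>R u j) = c *\<^sub>R u i" for u :: "'n::finite \<Rightarrow> 'a::real_vector"
proof -
  have "(\<Sum>j\<in>UNIV. (if j = i then c else 0) *\<^sub>R u j) = (\<Sum>j\<in>UNIV. if j = i then c *\<^sub>R u j else 0)"
    by (rule sum.cong) auto
  thus ?thesis by simp
qed

lemma sum_single_mult:
  "(\<Sum>j\<in>UNIV. (if j = i then c else 0)\<^sup>2 * u j) = c\<^sup>2 * u i" for u :: "'n::finite \<Rightarrow> real"
proof -
  have "(\<Sum>j\<in>UNIV. (if j = i then c else 0)\<^sup>2 * u j) = (\<Sum>j\<in>UNIV. if j = i then c\<^sup>2 * u j else 0)"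
    by (rule sum.cong) auto
  thus ?thesis by simp
qed

lemma sum_mean_mult:
  "(\<Sum>j\<in>UNIV. (c / real CARD('n))\<^sup>2 * u j) = c\<^sup>2 / real CARD('n) * worker_mean u" for u :: "'n::finite \<Rightarrow> real"
  unfolding sum_distrib_left[symmetric] by (simp add: worker_mean_def power2_eq_square)

context m4_run
begin

section \<open>Square integrability of the run\<close>

lemma square_integrable_compress:
  fixes X :: "'w \<Rightarrow> real ^ 'd"
  assumes "Z \<in> M \<rightarrow>\<^sub>M count_space UNIV" "square_integrable M X"
  shows "square_integrable M (\<lambda>\<xi>. rand_compress \<kappa> (Z \<xi>) (X \<xi>))"
proof (rule square_integrable_bound)
  show "(\<lambda>\<xi>. rand_compress \<kappa> (Z \<xi>) (X \<xi>)) \<in> borel_measurable M"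
    by (rule measurable_rand_compress[OF assms(1) square_integrable_measurable[OF assms(2)]])
  show "integrable M (\<lambda>\<xi>. (real CARD('d) / real \<kappa>)\<^sup>2 * (norm (X \<xi>))\<^sup>2)"
    using square_integrable_integrable[OF assms(2)] by simp
  show "(norm (rand_compress \<kappa> (Z \<xi>) (X \<xi>)))\<^sup>2 \<le> (real CARD('d) / real \<kappa>)\<^sup>2 * (norm (X \<xi>))\<^sup>2" for \<xi>
    unfolding power_mult_distrib[symmetric] by (rule power_mono[OF norm_rand_compress_le]) simp
qed

text \<open>
  The two properties that every quantity of the run must have for the noise lemmas to apply to it after the
  stamp \<open>m\<close>.
\<close>

definition regular :: "nat \<Rightarrow> ('w \<Rightarrow> real ^ 'd) \<Rightarrow> bool" where
  "regular m X \<longleftrightarrow> X \<in> borel_measurable (gen (history m)) \<and> square_integrable M X"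

lemma regular_mono: "regular m X \<Longrightarrow> m \<le> m' \<Longrightarrow> regular m' X"
  by (auto simp: regular_def intro: measurable_history_mono)

lemma regular_measurable: "regular m X \<Longrightarrow> X \<in> borel_measurable (gen (history m))"
  and regular_L2: "regular m X \<Longrightarrow> square_integrable M X"
  by (auto simp: regular_def)

lemma regular_const: "regular m (\<lambda>_. c)"
  by (simp add: regular_def square_integrable_const finite_M)

lemma regular_scaleR: "regular m X \<Longrightarrow> regular m (\<lambda>\<xi>. c *\<^sub>R X \<xi>)"
  by (auto simp: regular_def square_integrable_scaleR)

lemma regular_add: "regular m X \<Longrightarrow> regular m Y \<Longrightarrow> regular m (\<lambda>\<xi>. X \<xi> + Y \<xi>)"
  by (auto simp: regular_def square_integrable_add)

lemma regular_diff: "regular m X \<Longrightarrow> regular m Y \<Longrightarrow> regular m (\<lambda>\<xi>. X \<xi> - Y \<xi>)"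
  by (auto simp: regular_def square_integrable_diff)

lemma regular_sum: "(\<And>i. i \<in> I \<Longrightarrow> regular m (X i)) \<Longrightarrow> regular m (\<lambda>\<xi>. \<Sum>i\<in>I. X i \<xi>)"
  unfolding regular_def by (intro conjI borel_measurable_sum square_integrable_sum[OF finite_M]) auto

lemma regular_worker_mean: "(\<And>i. regular m (X i)) \<Longrightarrow> regular m (\<lambda>\<xi>. worker_mean (\<lambda>i. X i \<xi>))"
  unfolding worker_mean_def by (intro regular_scaleR regular_sum)

lemma regular_gradient: "regular m X \<Longrightarrow> regular m (\<lambda>\<xi>. gradient (f i) (X \<xi>))"
  by (auto simp: regular_def intro: square_integrable_Lipschitz[OF finite_M grad_Lipschitz])

lemma regular_compress:
  fixes X :: "'w \<Rightarrow> real ^ 'd"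
  assumes "Z \<in> gen (history m) \<rightarrow>\<^sub>M count_space UNIV" "regular m X"
  shows "regular m (\<lambda>\<xi>. rand_compress \<kappa> (Z \<xi>) (X \<xi>))"
  using assms square_integrable_compress[OF measurable_historyD[OF assms(1)]]
  by (auto simp: regular_def intro!: measurable_rand_compress)

lemma regular_if:
  assumes c: "c \<in> gen (history m) \<rightarrow>\<^sub>M count_space UNIV" and "regular m X" "regular m Y"
  shows "regular m (\<lambda>\<xi>. if c \<xi> then X \<xi> else Y \<xi>)"
proof -
  note [measurable] = c assms(2,3)[THEN regular_measurable]
  show ?thesis
    using square_integrable_if[OF measurable_historyD[OF c] assms(2,3)[THEN regular_L2]]
    by (simp add: regular_def)
qed

lemmas regular_intros = regular_scaleR regular_add regular_diff regular_worker_mean regular_gradient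

text \<open>
  A minibatch gradient at the random points \<open>X\<close> is the exact gradient plus data noise. At the start the
  points are constant, so nothing has to be known before the data with index \<open>0\<close>, whose stamp is \<open>0\<close>.
\<close>

lemma regular_minibatch:
  assumes X: "\<And>i. regular m (X i)" and "m < 5 * k - 2 \<or> k = 0 \<and> m = 0 \<and> (\<forall>i. \<exists>c. X i = (\<lambda>_. c))"
  shows "regular (max m (5 * k - 2)) (\<lambda>\<xi>. mb k i \<xi> (X i \<xi>))"
proof -
  let ?\<beta> = "\<lambda>j. if j = i then 1 else 0 :: real"
  define P where "P = (if k = 0 then {} else history m)"
  have P: "P \<subseteq> sources batch" "Data k i r \<notin> P" "P \<subseteq> history (max m (5 * k - 2))" for i r
    using assms(2) by (auto simp: P_def history_def)
  have Xm: "X j \<in> borel_measurable (gen P)" for j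
  proof (cases "k = 0")
    case True
    then obtain c where "X j = (\<lambda>_. c)" using assms(2) by auto
    thus ?thesis by simp
  qed (use X in \<open>auto simp: P_def regular_def\<close>)
  have A: "(\<lambda>\<xi>. gradient (f i) (X i \<xi>)) \<in> borel_measurable (gen P)"
    by (rule measurable_compose[OF Xm grad_measurable])
  have "mb k i \<xi> (X i \<xi>) = gradient (f i) (X i \<xi>) +
      (\<Sum>j\<in>UNIV. ?\<beta> j *\<^sub>R (mb k j \<xi> (X j \<xi>) - gradient (f j) (X j \<xi>)))" for \<xi>
    by (simp add: sum_single_scaleR)
  hence eq: "(\<lambda>\<xi>. mb k i \<xi> (X i \<xi>)) = (\<lambda>\<xi>. gradient (f i) (X i \<xi>) +
      (\<Sum>j\<in>UNIV. ?\<beta> j *\<^sub>R (mb k j \<xi> (X j \<xi>) - gradient (f j) (X j \<xi>))))" by blast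
  note N = data_noise[OF P(1,2) A regular_L2[OF regular_gradient[OF X]] Xm, of ?\<beta>]
  have sub: "P \<union> {Data k i r | i r. r \<in> {1..batch k}} \<subseteq> history (max m (5 * k - 2))"
    using P(3) by (auto simp: history_def source_mem)
  show ?thesis
    unfolding eq regular_def using measurable_gen_mono[OF N(1) sub history_sources] N(2) by simp
qed

lemma coins_sets_history:
  "server_coin R k \<in> gen (history (5 * k + 2)) \<rightarrow>\<^sub>M count_space UNIV"
  "worker_coin R k \<in> gen (history (5 * k + 5)) \<rightarrow>\<^sub>M count_space UNIV"
  "server_set R k i \<in> gen (history (5 * k + 1)) \<rightarrow>\<^sub>M count_space UNIV"
  "worker_set R k i \<in> gen (history (5 * k + 4)) \<rightarrow>\<^sub>M count_space UNIV"
  by (auto intro!: measurable_source_history[OF server_coin_gen] measurable_source_history[OF worker_coin_gen]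
      measurable_source_history[OF server_set_gen] measurable_source_history[OF worker_set_gen] source_mem)

lemma regular_step:
  assumes x: "regular (5 * k) (x k)" and g: "regular (5 * k) (g k)"
    and w: "\<And>i. regular (5 * k) (w k i)" and y: "\<And>i. regular (5 * k) (y k i)"
    and v: "\<And>i. regular (5 * k) (v k i)"
  shows "regular (5 * k) (x (Suc k))" "regular (5 * k) (dx k)"
    "regular (5 * k + 2) (w (Suc k) i)" "regular (5 * k + 2) (y (Suc k) i)"
    "regular (5 * k + 3) (v (Suc k) i)" "regular (5 * k + 5) (g (Suc k))"
proof -
  have x_Suc': "x (Suc k) = (\<lambda>\<xi>. x k \<xi> - \<gamma> *\<^sub>R g k \<xi>)" by (simp add: x_Suc fun_eq_iff)
  show x': "regular (5 * k) (x (Suc k))" unfolding x_Suc' using x g by (intro regular_intros)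
  have "dx k = (\<lambda>\<xi>. - \<gamma> *\<^sub>R g k \<xi>)" by (simp add: dx_eq fun_eq_iff)
  thus dx: "regular (5 * k) (dx k)" using regular_scaleR[OF g, of "- \<gamma>"] by simp
  have "w (Suc k) i = (\<lambda>\<xi>. if server_coin R k \<xi> then x (Suc k) \<xi>
    else w k i \<xi> + rand_compress K\<^sub>s (server_set R k i \<xi>) (dx k \<xi>))" for i
    by (simp add: w_Suc fun_eq_iff)
  moreover have "regular (5 * k + 2) (\<lambda>\<xi>. rand_compress K\<^sub>s (server_set R k i \<xi>) (dx k \<xi>))" for i
    by (rule regular_mono[OF regular_compress[OF coins_sets_history(3) regular_mono[OF dx]]]) auto
  moreover have "regular (5 * k + 2) (x (Suc k))" "regular (5 * k + 2) (w k i)" for i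
    by (rule regular_mono[OF x'] regular_mono[OF w]; simp)+
  ultimately have w': "regular (5 * k + 2) (w (Suc k) i)" for i
    by (simp only: regular_if[OF coins_sets_history(1)] regular_add)
  thus "regular (5 * k + 2) (w (Suc k) i)" .
  have "y (Suc k) i = (\<lambda>\<xi>. (1 - \<mu>) *\<^sub>R y k i \<xi> + \<mu> *\<^sub>R w (Suc k) i \<xi>)" for i
    by (simp add: y_Suc fun_eq_iff)
  hence y': "regular (5 * k + 2) (y (Suc k) i)" for i
    using regular_mono[OF y] w' by (auto intro!: regular_intros)
  thus "regular (5 * k + 2) (y (Suc k) i)" .
  have "regular (max (5 * k + 2) (5 * Suc k - 2)) (\<lambda>\<xi>. mb (Suc k) i \<xi> (y (Suc k) i \<xi>))" for i
    by (rule regular_minibatch[OF y']) auto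
  hence mb: "regular (5 * k + 3) (\<lambda>\<xi>. mb (Suc k) i \<xi> (y (Suc k) i \<xi>))" for i
    by (rule regular_mono) auto
  have "v (Suc k) i = (\<lambda>\<xi>. (1 - \<nu>) *\<^sub>R v k i \<xi> + \<nu> *\<^sub>R mb (Suc k) i \<xi> (y (Suc k) i \<xi>))" for i
    by (simp add: v_Suc fun_eq_iff)
  hence v': "regular (5 * k + 3) (v (Suc k) i)" for i
    using regular_mono[OF v] mb by (auto intro!: regular_intros)
  thus "regular (5 * k + 3) (v (Suc k) i)" .
  have "regular (5 * k + 5) (\<lambda>\<xi>. rand_compress K (worker_set R k i \<xi>) (v (Suc k) i \<xi> - v k i \<xi>))" for i
    by (rule regular_mono[OF regular_compress[OF coins_sets_history(4)
            regular_diff[OF regular_mono[OF v'] regular_mono[OF v]]]]) auto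
  moreover have "regular (5 * k + 5) (g k)" "regular (5 * k + 5) (v (Suc k) i)" for i
    by (rule regular_mono[OF g] regular_mono[OF v']; simp)+
  ultimately have "regular (5 * k + 5) (\<lambda>\<xi>. if worker_coin R k \<xi> then worker_mean (\<lambda>i. v (Suc k) i \<xi>)
    else g k \<xi> + worker_mean (\<lambda>i. rand_compress K (worker_set R k i \<xi>) (v (Suc k) i \<xi> - v k i \<xi>)))"
    by (intro regular_if[OF coins_sets_history(2)] regular_add regular_worker_mean)
  thus "regular (5 * k + 5) (g (Suc k))" by (simp add: g_Suc[abs_def])
qed

lemma regular_state:
  "regular (5 * k) (x k) \<and> regular (5 * k) (g k) \<and> (\<forall>i. regular (5 * k) (w k i)) \<and>
   (\<forall>i. regular (5 * k) (y k i)) \<and> (\<forall>i. regular (5 * k) (v k i))"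
proof (induction k)
  case 0
  have v: "regular 0 (v 0 i)" for i
  proof -
    have "\<exists>c. (\<lambda>_ :: 'w. x0) = (\<lambda>_. c)" by blast
    thus ?thesis
      using regular_minibatch[OF regular_const, of 0 0 "\<lambda>_. x0" i] by (simp add: start(4)[abs_def])
  qed
  have "regular 0 (g 0)" unfolding start(5)[abs_def] by (rule regular_worker_mean[OF v])
  moreover have "x 0 = (\<lambda>_. x0)" "w 0 i = (\<lambda>_. x0)" "y 0 i = (\<lambda>_. x0)" for i
    by (simp_all add: start fun_eq_iff)
  ultimately show ?case using v by (simp add: regular_const)
next
  case (Suc k)
  note S = regular_step[of k]
  show ?case
    using Suc by (auto intro!: S(1,6) regular_mono[OF S(1)] regular_mono[OF S(3)] regular_mono[OF S(4)]
        regular_mono[OF S(5)] regular_mono[OF S(6)])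
qed

lemma regular_x: "5 * k \<le> m \<Longrightarrow> regular m (x k)"
  and regular_g: "5 * k \<le> m \<Longrightarrow> regular m (g k)"
  and regular_w: "5 * k \<le> m \<Longrightarrow> regular m (w k i)"
  and regular_y: "5 * k \<le> m \<Longrightarrow> regular m (y k i)"
  and regular_v: "5 * k \<le> m \<Longrightarrow> regular m (v k i)"
  using regular_state[of k] by (blast intro: regular_mono)+

lemma regular_x_Suc: "5 * k \<le> m \<Longrightarrow> regular m (x (Suc k))"
  and regular_dx: "5 * k \<le> m \<Longrightarrow> regular m (dx k)"
  and regular_y_Suc: "5 * k + 2 \<le> m \<Longrightarrow> regular m (y (Suc k) i)"
  and regular_v_Suc: "5 * k + 3 \<le> m \<Longrightarrow> regular m (v (Suc k) i)"
  using regular_step[of k] regular_state[of k] by (blast intro: regular_mono)+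

lemmas L2_intros = square_integrable_scaleR square_integrable_add square_integrable_diff
  square_integrable_worker_mean[OF finite_M] square_integrable_sum[OF finite_M]
  square_integrable_Lipschitz[OF finite_M grad_Lipschitz]
  regular_x[OF order.refl, THEN regular_L2] regular_g[OF order.refl, THEN regular_L2]
  regular_w[OF order.refl, THEN regular_L2] regular_y[OF order.refl, THEN regular_L2]
  regular_v[OF order.refl, THEN regular_L2] regular_dx[OF order.refl, THEN regular_L2]

section \<open>One step in mean square\<close>

abbreviation msq :: "('w \<Rightarrow> real ^ 'd) \<Rightarrow> real" where
  "msq X \<equiv> expectation (\<lambda>\<xi>. (norm (X \<xi>))\<^sup>2)"

lemma msq_nonneg: "0 \<le> msq X"
  by (rule integral_nonneg_AE) simp

lemma msq_le:
  assumes "square_integrable M X" "square_integrable M Y" "square_integrable M Z"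
    and "\<And>\<xi>. (norm (X \<xi>))\<^sup>2 \<le> a * (norm (Y \<xi>))\<^sup>2 + c * (norm (Z \<xi>))\<^sup>2"
  shows "msq X \<le> a * msq Y + c * msq Z"
proof -
  have "msq X \<le> expectation (\<lambda>\<xi>. a * (norm (Y \<xi>))\<^sup>2 + c * (norm (Z \<xi>))\<^sup>2)"
    using assms(1-3)[THEN square_integrable_integrable] assms(4) by (intro integral_mono) auto
  thus ?thesis using assms(2,3)[THEN square_integrable_integrable] by simp
qed

lemma msq_scaleR: "msq (\<lambda>\<xi>. c *\<^sub>R X \<xi>) = c\<^sup>2 * msq X"
  by (simp add: power_mult_distrib)

text \<open>
  The synchronization error \<open>err\<close> is reset by the server's coin; \<open>dev\<close> is what functional similarity is applied
  to; \<open>gap\<close> measures how far the smoothing lags behind, and drives the movement of \<open>y\<close>.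
\<close>

definition err :: "nat \<Rightarrow> 'n \<Rightarrow> 'w \<Rightarrow> real ^ 'd" where "err k i \<xi> = w k i \<xi> - x k \<xi>"
definition dev :: "nat \<Rightarrow> 'n \<Rightarrow> 'w \<Rightarrow> real ^ 'd" where "dev k i \<xi> = y k i \<xi> - x k \<xi>"
definition gap :: "nat \<Rightarrow> 'n \<Rightarrow> 'w \<Rightarrow> real ^ 'd" where "gap k i \<xi> = w k i \<xi> - y k i \<xi>"

lemma regular_err: "5 * k \<le> m \<Longrightarrow> regular m (err k i)"
  unfolding err_def[abs_def] by (intro regular_intros regular_w regular_x)

lemma regular_gap: "5 * k \<le> m \<Longrightarrow> regular m (gap k i)"
  unfolding gap_def[abs_def] by (intro regular_intros regular_w regular_y)

lemma L2_err: "square_integrable M (err k i)" and L2_dev: "square_integrable M (dev k i)"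
  and L2_gap: "square_integrable M (gap k i)"
  unfolding err_def[abs_def] dev_def[abs_def] gap_def[abs_def] by (intro L2_intros)+

lemma server_noise:
  fixes \<beta> :: "'n \<Rightarrow> real"
  assumes A: "regular (5 * k) A"
  defines "T \<equiv> \<lambda>\<xi>. A \<xi> + (\<Sum>i\<in>UNIV. \<beta> i *\<^sub>R (rand_compress K\<^sub>s (server_set R k i \<xi>) (dx k \<xi>) - dx k \<xi>))"
  shows "regular (5 * k + 1) T"
    "msq T \<le> msq A + (\<Sum>i\<in>UNIV. (\<beta> i)\<^sup>2 * (\<omega>\<^sub>s * msq (dx k)))"
proof -
  have src: "range (Server_Set k) \<subseteq> sources batch" "range (Server_Set k) \<inter> history (5 * k) = {}"
    "inj (Server_Set k)"
    by (auto simp: source_mem history_def inj_on_def)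
  have dist: "distr M (count_space UNIV) (server_set R k i) = measure_pmf (pmf_of_set {S. card S = K\<^sub>s})" for i
    using randomness by (simp add: m4_randomness_def)
  note N = compressor_noise[OF history_sources regular_measurable[OF A] regular_L2[OF A] src
      regular_measurable[OF regular_dx[OF order.refl]] regular_L2[OF regular_dx[OF order.refl]]
      server_set_gen dist K(3,4), of \<beta>, folded \<omega>\<^sub>s(1)]
  have sub: "history (5 * k) \<union> range (Server_Set k) \<subseteq> history (5 * k + 1)"
    by (auto simp: history_def source_mem)
  show "regular (5 * k + 1) T"
    unfolding regular_def T_def using measurable_gen_mono[OF N(1) sub history_sources] N(2) by blast
  show "msq T \<le> msq A + (\<Sum>i\<in>UNIV. (\<beta> i)\<^sup>2 * (\<omega>\<^sub>s * msq (dx k)))"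
    unfolding T_def by (rule N(3))
qed

lemma worker_noise:
  fixes \<beta> :: "'n \<Rightarrow> real"
  assumes A: "regular (5 * k + 3) A"
  defines "X \<equiv> \<lambda>i \<xi>. v (Suc k) i \<xi> - v k i \<xi>"
  defines "T \<equiv> \<lambda>\<xi>. A \<xi> + (\<Sum>i\<in>UNIV. \<beta> i *\<^sub>R (rand_compress K (worker_set R k i \<xi>) (X i \<xi>) - X i \<xi>))"
  shows "regular (5 * k + 4) T"
    "msq T \<le> msq A + (\<Sum>i\<in>UNIV. (\<beta> i)\<^sup>2 * (\<omega> * msq (X i)))"
proof -
  have X: "regular (5 * k + 3) (X i)" for i
    unfolding X_def by (intro regular_intros regular_v regular_v_Suc) auto
  have src: "range (Worker_Set k) \<subseteq> sources batch" "range (Worker_Set k) \<inter> history (5 * k + 3) = {}"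
    "inj (Worker_Set k)"
    by (auto simp: source_mem history_def inj_on_def)
  have dist: "distr M (count_space UNIV) (worker_set R k i) = measure_pmf (pmf_of_set {S. card S = K})" for i
    using randomness by (simp add: m4_randomness_def)
  note N = compressor_noise[where X = X and \<beta> = \<beta>, OF history_sources regular_measurable[OF A]
      regular_L2[OF A] src regular_measurable[OF X] regular_L2[OF X] worker_set_gen dist K(1,2), folded \<omega>(1)]
  have sub: "history (5 * k + 3) \<union> range (Worker_Set k) \<subseteq> history (5 * k + 4)"
    by (auto simp: history_def source_mem)
  show "regular (5 * k + 4) T"
    unfolding regular_def T_def using measurable_gen_mono[OF N(1) sub history_sources] N(2) by blast
  show "msq T \<le> msq A + (\<Sum>i\<in>UNIV. (\<beta> i)\<^sup>2 * (\<omega> * msq (X i)))"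
    unfolding T_def by (rule N(3))
qed

lemma gradient_noise:
  fixes \<beta> :: "'n \<Rightarrow> real"
  assumes A: "regular (5 * k + 2) A"
  defines "T \<equiv> \<lambda>\<xi>. A \<xi> + (\<Sum>i\<in>UNIV. \<beta> i *\<^sub>R
     (mb (Suc k) i \<xi> (y (Suc k) i \<xi>) - gradient (f i) (y (Suc k) i \<xi>)))"
  shows "msq T \<le> msq A + (\<Sum>i\<in>UNIV. (\<beta> i)\<^sup>2) * (\<sigma>\<^sup>2 / real b)"
proof -
  have "Data (Suc k) i r \<notin> history (5 * k + 2)" for i r by (auto simp: history_def)
  from data_noise(3)[OF history_sources this regular_measurable[OF A] regular_L2[OF A]
      regular_measurable[OF regular_y_Suc[OF order.refl]], of \<beta>]
  show ?thesis unfolding T_def batch(3) .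
qed

lemma coin_split:
  assumes c: "c \<in> gen {s} \<rightarrow>\<^sub>M count_space UNIV" "prob {\<xi> \<in> space M. c \<xi>} = q"
    and s: "s \<in> sources batch" "m < stamp s" and X: "regular m X" and Y: "regular m Y"
  shows "msq (\<lambda>\<xi>. if c \<xi> then X \<xi> else Y \<xi>) = q * msq X + (1 - q) * msq Y"
proof -
  have "expectation (\<lambda>\<xi>. if c \<xi> then (norm (X \<xi>))\<^sup>2 else (norm (Y \<xi>))\<^sup>2) = q * msq X + (1 - q) * msq Y"
  proof (rule expectation_coin[OF history_sources[of m] _ _ c])
    show "(\<lambda>\<xi>. (norm (X \<xi>))\<^sup>2) \<in> borel_measurable (gen (history m))"
      "(\<lambda>\<xi>. (norm (Y \<xi>))\<^sup>2) \<in> borel_measurable (gen (history m))"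
      using regular_measurable[OF X] regular_measurable[OF Y] by auto
  qed (use s regular_L2[OF X] regular_L2[OF Y] in \<open>auto simp: history_def square_integrable_def\<close>)
  thus ?thesis by (simp add: if_distrib[of norm] if_distrib[of "\<lambda>z. z\<^sup>2"] cong: if_cong)
qed

lemma server_coin_split:
  "regular (5 * k + 1) X \<Longrightarrow> regular (5 * k + 1) Y \<Longrightarrow>
   msq (\<lambda>\<xi>. if server_coin R k \<xi> then X \<xi> else Y \<xi>) = p\<^sub>s * msq X + (1 - p\<^sub>s) * msq Y"
  by (rule coin_split[OF server_coin_gen prob_server_coin source_mem(1)]) simp_all

lemma worker_coin_split:
  "regular (5 * k + 4) X \<Longrightarrow> regular (5 * k + 4) Y \<Longrightarrow>
   msq (\<lambda>\<xi>. if worker_coin R k \<xi> then X \<xi> else Y \<xi>) = p * msq X + (1 - p) * msq Y"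
  by (rule coin_split[OF worker_coin_gen prob_worker_coin source_mem(2)]) simp_all

text \<open>
  Between synchronizations the compression errors accumulate as independent noise; with probability
  \<open>p\<^sub>s\<close> they are wiped out.
\<close>

lemma err_step:
  "msq (\<lambda>\<xi>. \<Sum>i\<in>UNIV. \<beta> i *\<^sub>R err (Suc k) i \<xi>) \<le>
   (1 - p\<^sub>s) * (msq (\<lambda>\<xi>. \<Sum>i\<in>UNIV. \<beta> i *\<^sub>R err k i \<xi>) + (\<Sum>i\<in>UNIV. (\<beta> i)\<^sup>2 * (\<omega>\<^sub>s * msq (dx k))))"
proof -
  let ?A = "\<lambda>\<xi>. \<Sum>i\<in>UNIV. \<beta> i *\<^sub>R err k i \<xi>"
  let ?T = "\<lambda>\<xi>. ?A \<xi> + (\<Sum>i\<in>UNIV. \<beta> i *\<^sub>R (rand_compress K\<^sub>s (server_set R k i \<xi>) (dx k \<xi>) - dx k \<xi>))"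
  have A: "regular (5 * k) ?A" by (intro regular_sum regular_scaleR regular_err) simp
  note N = server_noise[OF A, of \<beta>]
  have "(\<Sum>i\<in>UNIV. \<beta> i *\<^sub>R err (Suc k) i \<xi>) = (if server_coin R k \<xi> then 0 else ?T \<xi>)" for \<xi>
  proof (cases "server_coin R k \<xi>")
    case False
    hence "\<beta> i *\<^sub>R err (Suc k) i \<xi> = \<beta> i *\<^sub>R err k i \<xi> +
        \<beta> i *\<^sub>R (rand_compress K\<^sub>s (server_set R k i \<xi>) (dx k \<xi>) - dx k \<xi>)" for i
      unfolding scaleR_add_right[symmetric] by (simp add: err_def w_Suc dx_def)
    thus ?thesis using False by (simp only: sum.distrib if_False)
  qed (simp add: err_def w_Suc)
  hence "msq (\<lambda>\<xi>. \<Sum>i\<in>UNIV. \<beta> i *\<^sub>R err (Suc k) i \<xi>) = msq (\<lambda>\<xi>. if server_coin R k \<xi> then 0 else ?T \<xi>)"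
    by simp
  also have "\<dots> = (1 - p\<^sub>s) * msq ?T"
    by (subst server_coin_split[OF regular_const N(1)]) simp
  also have "\<dots> \<le> (1 - p\<^sub>s) * (msq ?A + (\<Sum>i\<in>UNIV. (\<beta> i)\<^sup>2 * (\<omega>\<^sub>s * msq (dx k))))"
    using N(2) p_bounds by (intro mult_left_mono) auto
  finally show ?thesis .
qed

text \<open>
  Conditioned on the past, \<open>w\<close> changes on average by \<open>dx - p\<^sub>s * err\<close>, because the compressor is unbiased
  and a synchronization removes the error. The remaining terms are the variance: \<open>\<omega>\<^sub>s\<close> times the squared step from
  the compressor and \<open>p\<^sub>s\<close> times the squared error from the coin. The factor \<open>p\<^sub>s\<close> is the gain over a
  triangle inequality.
\<close>

lemma gap_step:
  "msq (\<lambda>\<xi>. w (Suc k) i \<xi> - y k i \<xi>) \<le>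
   msq (\<lambda>\<xi>. gap k i \<xi> + (dx k \<xi> - p\<^sub>s *\<^sub>R err k i \<xi>)) + p\<^sub>s * msq (err k i) + \<omega>\<^sub>s * msq (dx k)"
proof -
  let ?\<beta> = "\<lambda>j. if j = i then 1 else 0 :: real"
  let ?u = "\<lambda>\<xi>. gap k i \<xi> + dx k \<xi>"
  let ?T = "\<lambda>\<xi>. ?u \<xi> + (\<Sum>i\<in>UNIV. ?\<beta> i *\<^sub>R (rand_compress K\<^sub>s (server_set R k i \<xi>) (dx k \<xi>) - dx k \<xi>))"
  have u: "regular m ?u" if "5 * k \<le> m" for m using that by (intro regular_intros regular_gap regular_dx)
  have ue: "regular m (\<lambda>\<xi>. ?u \<xi> - err k i \<xi>)" if "5 * k \<le> m" for m
    using that by (intro regular_intros u regular_err regular_gap regular_dx)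
  note N = server_noise[OF u[OF order.refl], of ?\<beta>]
  have L2: "square_integrable M ?u" "square_integrable M (\<lambda>\<xi>. ?u \<xi> - err k i \<xi>)"
     "square_integrable M (\<lambda>\<xi>. gap k i \<xi> + (dx k \<xi> - p\<^sub>s *\<^sub>R err k i \<xi>))"
    by (intro L2_intros L2_gap L2_err)+
  have "w (Suc k) i \<xi> - y k i \<xi> = (if server_coin R k \<xi> then ?u \<xi> - err k i \<xi> else ?T \<xi>)" for \<xi>
    by (simp add: sum_single_scaleR w_Suc gap_def err_def dx_def)
  hence "msq (\<lambda>\<xi>. w (Suc k) i \<xi> - y k i \<xi>) = p\<^sub>s * msq (\<lambda>\<xi>. ?u \<xi> - err k i \<xi>) + (1 - p\<^sub>s) * msq ?T"
    using server_coin_split[OF ue N(1)] by simp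
  also have "\<dots> \<le> p\<^sub>s * msq (\<lambda>\<xi>. ?u \<xi> - err k i \<xi>) + (1 - p\<^sub>s) * (msq ?u + \<omega>\<^sub>s * msq (dx k))"
    using N(2) p_bounds by (intro add_left_mono mult_left_mono) (auto simp: sum_single_mult)
  also have "\<dots> \<le> (p\<^sub>s * msq (\<lambda>\<xi>. ?u \<xi> - err k i \<xi>) + (1 - p\<^sub>s) * msq ?u) + \<omega>\<^sub>s * msq (dx k)"
    using mult_right_mono[of "1 - p\<^sub>s" 1 "\<omega>\<^sub>s * msq (dx k)"] p_bounds \<omega>_nonneg msq_nonneg[of "dx k"]
    by (simp add: distrib_left)
  also have "p\<^sub>s * msq (\<lambda>\<xi>. ?u \<xi> - err k i \<xi>) + (1 - p\<^sub>s) * msq ?u =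
      expectation (\<lambda>\<xi>. p\<^sub>s * (norm (?u \<xi> - err k i \<xi>))\<^sup>2 + (1 - p\<^sub>s) * (norm (?u \<xi>))\<^sup>2)"
    using L2(1,2)[THEN square_integrable_integrable] by simp
  also have "\<dots> = expectation (\<lambda>\<xi>. (norm (gap k i \<xi> + (dx k \<xi> - p\<^sub>s *\<^sub>R err k i \<xi>)))\<^sup>2 +
      p\<^sub>s * (1 - p\<^sub>s) * (norm (err k i \<xi>))\<^sup>2)"
    by (intro Bochner_Integration.integral_cong refl)
       (simp add: power2_norm_eq_inner inner_add_left inner_add_right inner_diff_left inner_diff_right
         inner_commute algebra_simps)
  also have "\<dots> = msq (\<lambda>\<xi>. gap k i \<xi> + (dx k \<xi> - p\<^sub>s *\<^sub>R err k i \<xi>)) + p\<^sub>s * (1 - p\<^sub>s) * msq (err k i)"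
    using L2(3)[THEN square_integrable_integrable] L2_err[THEN square_integrable_integrable] by simp
  also have "p\<^sub>s * (1 - p\<^sub>s) * msq (err k i) \<le> p\<^sub>s * 1 * msq (err k i)"
    using p_bounds msq_nonneg by (intro mult_right_mono mult_left_mono) auto
  finally show ?thesis by simp
qed

text \<open>
  The mean square quantities of the analysis, averaged over the workers. The prefix \<open>mean\<close> marks the square of
  an average as opposed to an average of squares. \<open>move_sq\<close> is the movement of the workers' points,
  \<open>tracking_err\<close> the error of the \<open>v\<close> as estimators of the workers' own gradients, \<open>momentum_err\<close> the error of their
  mean as an estimator of the gradient of \<open>F\<close>, \<open>change_sq\<close> what the workers compress, and \<open>compress_err\<close>
  the resulting error of \<open>g\<close>.
\<close>

definition step_sq :: "nat \<Rightarrow> real" where "step_sq k = msq (dx k)"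
definition err_sq :: "nat \<Rightarrow> real" where "err_sq k = worker_mean (\<lambda>i. msq (err k i))"
definition mean_err_sq :: "nat \<Rightarrow> real" where "mean_err_sq k = msq (\<lambda>\<xi>. worker_mean (\<lambda>i. err k i \<xi>))"
definition dev_sq :: "nat \<Rightarrow> real" where "dev_sq k = worker_mean (\<lambda>i. msq (dev k i))"
definition mean_dev_sq :: "nat \<Rightarrow> real" where "mean_dev_sq k = msq (\<lambda>\<xi>. worker_mean (\<lambda>i. dev k i \<xi>))"
definition gap_sq :: "nat \<Rightarrow> real" where "gap_sq k = worker_mean (\<lambda>i. msq (gap k i))"
definition move_sq :: "nat \<Rightarrow> real" where "move_sq k = worker_mean (\<lambda>i. msq (\<lambda>\<xi>. y (Suc k) i \<xi> - y k i \<xi>))"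
definition momentum_err :: "nat \<Rightarrow> real" where
  "momentum_err k = msq (\<lambda>\<xi>. worker_mean (\<lambda>i. v k i \<xi>) - worker_mean (\<lambda>i. gradient (f i) (x k \<xi>)))"
definition tracking_err :: "nat \<Rightarrow> real" where
  "tracking_err k = worker_mean (\<lambda>i. msq (\<lambda>\<xi>. v k i \<xi> - gradient (f i) (y k i \<xi>)))"
definition change_sq :: "nat \<Rightarrow> real" where "change_sq k = worker_mean (\<lambda>i. msq (\<lambda>\<xi>. v (Suc k) i \<xi> - v k i \<xi>))"
definition compress_err :: "nat \<Rightarrow> real" where "compress_err k = msq (\<lambda>\<xi>. g k \<xi> - worker_mean (\<lambda>i. v k i \<xi>))"

lemma sequences_nonneg: "0 \<le> step_sq k" "0 \<le> err_sq k" "0 \<le> mean_err_sq k" "0 \<le> dev_sq k" "0 \<le> mean_dev_sq k" "0 \<le> gap_sq k"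
  "0 \<le> move_sq k" "0 \<le> momentum_err k" "0 \<le> tracking_err k" "0 \<le> change_sq k" "0 \<le> compress_err k"
  by (simp_all add: step_sq_def err_sq_def mean_err_sq_def dev_sq_def mean_dev_sq_def gap_sq_def move_sq_def momentum_err_def tracking_err_def change_sq_def compress_err_def
      msq_nonneg worker_mean_nonneg)

lemma start_zero: "err_sq 0 = 0" "mean_err_sq 0 = 0" "dev_sq 0 = 0" "mean_dev_sq 0 = 0" "gap_sq 0 = 0" "compress_err 0 = 0"
  by (simp_all add: err_sq_def mean_err_sq_def dev_sq_def mean_dev_sq_def gap_sq_def compress_err_def err_def dev_def gap_def start
      worker_mean_const)

lemma err_sq_step: "err_sq (Suc k) \<le> (1 - p\<^sub>s) * (err_sq k + \<omega>\<^sub>s * step_sq k)"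
proof -
  have "msq (err (Suc k) i) \<le> (1 - p\<^sub>s) * (msq (err k i) + \<omega>\<^sub>s * step_sq k)" for i
    using err_step[of "\<lambda>j. if j = i then 1 else 0" k]
    by (simp add: sum_single_scaleR sum_single_mult step_sq_def)
  hence "err_sq (Suc k) \<le> worker_mean (\<lambda>i. (1 - p\<^sub>s) * (msq (err k i) + \<omega>\<^sub>s * step_sq k))"
    unfolding err_sq_def by (rule worker_mean_mono)
  thus ?thesis by (simp add: worker_mean_mult worker_mean_add worker_mean_const err_sq_def)
qed

lemma mean_err_sq_step: "mean_err_sq (Suc k) \<le> (1 - p\<^sub>s) * (mean_err_sq k + \<omega>\<^sub>s / real CARD('n) * step_sq k)"
  using err_step[of "\<lambda>j. 1 / real CARD('n)" k] sum_mean_mult[where 'n = 'n, of 1 "\<lambda>_. \<omega>\<^sub>s * step_sq k"]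
  by (simp add: mean_err_sq_def worker_mean_sum step_sq_def)

lemma momentum_tracking:
  fixes Y \<delta> e :: "'a::real_inner"
  shows "(norm ((1 - \<mu>) *\<^sub>R (Y - \<delta>) + \<mu> *\<^sub>R e))\<^sup>2 \<le>
    (1 - \<mu>) * (norm Y)\<^sup>2 + (4 / \<mu>) * (norm \<delta>)\<^sup>2 + 4 * \<mu> * (norm e)\<^sup>2"
proof -
  have "(1 - \<mu>)\<^sup>2 * (norm \<delta>)\<^sup>2 \<le> 1 * (norm \<delta>)\<^sup>2"
    using momentum by (intro mult_right_mono) (auto simp: power_le_one)
  hence "(norm (- (1 - \<mu>) *\<^sub>R \<delta> + \<mu> *\<^sub>R e))\<^sup>2 \<le> 2 * (norm \<delta>)\<^sup>2 + 2 * (\<mu>\<^sup>2 * (norm e)\<^sup>2)"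
    using norm_add_sq_le2[of "- (1 - \<mu>) *\<^sub>R \<delta>" "\<mu> *\<^sub>R e"] by (simp add: power_mult_distrib power2_commute[of \<mu> 1])
  hence "2 / \<mu> * (norm (- (1 - \<mu>) *\<^sub>R \<delta> + \<mu> *\<^sub>R e))\<^sup>2 \<le> 2 / \<mu> * (2 * (norm \<delta>)\<^sup>2 + 2 * (\<mu>\<^sup>2 * (norm e)\<^sup>2))"
    using momentum by (intro mult_left_mono) auto
  also have "\<dots> = (4 / \<mu>) * (norm \<delta>)\<^sup>2 + 4 * \<mu> * (norm e)\<^sup>2"
    using momentum by (simp add: field_simps power2_eq_square)
  finally show ?thesis
    using momentum_norm_sq_le[OF momentum(3,4), of Y "- (1 - \<mu>) *\<^sub>R \<delta> + \<mu> *\<^sub>R e"]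
    by (simp add: algebra_simps)
qed

lemma dev_Suc: "dev (Suc k) i \<xi> = (1 - \<mu>) *\<^sub>R (dev k i \<xi> - dx k \<xi>) + \<mu> *\<^sub>R err (Suc k) i \<xi>"
  by (simp add: dev_def y_Suc dx_def err_def algebra_simps)

lemma msq_le3:
  assumes "square_integrable M X" "square_integrable M Y" "square_integrable M Z" "square_integrable M W"
    and "\<And>\<xi>. (norm (X \<xi>))\<^sup>2 \<le> a * (norm (Y \<xi>))\<^sup>2 + c * (norm (Z \<xi>))\<^sup>2 + e * (norm (W \<xi>))\<^sup>2"
  shows "msq X \<le> a * msq Y + c * msq Z + e * msq W"
proof -
  have "msq X \<le> expectation (\<lambda>\<xi>. a * (norm (Y \<xi>))\<^sup>2 + c * (norm (Z \<xi>))\<^sup>2 + e * (norm (W \<xi>))\<^sup>2)"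
    using assms(1-4)[THEN square_integrable_integrable] assms(5) by (intro integral_mono) auto
  thus ?thesis using assms(2-4)[THEN square_integrable_integrable] by simp
qed

lemma dev_sq_step: "dev_sq (Suc k) \<le> (1 - \<mu>) * dev_sq k + (4 / \<mu>) * step_sq k + 4 * \<mu> * err_sq (Suc k)"
proof -
  have "msq (dev (Suc k) i) \<le> (1 - \<mu>) * msq (dev k i) + (4 / \<mu>) * step_sq k + 4 * \<mu> * msq (err (Suc k) i)" for i
    unfolding step_sq_def
    by (rule msq_le3; (intro L2_err L2_dev L2_intros | unfold dev_Suc, rule momentum_tracking))
  hence "dev_sq (Suc k) \<le> worker_mean (\<lambda>i. (1 - \<mu>) * msq (dev k i) + (4 / \<mu>) * step_sq k + 4 * \<mu> * msq (err (Suc k) i))"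
    unfolding dev_sq_def by (rule worker_mean_mono)
  thus ?thesis by (simp add: worker_mean_mult worker_mean_add worker_mean_const err_sq_def dev_sq_def)
qed

lemma mean_dev_sq_step: "mean_dev_sq (Suc k) \<le> (1 - \<mu>) * mean_dev_sq k + (4 / \<mu>) * step_sq k + 4 * \<mu> * mean_err_sq (Suc k)"
proof -
  have eq: "worker_mean (\<lambda>i. dev (Suc k) i \<xi>) =
      (1 - \<mu>) *\<^sub>R (worker_mean (\<lambda>i. dev k i \<xi>) - dx k \<xi>) + \<mu> *\<^sub>R worker_mean (\<lambda>i. err (Suc k) i \<xi>)" for \<xi>
    by (simp add: dev_Suc worker_mean_add worker_mean_diff worker_mean_scaleR worker_mean_const)
  show ?thesis
    unfolding step_sq_def mean_dev_sq_def mean_err_sq_def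
    by (rule msq_le3; (intro L2_err L2_dev L2_intros | unfold eq, rule momentum_tracking))
qed

lemma gap_step_mean:
  "worker_mean (\<lambda>i. msq (\<lambda>\<xi>. gap k i \<xi> + (dx k \<xi> - p\<^sub>s *\<^sub>R err k i \<xi>)) + p\<^sub>s * msq (err k i) + \<omega>\<^sub>s * step_sq k)
   \<le> 2 * gap_sq k + 4 * (step_sq k + p\<^sub>s\<^sup>2 * err_sq k) + (p\<^sub>s * err_sq k + \<omega>\<^sub>s * step_sq k)"
proof -
  have m: "msq (\<lambda>\<xi>. dx k \<xi> - p\<^sub>s *\<^sub>R err k i \<xi>) \<le> 2 * step_sq k + 2 * p\<^sub>s\<^sup>2 * msq (err k i)" for i
  proof -
    have "msq (\<lambda>\<xi>. dx k \<xi> - p\<^sub>s *\<^sub>R err k i \<xi>) \<le> 2 * msq (dx k) + 2 * msq (\<lambda>\<xi>. p\<^sub>s *\<^sub>R err k i \<xi>)"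
      by (rule msq_le) (auto intro!: L2_intros L2_err norm_diff_sq_le2 simp del: norm_scaleR)
    thus ?thesis unfolding msq_scaleR by (simp add: step_sq_def)
  qed
  have le: "msq (\<lambda>\<xi>. gap k i \<xi> + (dx k \<xi> - p\<^sub>s *\<^sub>R err k i \<xi>)) \<le>
      2 * msq (gap k i) + 2 * msq (\<lambda>\<xi>. dx k \<xi> - p\<^sub>s *\<^sub>R err k i \<xi>)" for i
    by (rule msq_le) (auto intro!: L2_intros L2_err L2_gap norm_add_sq_le2)
  have "msq (\<lambda>\<xi>. gap k i \<xi> + (dx k \<xi> - p\<^sub>s *\<^sub>R err k i \<xi>)) + p\<^sub>s * msq (err k i) + \<omega>\<^sub>s * step_sq k \<le>
      2 * msq (gap k i) + 4 * (step_sq k + p\<^sub>s\<^sup>2 * msq (err k i)) + (p\<^sub>s * msq (err k i) + \<omega>\<^sub>s * step_sq k)" for i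
  proof -
    have "2 * msq (\<lambda>\<xi>. dx k \<xi> - p\<^sub>s *\<^sub>R err k i \<xi>) \<le> 4 * (step_sq k + p\<^sub>s\<^sup>2 * msq (err k i))"
      using m[of i] by (simp add: distrib_left)
    hence "msq (\<lambda>\<xi>. gap k i \<xi> + (dx k \<xi> - p\<^sub>s *\<^sub>R err k i \<xi>)) \<le>
        2 * msq (gap k i) + 4 * (step_sq k + p\<^sub>s\<^sup>2 * msq (err k i))"
      by (rule order_trans[OF le add_left_mono])
    thus ?thesis by simp
  qed
  from worker_mean_mono[OF this, of "\<lambda>i. i"] show ?thesis
    unfolding err_sq_def gap_sq_def by (simp only: worker_mean_mult worker_mean_add worker_mean_const)
qed

lemma move_sq_le: "move_sq k \<le> \<mu>\<^sup>2 * (2 * gap_sq k + 4 * (step_sq k + p\<^sub>s\<^sup>2 * err_sq k) + (p\<^sub>s * err_sq k + \<omega>\<^sub>s * step_sq k))"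
proof -
  have "y (Suc k) i \<xi> - y k i \<xi> = \<mu> *\<^sub>R (w (Suc k) i \<xi> - y k i \<xi>)" for i \<xi>
    by (simp add: y_Suc algebra_simps)
  hence "move_sq k = \<mu>\<^sup>2 * worker_mean (\<lambda>i. msq (\<lambda>\<xi>. w (Suc k) i \<xi> - y k i \<xi>))"
    by (simp add: move_sq_def power_mult_distrib worker_mean_mult)
  also have "\<dots> \<le> \<mu>\<^sup>2 * (2 * gap_sq k + 4 * (step_sq k + p\<^sub>s\<^sup>2 * err_sq k) + (p\<^sub>s * err_sq k + \<omega>\<^sub>s * step_sq k))"
    by (rule mult_left_mono[OF order_trans[OF worker_mean_mono gap_step_mean]])
       (use gap_step in \<open>simp_all add: step_sq_def\<close>)
  finally show ?thesis .
qed

text \<open>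
  The mean part of the change enters the contraction with a factor \<open>1 / \<mu>\<close>, the variance without one: this is
  the difference between adding up linearly and in quadrature.
\<close>

lemma gap_sq_step:
  "gap_sq (Suc k) \<le> (1 - \<mu>) * gap_sq k + (4 / \<mu>) * (step_sq k + p\<^sub>s\<^sup>2 * err_sq k) + (p\<^sub>s * err_sq k + \<omega>\<^sub>s * step_sq k)"
proof -
  have "msq (gap (Suc k) i) \<le> (1 - \<mu>) * msq (gap k i) + (4 / \<mu>) * (step_sq k + p\<^sub>s\<^sup>2 * msq (err k i)) +
      (p\<^sub>s * msq (err k i) + \<omega>\<^sub>s * step_sq k)" for i
  proof -
    let ?m = "\<lambda>\<xi>. dx k \<xi> - p\<^sub>s *\<^sub>R err k i \<xi>"
    have "gap (Suc k) i \<xi> = (1 - \<mu>) *\<^sub>R (w (Suc k) i \<xi> - y k i \<xi>)" for \<xi>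
      by (simp add: gap_def y_Suc algebra_simps)
    hence "msq (gap (Suc k) i) = (1 - \<mu>)\<^sup>2 * msq (\<lambda>\<xi>. w (Suc k) i \<xi> - y k i \<xi>)"
      by (simp add: power_mult_distrib)
    also have "\<dots> \<le> (1 - \<mu>)\<^sup>2 * (msq (\<lambda>\<xi>. gap k i \<xi> + ?m \<xi>) + (p\<^sub>s * msq (err k i) + \<omega>\<^sub>s * step_sq k))"
      using gap_step[of k i] by (intro mult_left_mono) (auto simp: step_sq_def)
    also have "\<dots> \<le> msq (\<lambda>\<xi>. (1 - \<mu>) *\<^sub>R (gap k i \<xi> + ?m \<xi>)) + (p\<^sub>s * msq (err k i) + \<omega>\<^sub>s * step_sq k)"
    proof -
      have "(1 - \<mu>)\<^sup>2 * (p\<^sub>s * msq (err k i) + \<omega>\<^sub>s * step_sq k) \<le> 1 * (p\<^sub>s * msq (err k i) + \<omega>\<^sub>s * step_sq k)"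
        using momentum p_bounds \<omega>_nonneg sequences_nonneg msq_nonneg
        by (intro mult_right_mono) (auto simp: power_le_one)
      thus ?thesis unfolding msq_scaleR by (simp add: distrib_left)
    qed
    also have "msq (\<lambda>\<xi>. (1 - \<mu>) *\<^sub>R (gap k i \<xi> + ?m \<xi>)) \<le>
        (1 - \<mu>) * msq (gap k i) + (4 / \<mu>) * msq (dx k) + (4 / \<mu>) * msq (\<lambda>\<xi>. p\<^sub>s *\<^sub>R err k i \<xi>)"
    proof (rule msq_le3)
      fix \<xi>
      have "(norm ((1 - \<mu>) *\<^sub>R ?m \<xi>))\<^sup>2 \<le> (norm (?m \<xi>))\<^sup>2"
        using momentum by (auto simp: power_mult_distrib power_le_one intro!: mult_left_le_one_le)
      also have "\<dots> \<le> 2 * (norm (dx k \<xi>))\<^sup>2 + 2 * (norm (p\<^sub>s *\<^sub>R err k i \<xi>))\<^sup>2"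
        by (rule norm_diff_sq_le2)
      finally have "2 / \<mu> * (norm ((1 - \<mu>) *\<^sub>R ?m \<xi>))\<^sup>2 \<le>
          2 / \<mu> * (2 * (norm (dx k \<xi>))\<^sup>2 + 2 * (norm (p\<^sub>s *\<^sub>R err k i \<xi>))\<^sup>2)"
        using momentum by (intro mult_left_mono) auto
      with momentum_norm_sq_le[OF momentum(3,4), of "gap k i \<xi>" "(1 - \<mu>) *\<^sub>R ?m \<xi>"]
      show "(norm ((1 - \<mu>) *\<^sub>R (gap k i \<xi> + ?m \<xi>)))\<^sup>2 \<le> (1 - \<mu>) * (norm (gap k i \<xi>))\<^sup>2 +
          4 / \<mu> * (norm (dx k \<xi>))\<^sup>2 + 4 / \<mu> * (norm (p\<^sub>s *\<^sub>R err k i \<xi>))\<^sup>2"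
        by (simp add: scaleR_add_right distrib_left del: norm_scaleR)
    qed (intro L2_intros L2_gap L2_err)+
    finally show ?thesis unfolding msq_scaleR by (simp add: step_sq_def distrib_left add.assoc)
  qed
  from worker_mean_mono[OF this, of "\<lambda>i. i"] show ?thesis
    unfolding err_sq_def gap_sq_def by (simp only: worker_mean_mult worker_mean_add worker_mean_const)
qed

text \<open>
  The recursion compares with the gradient of \<open>F\<close> at the server's point directly, so the gradients at the
  workers' points enter only through functional similarity and carry the small weight \<open>\<nu>\<close>.
\<close>

lemma momentum_err_step:
  "momentum_err (Suc k) \<le> (1 - \<nu>) * momentum_err k + (4 / \<nu>) * L\<^sup>2 * step_sq k
     + 4 * \<nu> * (L\<^sub>A\<^sup>2 * dev_sq (Suc k) + L\<^sub>B\<^sup>2 * mean_dev_sq (Suc k)) + \<nu>\<^sup>2 * (\<sigma>\<^sup>2 / (real b * real CARD('n)))"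
proof -
  let ?F = "\<lambda>k \<xi>. worker_mean (\<lambda>i. gradient (f i) (x k \<xi>))"
  let ?h = "\<lambda>\<xi>. worker_mean (\<lambda>i. v k i \<xi>) - ?F k \<xi>"
  let ?B = "\<lambda>\<xi>. ?F (Suc k) \<xi> - ?F k \<xi>"
  let ?c = "\<lambda>\<xi>. worker_mean (\<lambda>i. gradient (f i) (y (Suc k) i \<xi>)) - ?F (Suc k) \<xi>"
  let ?A = "\<lambda>\<xi>. (1 - \<nu>) *\<^sub>R ?h \<xi> + (\<nu> *\<^sub>R ?c \<xi> - (1 - \<nu>) *\<^sub>R ?B \<xi>)"
  have A: "regular (5 * k + 2) ?A"
    by (intro regular_intros regular_x regular_x_Suc regular_y_Suc regular_v) auto
  have eq: "worker_mean (\<lambda>i. v (Suc k) i \<xi>) - ?F (Suc k) \<xi> = ?A \<xi> + (\<Sum>i\<in>UNIV. (\<nu> / real CARD('n)) *\<^sub>R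
     (mb (Suc k) i \<xi> (y (Suc k) i \<xi>) - gradient (f i) (y (Suc k) i \<xi>)))" for \<xi>
  proof -
    have "(\<Sum>i\<in>UNIV. (\<nu> / real CARD('n)) *\<^sub>R (mb (Suc k) i \<xi> (y (Suc k) i \<xi>) - gradient (f i) (y (Suc k) i \<xi>))) =
       \<nu> *\<^sub>R (worker_mean (\<lambda>i. mb (Suc k) i \<xi> (y (Suc k) i \<xi>)) - worker_mean (\<lambda>i. gradient (f i) (y (Suc k) i \<xi>)))"
      unfolding worker_mean_diff[symmetric] by (simp add: worker_mean_def scaleR_sum_right)
    moreover have "worker_mean (\<lambda>i. v (Suc k) i \<xi>) = (1 - \<nu>) *\<^sub>R worker_mean (\<lambda>i. v k i \<xi>) +
       \<nu> *\<^sub>R worker_mean (\<lambda>i. mb (Suc k) i \<xi> (y (Suc k) i \<xi>))"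
      unfolding v_Suc worker_mean_add worker_mean_scaleR ..
    ultimately show ?thesis by (simp only:) (simp add: algebra_simps)
  qed
  have "momentum_err (Suc k) \<le> msq ?A + (\<Sum>i\<in>(UNIV::'n set). (\<nu> / real CARD('n))\<^sup>2) * (\<sigma>\<^sup>2 / real b)"
    unfolding momentum_err_def eq by (rule gradient_noise[OF A])
  also have "(\<Sum>i\<in>(UNIV::'n set). (\<nu> / real CARD('n))\<^sup>2) * (\<sigma>\<^sup>2 / real b) = \<nu>\<^sup>2 * (\<sigma>\<^sup>2 / (real b * real CARD('n)))"
    by (simp add: power2_eq_square)
  also have "msq ?A \<le> (1 - \<nu>) * momentum_err k + (4 / \<nu>) * L\<^sup>2 * step_sq k
     + 4 * \<nu> * (L\<^sub>A\<^sup>2 * dev_sq (Suc k) + L\<^sub>B\<^sup>2 * mean_dev_sq (Suc k))"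
  proof -
    have Bpt: "(norm (?B \<xi>))\<^sup>2 \<le> L\<^sup>2 * (norm (dx k \<xi>))\<^sup>2" for \<xi>
    proof -
      have "norm (gradient (f i) (x (Suc k) \<xi>) - gradient (f i) (x k \<xi>)) \<le> L * norm (dx k \<xi>)" for i
        using lipschitz_onD[OF grad_Lipschitz, of "x (Suc k) \<xi>" "x k \<xi>" i] by (simp add: dist_norm dx_def)
      from norm_worker_mean_le[OF this] show ?thesis
        unfolding power_mult_distrib[symmetric] worker_mean_diff[symmetric] by (rule power_mono) simp
    qed
    have cpt: "(norm (?c \<xi>))\<^sup>2 \<le> L\<^sub>A\<^sup>2 * worker_mean (\<lambda>i. (norm (dev (Suc k) i \<xi>))\<^sup>2) +
        L\<^sub>B\<^sup>2 * (norm (worker_mean (\<lambda>i. dev (Suc k) i \<xi>)))\<^sup>2" for \<xi>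
      using similarity[unfolded functional_similarity_def, rule_format, of "x (Suc k) \<xi>" "\<lambda>i. dev (Suc k) i \<xi>"]
      by (simp add: dev_def worker_mean_diff)
    have cL: "msq ?c \<le> L\<^sub>A\<^sup>2 * dev_sq (Suc k) + L\<^sub>B\<^sup>2 * mean_dev_sq (Suc k)"
    proof -
      have wm: "(\<lambda>\<xi>. worker_mean (\<lambda>i. (norm (dev (Suc k) i \<xi>))\<^sup>2)) =
         (\<lambda>\<xi>. 1 / real CARD('n) * (\<Sum>i\<in>UNIV. (norm (dev (Suc k) i \<xi>))\<^sup>2))"
        by (simp add: worker_mean_def)
      have i1: "integrable M (\<lambda>\<xi>. worker_mean (\<lambda>i. (norm (dev (Suc k) i \<xi>))\<^sup>2))"
        and e1: "expectation (\<lambda>\<xi>. worker_mean (\<lambda>i. (norm (dev (Suc k) i \<xi>))\<^sup>2)) = dev_sq (Suc k)"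
        using L2_dev[THEN square_integrable_integrable] unfolding wm
        by (simp_all add: dev_sq_def worker_mean_def Bochner_Integration.integral_sum)
      have i2: "integrable M (\<lambda>\<xi>. (norm (worker_mean (\<lambda>i. dev (Suc k) i \<xi>)))\<^sup>2)"
        by (intro square_integrable_integrable L2_intros L2_dev)
      have "msq ?c \<le> expectation (\<lambda>\<xi>. L\<^sub>A\<^sup>2 * worker_mean (\<lambda>i. (norm (dev (Suc k) i \<xi>))\<^sup>2) +
        L\<^sub>B\<^sup>2 * (norm (worker_mean (\<lambda>i. dev (Suc k) i \<xi>)))\<^sup>2)"
        using i1 i2 cpt by (intro integral_mono square_integrable_integrable) (auto intro!: L2_intros)
      thus ?thesis using i1 i2 e1 by (simp add: mean_dev_sq_def)
    qed
    have "msq ?A \<le> (1 - \<nu>) * msq ?h + (4 / \<nu> * L\<^sup>2) * msq (dx k) + (4 * \<nu>) * msq ?c"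
    proof (rule msq_le3)
      fix \<xi>
      have "(norm (\<nu> *\<^sub>R ?c \<xi> - (1 - \<nu>) *\<^sub>R ?B \<xi>))\<^sup>2 \<le>
          2 * (norm (\<nu> *\<^sub>R ?c \<xi>))\<^sup>2 + 2 * (norm ((1 - \<nu>) *\<^sub>R ?B \<xi>))\<^sup>2"
        by (rule norm_diff_sq_le2)
      also have "(norm ((1 - \<nu>) *\<^sub>R ?B \<xi>))\<^sup>2 \<le> 1 * (norm (?B \<xi>))\<^sup>2"
        unfolding norm_scaleR power_mult_distrib using momentum
        by (intro mult_right_mono) (auto simp: power_le_one)
      also have "1 * (norm (?B \<xi>))\<^sup>2 \<le> L\<^sup>2 * (norm (dx k \<xi>))\<^sup>2" using Bpt by simp
      also have "(norm (\<nu> *\<^sub>R ?c \<xi>))\<^sup>2 = \<nu>\<^sup>2 * (norm (?c \<xi>))\<^sup>2" by (simp add: power_mult_distrib)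
      finally have "2 / \<nu> * (norm (\<nu> *\<^sub>R ?c \<xi> - (1 - \<nu>) *\<^sub>R ?B \<xi>))\<^sup>2 \<le>
          2 / \<nu> * (2 * (\<nu>\<^sup>2 * (norm (?c \<xi>))\<^sup>2) + 2 * (L\<^sup>2 * (norm (dx k \<xi>))\<^sup>2))"
        using momentum by (intro mult_left_mono) auto
      also have "\<dots> = (4 / \<nu> * L\<^sup>2) * (norm (dx k \<xi>))\<^sup>2 + (4 * \<nu>) * (norm (?c \<xi>))\<^sup>2"
        using momentum by (simp add: field_simps power2_eq_square)
      finally show "(norm (?A \<xi>))\<^sup>2 \<le> (1 - \<nu>) * (norm (?h \<xi>))\<^sup>2 + (4 / \<nu> * L\<^sup>2) * (norm (dx k \<xi>))\<^sup>2 +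
           (4 * \<nu>) * (norm (?c \<xi>))\<^sup>2"
        using momentum_norm_sq_le[OF momentum(1,2), of "?h \<xi>" "\<nu> *\<^sub>R ?c \<xi> - (1 - \<nu>) *\<^sub>R ?B \<xi>"] by linarith
    qed (intro L2_intros)+
    moreover have "4 * \<nu> * msq ?c \<le> 4 * \<nu> * (L\<^sub>A\<^sup>2 * dev_sq (Suc k) + L\<^sub>B\<^sup>2 * mean_dev_sq (Suc k))"
      using cL momentum by (intro mult_left_mono) auto
    ultimately show ?thesis by (simp add: momentum_err_def step_sq_def)
  qed
  finally show ?thesis by simp
qed

text \<open>
  One minibatch refreshes \<open>v\<close> with weight \<open>\<nu>\<close>. The same centered noise is added to the tracking error and
  to the change of \<open>v\<close>.
\<close>

lemma tracking_noise:
  "msq (\<lambda>\<xi>. v (Suc k) i \<xi> - gradient (f i) (y (Suc k) i \<xi>)) \<le>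
     msq (\<lambda>\<xi>. (1 - \<nu>) *\<^sub>R (v k i \<xi> - gradient (f i) (y (Suc k) i \<xi>))) + \<nu>\<^sup>2 * (\<sigma>\<^sup>2 / real b)"
  "msq (\<lambda>\<xi>. v (Suc k) i \<xi> - v k i \<xi>) \<le>
     msq (\<lambda>\<xi>. \<nu> *\<^sub>R (gradient (f i) (y (Suc k) i \<xi>) - v k i \<xi>)) + \<nu>\<^sup>2 * (\<sigma>\<^sup>2 / real b)"
proof -
  let ?\<beta> = "\<lambda>j. if j = i then \<nu> else 0"
  let ?d = "\<lambda>\<xi>. v k i \<xi> - gradient (f i) (y (Suc k) i \<xi>)"
  have d: "regular (5 * k + 2) (\<lambda>\<xi>. (1 - \<nu>) *\<^sub>R ?d \<xi>)"
    "regular (5 * k + 2) (\<lambda>\<xi>. \<nu> *\<^sub>R (gradient (f i) (y (Suc k) i \<xi>) - v k i \<xi>))"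
    by (intro regular_intros regular_y_Suc regular_v; simp)+
  have var: "(\<Sum>j\<in>(UNIV::'n set). (?\<beta> j)\<^sup>2) = \<nu>\<^sup>2"
    using sum_single_mult[of i \<nu> "\<lambda>_. 1"] by simp
  have eq1: "v (Suc k) i \<xi> - gradient (f i) (y (Suc k) i \<xi>) = (1 - \<nu>) *\<^sub>R ?d \<xi> + (\<Sum>i\<in>UNIV. ?\<beta> i *\<^sub>R
     (mb (Suc k) i \<xi> (y (Suc k) i \<xi>) - gradient (f i) (y (Suc k) i \<xi>)))" for \<xi>
    unfolding sum_single_scaleR v_Suc by (simp add: algebra_simps)
  have eq2: "v (Suc k) i \<xi> - v k i \<xi> = \<nu> *\<^sub>R (gradient (f i) (y (Suc k) i \<xi>) - v k i \<xi>) + (\<Sum>i\<in>UNIV. ?\<beta> i *\<^sub>R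
     (mb (Suc k) i \<xi> (y (Suc k) i \<xi>) - gradient (f i) (y (Suc k) i \<xi>)))" for \<xi>
    unfolding sum_single_scaleR v_Suc by (simp add: algebra_simps)
  show "msq (\<lambda>\<xi>. v (Suc k) i \<xi> - gradient (f i) (y (Suc k) i \<xi>)) \<le>
     msq (\<lambda>\<xi>. (1 - \<nu>) *\<^sub>R ?d \<xi>) + \<nu>\<^sup>2 * (\<sigma>\<^sup>2 / real b)"
    unfolding eq1 using gradient_noise[OF d(1), of ?\<beta>] unfolding var .
  show "msq (\<lambda>\<xi>. v (Suc k) i \<xi> - v k i \<xi>) \<le>
     msq (\<lambda>\<xi>. \<nu> *\<^sub>R (gradient (f i) (y (Suc k) i \<xi>) - v k i \<xi>)) + \<nu>\<^sup>2 * (\<sigma>\<^sup>2 / real b)"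
    unfolding eq2 using gradient_noise[OF d(2), of ?\<beta>] unfolding var .
qed

lemma tracking_err_step: "tracking_err (Suc k) \<le> (1 - \<nu>) * tracking_err k + (2 / \<nu>) * L\<^sup>2 * move_sq k + \<nu>\<^sup>2 * (\<sigma>\<^sup>2 / real b)"
proof -
  have "msq (\<lambda>\<xi>. v (Suc k) i \<xi> - gradient (f i) (y (Suc k) i \<xi>)) \<le>
     (1 - \<nu>) * msq (\<lambda>\<xi>. v k i \<xi> - gradient (f i) (y k i \<xi>)) +
     (2 / \<nu> * L\<^sup>2) * msq (\<lambda>\<xi>. y (Suc k) i \<xi> - y k i \<xi>) + \<nu>\<^sup>2 * (\<sigma>\<^sup>2 / real b)" for i
  proof -
    have "msq (\<lambda>\<xi>. (1 - \<nu>) *\<^sub>R (v k i \<xi> - gradient (f i) (y (Suc k) i \<xi>))) \<le>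
       (1 - \<nu>) * msq (\<lambda>\<xi>. v k i \<xi> - gradient (f i) (y k i \<xi>)) +
       (2 / \<nu> * L\<^sup>2) * msq (\<lambda>\<xi>. y (Suc k) i \<xi> - y k i \<xi>)"
    proof (rule msq_le)
      fix \<xi>
      let ?g = "gradient (f i) (y (Suc k) i \<xi>) - gradient (f i) (y k i \<xi>)"
      have "(norm (- (1 - \<nu>) *\<^sub>R ?g))\<^sup>2 \<le> 1 * (norm ?g)\<^sup>2"
        unfolding norm_scaleR power_mult_distrib using momentum
        by (intro mult_right_mono) (auto simp: power_le_one)
      also have "\<dots> \<le> L\<^sup>2 * (norm (y (Suc k) i \<xi> - y k i \<xi>))\<^sup>2" using grad_diff_le by simp
      finally have "2 / \<nu> * (norm (- (1 - \<nu>) *\<^sub>R ?g))\<^sup>2 \<le> 2 / \<nu> * (L\<^sup>2 * (norm (y (Suc k) i \<xi> - y k i \<xi>))\<^sup>2)"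
        using momentum by (intro mult_left_mono) auto
      moreover have "(1 - \<nu>) *\<^sub>R (v k i \<xi> - gradient (f i) (y (Suc k) i \<xi>)) =
          (1 - \<nu>) *\<^sub>R (v k i \<xi> - gradient (f i) (y k i \<xi>)) + (- (1 - \<nu>) *\<^sub>R ?g)"
        by (simp add: algebra_simps)
      ultimately show "(norm ((1 - \<nu>) *\<^sub>R (v k i \<xi> - gradient (f i) (y (Suc k) i \<xi>))))\<^sup>2 \<le>
          (1 - \<nu>) * (norm (v k i \<xi> - gradient (f i) (y k i \<xi>)))\<^sup>2 +
          (2 / \<nu> * L\<^sup>2) * (norm (y (Suc k) i \<xi> - y k i \<xi>))\<^sup>2"
        using momentum_norm_sq_le[OF momentum(1,2), of "v k i \<xi> - gradient (f i) (y k i \<xi>)" "- (1 - \<nu>) *\<^sub>R ?g"]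
        by (simp only: mult.assoc)
    qed (intro L2_intros)+
    with tracking_noise(1)[of k i] show ?thesis by linarith
  qed
  from worker_mean_mono[OF this, of "\<lambda>i. i"] show ?thesis
    unfolding tracking_err_def move_sq_def by (simp only: worker_mean_mult worker_mean_add worker_mean_const)
qed

lemma change_sq_le: "change_sq k \<le> \<nu>\<^sup>2 * (2 * tracking_err k + 2 * L\<^sup>2 * move_sq k + \<sigma>\<^sup>2 / real b)"
proof -
  have "msq (\<lambda>\<xi>. v (Suc k) i \<xi> - v k i \<xi>) \<le>
     \<nu>\<^sup>2 * (2 * msq (\<lambda>\<xi>. v k i \<xi> - gradient (f i) (y k i \<xi>)) +
     2 * L\<^sup>2 * msq (\<lambda>\<xi>. y (Suc k) i \<xi> - y k i \<xi>) + \<sigma>\<^sup>2 / real b)" for i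
  proof -
    have "msq (\<lambda>\<xi>. gradient (f i) (y (Suc k) i \<xi>) - v k i \<xi>) \<le>
        (2 * L\<^sup>2) * msq (\<lambda>\<xi>. y (Suc k) i \<xi> - y k i \<xi>) + 2 * msq (\<lambda>\<xi>. v k i \<xi> - gradient (f i) (y k i \<xi>))"
    proof (rule msq_le)
      fix \<xi>
      have "gradient (f i) (y (Suc k) i \<xi>) - v k i \<xi> =
          (gradient (f i) (y (Suc k) i \<xi>) - gradient (f i) (y k i \<xi>)) - (v k i \<xi> - gradient (f i) (y k i \<xi>))"
        by simp
      hence "(norm (gradient (f i) (y (Suc k) i \<xi>) - v k i \<xi>))\<^sup>2 = (norm
          ((gradient (f i) (y (Suc k) i \<xi>) - gradient (f i) (y k i \<xi>)) - (v k i \<xi> - gradient (f i) (y k i \<xi>))))\<^sup>2"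
        by (rule arg_cong)
      with norm_diff_sq_le2[of "gradient (f i) (y (Suc k) i \<xi>) - gradient (f i) (y k i \<xi>)"
          "v k i \<xi> - gradient (f i) (y k i \<xi>)"] grad_diff_le[of i "y (Suc k) i \<xi>" "y k i \<xi>"]
      show "(norm (gradient (f i) (y (Suc k) i \<xi>) - v k i \<xi>))\<^sup>2 \<le>
          (2 * L\<^sup>2) * (norm (y (Suc k) i \<xi> - y k i \<xi>))\<^sup>2 + 2 * (norm (v k i \<xi> - gradient (f i) (y k i \<xi>)))\<^sup>2"
        by linarith
    qed (intro L2_intros)+
    hence "\<nu>\<^sup>2 * msq (\<lambda>\<xi>. gradient (f i) (y (Suc k) i \<xi>) - v k i \<xi>) \<le> \<nu>\<^sup>2 * \<dots>"
      by (rule mult_left_mono) simp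
    thus ?thesis using tracking_noise(2)[of k i] unfolding msq_scaleR by (simp add: algebra_simps)
  qed
  from worker_mean_mono[OF this, of "\<lambda>i. i"] show ?thesis
    unfolding tracking_err_def move_sq_def change_sq_def by (simp only: worker_mean_mult worker_mean_add worker_mean_const)
qed

text \<open>
  With probability \<open>p\<close> the server receives the exact mean of the \<open>v\<close>; otherwise the workers' independent
  compression errors are added.
\<close>

lemma compress_err_step: "compress_err (Suc k) \<le> (1 - p) * (compress_err k + \<omega> / real CARD('n) * change_sq k)"
proof -
  let ?A = "\<lambda>\<xi>. g k \<xi> - worker_mean (\<lambda>i. v k i \<xi>)"
  let ?X = "\<lambda>i \<xi>. v (Suc k) i \<xi> - v k i \<xi>"
  let ?T = "\<lambda>\<xi>. ?A \<xi> + (\<Sum>i\<in>UNIV. (1 / real CARD('n)) *\<^sub>R (rand_compress K (worker_set R k i \<xi>) (?X i \<xi>) - ?X i \<xi>))"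
  have A: "regular (5 * k + 3) ?A" by (intro regular_intros regular_g regular_v) auto
  note N = worker_noise[OF A, of "\<lambda>_. 1 / real CARD('n)"]
  have "g (Suc k) \<xi> - worker_mean (\<lambda>i. v (Suc k) i \<xi>) = (if worker_coin R k \<xi> then 0 else ?T \<xi>)" for \<xi>
    by (simp add: g_Suc worker_mean_sum[symmetric] worker_mean_diff)
  hence "compress_err (Suc k) = msq (\<lambda>\<xi>. if worker_coin R k \<xi> then 0 else ?T \<xi>)" by (simp add: compress_err_def)
  also have "\<dots> = (1 - p) * msq ?T"
    by (subst worker_coin_split[OF regular_const N(1)]) simp
  also have "\<dots> \<le> (1 - p) * (msq ?A + (\<Sum>i\<in>UNIV. (1 / real CARD('n))\<^sup>2 * (\<omega> * msq (?X i))))"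
    using N(2) p_bounds by (intro mult_left_mono) auto
  also have "(\<Sum>i\<in>UNIV. (1 / real CARD('n))\<^sup>2 * (\<omega> * msq (?X i))) = \<omega> / real CARD('n) * change_sq k"
    unfolding sum_mean_mult worker_mean_mult change_sq_def by simp
  finally show ?thesis by (simp add: compress_err_def)
qed

lemma initial_noise: "momentum_err 0 \<le> \<sigma>\<^sup>2 / (real (batch 0) * real CARD('n))" "tracking_err 0 \<le> \<sigma>\<^sup>2 / real (batch 0)"
proof -
  have N: "msq (\<lambda>\<xi>. 0 + (\<Sum>i\<in>UNIV. \<beta> i *\<^sub>R (mb 0 i \<xi> x0 - gradient (f i) x0))) \<le>
      msq (\<lambda>_. 0) + (\<Sum>i\<in>UNIV. (\<beta> i)\<^sup>2) * (\<sigma>\<^sup>2 / real (batch 0))" for \<beta>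
    by (rule data_noise(3)[where P = "{}"]) (simp_all add: square_integrable_const finite_M)
  have "worker_mean (\<lambda>i. v 0 i \<xi>) - worker_mean (\<lambda>i. gradient (f i) (x 0 \<xi>)) =
      (\<Sum>i\<in>UNIV. (1 / real CARD('n)) *\<^sub>R (mb 0 i \<xi> x0 - gradient (f i) x0))" for \<xi>
    unfolding start worker_mean_diff[symmetric] by (rule worker_mean_sum)
  thus "momentum_err 0 \<le> \<sigma>\<^sup>2 / (real (batch 0) * real CARD('n))"
    using N[of "\<lambda>_. 1 / real CARD('n)"] by (simp add: momentum_err_def power2_eq_square mult.commute)
  have "msq (\<lambda>\<xi>. v 0 i \<xi> - gradient (f i) (y 0 i \<xi>)) \<le> \<sigma>\<^sup>2 / real (batch 0)" for i
    using N[of "\<lambda>j. if j = i then 1 else 0"] sum_single_mult[of i 1 "\<lambda>_. 1"]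
    by (simp add: start sum_single_scaleR)
  from worker_mean_mono[OF this, of "\<lambda>i. i"] show "tracking_err 0 \<le> \<sigma>\<^sup>2 / real (batch 0)"
    unfolding tracking_err_def worker_mean_const .
qed

section \<open>Summing the recursions\<close>

lemma coin_odds: "(1 - p\<^sub>s) = \<omega>\<^sub>s * p\<^sub>s" "(1 - p) = \<omega> * p"
  using \<omega>_nonneg by (simp_all add: \<omega>(2) \<omega>\<^sub>s(2) field_simps)

lemma sum_err_sq: "(\<Sum>k\<le>N. err_sq k) \<le> \<omega>\<^sub>s * (\<omega>\<^sub>s + 1) * (\<Sum>k\<le>N. step_sq k)"
  and ps_sum_err_sq: "p\<^sub>s * (\<Sum>k\<le>N. err_sq k) \<le> \<omega>\<^sub>s * (\<Sum>k\<le>N. step_sq k)"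
  and ps2_sum_err_sq: "p\<^sub>s\<^sup>2 * (\<Sum>k\<le>N. err_sq k) \<le> (\<Sum>k\<le>N. step_sq k)"
  and sum_mean_err_sq: "(\<Sum>k\<le>N. mean_err_sq k) \<le> \<omega>\<^sub>s / real CARD('n) * (\<omega>\<^sub>s + 1) * (\<Sum>k\<le>N. step_sq k)"
proof -
  let ?P = "\<Sum>k\<le>N. step_sq k"
  have P: "(\<Sum>k<N. step_sq k) \<le> ?P" "0 \<le> ?P"
    by (auto intro!: sum_mono2 sum_nonneg sequences_nonneg)
  have *: "p\<^sub>s * (\<Sum>k\<le>N. a k) \<le> \<omega>\<^sub>s * p\<^sub>s * (c * ?P)"
    if "\<And>k. a (Suc k) \<le> (1 - p\<^sub>s) * (a k + c * step_sq k)" "a 0 = 0" "\<And>k. 0 \<le> a k" "0 \<le> c" for a c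
  proof -
    have "p\<^sub>s * (\<Sum>k\<le>N. a k) \<le> a 0 + (\<Sum>k<N. (1 - p\<^sub>s) * (c * step_sq k))"
      using that p_bounds by (intro sum_geometric_recursion_le) (auto simp: distrib_left)
    also have "\<dots> = \<omega>\<^sub>s * p\<^sub>s * (c * (\<Sum>k<N. step_sq k))"
      by (simp add: that(2) coin_odds sum_distrib_left)
    also have "\<dots> \<le> \<omega>\<^sub>s * p\<^sub>s * (c * ?P)"
      using P that p_bounds \<omega>_nonneg by (intro mult_left_mono) auto
    finally show ?thesis .
  qed
  have ps1: "\<omega>\<^sub>s * p\<^sub>s \<le> 1" "p\<^sub>s * (\<omega>\<^sub>s + 1) = 1" using \<omega>_nonneg by (auto simp: \<omega>\<^sub>s(2) field_simps)
  have e1: "p\<^sub>s * (\<Sum>k\<le>N. err_sq k) \<le> \<omega>\<^sub>s * p\<^sub>s * (\<omega>\<^sub>s * ?P)"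
    by (rule *[OF err_sq_step]) (auto simp: start_zero sequences_nonneg \<omega>_nonneg)
  hence e2: "(\<Sum>k\<le>N. err_sq k) \<le> \<omega>\<^sub>s * (\<omega>\<^sub>s * ?P)"
    using p_bounds by (simp add: mult.assoc mult.left_commute[of \<omega>\<^sub>s p\<^sub>s])
  also have "\<dots> \<le> \<omega>\<^sub>s * (\<omega>\<^sub>s + 1) * ?P"
    using P \<omega>_nonneg by (simp add: algebra_simps)
  finally show "(\<Sum>k\<le>N. err_sq k) \<le> \<omega>\<^sub>s * (\<omega>\<^sub>s + 1) * ?P" .
  have "\<omega>\<^sub>s * p\<^sub>s * (\<omega>\<^sub>s * ?P) \<le> 1 * (\<omega>\<^sub>s * ?P)"
    using ps1 P \<omega>_nonneg by (intro mult_right_mono) auto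
  with e1 show pe: "p\<^sub>s * (\<Sum>k\<le>N. err_sq k) \<le> \<omega>\<^sub>s * ?P" by simp
  have "p\<^sub>s\<^sup>2 * (\<Sum>k\<le>N. err_sq k) \<le> p\<^sub>s * (\<omega>\<^sub>s * ?P)"
    unfolding power2_eq_square mult.assoc using pe p_bounds by (intro mult_left_mono) auto
  also have "\<dots> = (\<omega>\<^sub>s * p\<^sub>s) * ?P" by simp
  also have "\<dots> \<le> 1 * ?P" using ps1 P by (intro mult_right_mono) auto
  finally show "p\<^sub>s\<^sup>2 * (\<Sum>k\<le>N. err_sq k) \<le> ?P" by simp
  have "p\<^sub>s * (\<Sum>k\<le>N. mean_err_sq k) \<le> \<omega>\<^sub>s * p\<^sub>s * (\<omega>\<^sub>s / real CARD('n) * ?P)"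
    by (rule *[OF mean_err_sq_step]) (auto simp: start_zero sequences_nonneg \<omega>_nonneg)
  hence "p\<^sub>s * (\<Sum>k\<le>N. mean_err_sq k) \<le> p\<^sub>s * (\<omega>\<^sub>s * (\<omega>\<^sub>s / real CARD('n) * ?P))"
    by (simp only: mult_ac)
  hence "(\<Sum>k\<le>N. mean_err_sq k) \<le> \<omega>\<^sub>s * (\<omega>\<^sub>s / real CARD('n) * ?P)"
    using p_bounds by (simp only: mult_le_cancel_left_pos)
  also have "\<dots> \<le> (\<omega>\<^sub>s + 1) * (\<omega>\<^sub>s / real CARD('n) * ?P)"
    using P \<omega>_nonneg by (intro mult_right_mono) auto
  finally show "(\<Sum>k\<le>N. mean_err_sq k) \<le> \<omega>\<^sub>s / real CARD('n) * (\<omega>\<^sub>s + 1) * ?P" by (simp add: mult_ac)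
qed

lemma sum_tracking:
  assumes step: "\<And>k. a (Suc k) \<le> (1 - \<mu>) * a k + (4 / \<mu>) * step_sq k + 4 * \<mu> * e (Suc k)"
    and "a 0 = 0" "\<And>k. 0 \<le> a k" "\<And>k. 0 \<le> e k" and e: "(\<Sum>k\<le>N. e k) \<le> c * (\<Sum>k\<le>N. step_sq k)"
  shows "(\<Sum>k\<le>N. a k) \<le> (4 / \<mu>\<^sup>2 + 4 * c) * (\<Sum>k\<le>N. step_sq k)"
proof -
  have "\<mu> * (\<Sum>k\<le>N. a k) \<le> a 0 + (\<Sum>k<N. (4 / \<mu>) * step_sq k + 4 * \<mu> * e (Suc k))"
    using assms momentum by (intro sum_geometric_recursion_le) (auto simp: add.assoc)
  also have "\<dots> = (4 / \<mu>) * (\<Sum>k<N. step_sq k) + 4 * \<mu> * (\<Sum>k<N. e (Suc k))"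
    by (simp add: assms sum.distrib sum_distrib_left)
  also have "\<dots> \<le> (4 / \<mu>) * (\<Sum>k\<le>N. step_sq k) + 4 * \<mu> * (c * (\<Sum>k\<le>N. step_sq k))"
  proof (intro add_mono mult_left_mono)
    have "(\<Sum>k<N. e (Suc k)) \<le> (\<Sum>k\<le>N. e k)"
      using assms(4) by (simp add: sum.atMost_shift)
    thus "(\<Sum>k<N. e (Suc k)) \<le> c * (\<Sum>k\<le>N. step_sq k)" using e by simp
  qed (use momentum in \<open>auto intro!: sum_mono2 sequences_nonneg\<close>)
  also have "\<dots> = \<mu> * ((4 / \<mu>\<^sup>2 + 4 * c) * (\<Sum>k\<le>N. step_sq k))"
    using momentum by (simp add: field_simps power2_eq_square)
  finally show ?thesis using momentum by simp
qed

lemmas sum_dev_sq = sum_tracking[OF dev_sq_step start_zero(3) sequences_nonneg(4,2) sum_err_sq]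
lemmas sum_mean_dev_sq = sum_tracking[OF mean_dev_sq_step start_zero(4) sequences_nonneg(5,3) sum_mean_err_sq]

text \<open>
  The square of the compressor parameter has disappeared: \<open>p\<^sub>s\<^sup>2\<close> and \<open>p\<^sub>s\<close> times the synchronization errors sum to
  at most \<open>1\<close> and \<open>\<omega>\<^sub>s\<close> times the squared steps, and the part with \<open>\<omega>\<^sub>s\<close> carries only a single factor \<open>\<mu>\<close>.
\<close>

lemma sum_move_sq: "(\<Sum>k\<le>N. move_sq k) \<le> (24 + 6 * \<mu> * \<omega>\<^sub>s) * (\<Sum>k\<le>N. step_sq k)"
proof -
  let ?P = "\<Sum>k\<le>N. step_sq k"
  let ?m = "\<lambda>k. step_sq k + p\<^sub>s\<^sup>2 * err_sq k" and ?V = "\<lambda>k. p\<^sub>s * err_sq k + \<omega>\<^sub>s * step_sq k"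
  have m: "(\<Sum>k\<le>N. ?m k) \<le> 2 * ?P"
    using ps2_sum_err_sq[of N] by (simp add: sum.distrib sum_distrib_left[symmetric])
  have V: "(\<Sum>k\<le>N. ?V k) \<le> 2 * \<omega>\<^sub>s * ?P"
    using ps_sum_err_sq[of N] by (simp add: sum.distrib sum_distrib_left[symmetric])
  have nn: "0 \<le> ?m k" "0 \<le> ?V k" for k
    using sequences_nonneg p_bounds \<omega>_nonneg by auto
  have P: "0 \<le> ?P" by (intro sum_nonneg sequences_nonneg)
  have "\<mu> * (\<Sum>k\<le>N. gap_sq k) \<le> gap_sq 0 + (\<Sum>k<N. (4 / \<mu>) * ?m k + ?V k)"
    using gap_sq_step sequences_nonneg momentum
    by (intro sum_geometric_recursion_le) (auto simp: add.assoc)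
  also have "\<dots> \<le> (\<Sum>k\<le>N. (4 / \<mu>) * ?m k + ?V k)"
    unfolding start_zero add_0 using nn momentum sequences_nonneg p_bounds \<omega>_nonneg
    by (intro sum_mono2 add_nonneg_nonneg mult_nonneg_nonneg[of "4 / \<mu>"]) auto
  also have "\<dots> = (4 / \<mu>) * (\<Sum>k\<le>N. ?m k) + (\<Sum>k\<le>N. ?V k)"
    by (subst sum.distrib) (simp only: sum_distrib_left)
  also have "\<dots> \<le> (4 / \<mu>) * (2 * ?P) + 2 * \<omega>\<^sub>s * ?P"
    using m V momentum by (intro add_mono mult_left_mono) auto
  finally have a: "\<mu> * (\<Sum>k\<le>N. gap_sq k) \<le> (8 / \<mu> + 2 * \<omega>\<^sub>s) * ?P" by (simp add: algebra_simps)
  have "(\<Sum>k\<le>N. move_sq k) \<le> (\<Sum>k\<le>N. \<mu>\<^sup>2 * (2 * gap_sq k + 4 * ?m k + ?V k))"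
    by (intro sum_mono move_sq_le)
  also have "\<dots> = 2 * \<mu> * (\<mu> * (\<Sum>k\<le>N. gap_sq k)) + \<mu>\<^sup>2 * (4 * (\<Sum>k\<le>N. ?m k) + (\<Sum>k\<le>N. ?V k))"
    by (simp only: sum.distrib sum_distrib_left[symmetric] power2_eq_square) (simp add: algebra_simps)
  also have "\<dots> \<le> 2 * \<mu> * ((8 / \<mu> + 2 * \<omega>\<^sub>s) * ?P) + \<mu>\<^sup>2 * (4 * (2 * ?P) + 2 * \<omega>\<^sub>s * ?P)"
    using a m V momentum by (intro add_mono mult_left_mono) auto
  also have "\<dots> = (16 + 8 * \<mu>\<^sup>2 + (4 * \<mu> + 2 * \<mu>\<^sup>2) * \<omega>\<^sub>s) * ?P"
    using momentum by (simp add: field_simps)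
  also have "\<dots> \<le> (24 + 6 * \<mu> * \<omega>\<^sub>s) * ?P"
  proof -
    have "\<mu>\<^sup>2 \<le> \<mu>" "\<mu>\<^sup>2 \<le> 1" using momentum by (auto simp: power2_eq_square mult_le_one)
    hence "(4 * \<mu> + 2 * \<mu>\<^sup>2) * \<omega>\<^sub>s \<le> 6 * \<mu> * \<omega>\<^sub>s" "8 * \<mu>\<^sup>2 \<le> 8"
      using \<omega>_nonneg by (auto intro!: mult_right_mono)
    thus ?thesis using P by (intro mult_right_mono) auto
  qed
  finally show ?thesis .
qed

lemma sum_momentum_err:
  "(\<Sum>k\<le>N. momentum_err k) \<le> \<sigma>\<^sup>2 / (real (batch 0) * real CARD('n)) / \<nu> +
    (4 / \<nu>\<^sup>2 * L\<^sup>2 + 16 * L\<^sub>A\<^sup>2 * (1 / \<mu>\<^sup>2 + \<omega>\<^sub>s * (\<omega>\<^sub>s + 1)) +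
      16 * L\<^sub>B\<^sup>2 * (1 / \<mu>\<^sup>2 + \<omega>\<^sub>s / real CARD('n) * (\<omega>\<^sub>s + 1))) * (\<Sum>k\<le>N. step_sq k) +
    real (Suc N) * (\<nu> * (\<sigma>\<^sup>2 / (real b * real CARD('n))))"
proof -
  let ?P = "\<Sum>k\<le>N. step_sq k" and ?c = "\<sigma>\<^sup>2 / (real b * real CARD('n))"
  have sumSuc: "(\<Sum>k<N. a (Suc k)) \<le> (\<Sum>k\<le>N. a k)" if "\<And>k. 0 \<le> a k" for a :: "nat \<Rightarrow> real"
    using that by (simp add: sum.atMost_shift)
  have "\<nu> * (\<Sum>k\<le>N. momentum_err k) \<le> momentum_err 0 + (\<Sum>k<N. (4 / \<nu>) * L\<^sup>2 * step_sq k
     + 4 * \<nu> * (L\<^sub>A\<^sup>2 * dev_sq (Suc k) + L\<^sub>B\<^sup>2 * mean_dev_sq (Suc k)) + \<nu>\<^sup>2 * ?c)"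
    using momentum_err_step sequences_nonneg momentum
    by (intro sum_geometric_recursion_le) (auto simp: add.assoc)
  also have "\<dots> = momentum_err 0 + ((4 / \<nu>) * L\<^sup>2 * (\<Sum>k<N. step_sq k) +
      4 * \<nu> * (L\<^sub>A\<^sup>2 * (\<Sum>k<N. dev_sq (Suc k)) + L\<^sub>B\<^sup>2 * (\<Sum>k<N. mean_dev_sq (Suc k))) + real N * (\<nu>\<^sup>2 * ?c))"
    by (simp only: sum.distrib sum_distrib_left[symmetric] distrib_left sum_constant card_lessThan add.assoc)
      (simp only: mult.left_commute)
  also have "\<dots> \<le> \<sigma>\<^sup>2 / (real (batch 0) * real CARD('n)) + ((4 / \<nu>) * L\<^sup>2 * ?P +
      4 * \<nu> * (L\<^sub>A\<^sup>2 * ((4 / \<mu>\<^sup>2 + 4 * (\<omega>\<^sub>s * (\<omega>\<^sub>s + 1))) * ?P) +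
        L\<^sub>B\<^sup>2 * ((4 / \<mu>\<^sup>2 + 4 * (\<omega>\<^sub>s / real CARD('n) * (\<omega>\<^sub>s + 1))) * ?P)) + real (Suc N) * (\<nu>\<^sup>2 * ?c))"
    using momentum initial_noise(1) order_trans[OF sumSuc sum_dev_sq] order_trans[OF sumSuc sum_mean_dev_sq]
    by (intro add_mono mult_left_mono mult_right_mono sum_mono2) (auto simp: sequences_nonneg)
  also have "\<dots> = \<nu> * (\<sigma>\<^sup>2 / (real (batch 0) * real CARD('n)) / \<nu> +
    (4 / \<nu>\<^sup>2 * L\<^sup>2 + 16 * L\<^sub>A\<^sup>2 * (1 / \<mu>\<^sup>2 + \<omega>\<^sub>s * (\<omega>\<^sub>s + 1)) +
      16 * L\<^sub>B\<^sup>2 * (1 / \<mu>\<^sup>2 + \<omega>\<^sub>s / real CARD('n) * (\<omega>\<^sub>s + 1))) * ?P +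
    real (Suc N) * (\<nu> * ?c))"
  proof -
    have \<nu>: "\<nu> * (a / \<nu>) = a" "\<nu> * (4 / \<nu>\<^sup>2 * a) = 4 / \<nu> * a" for a
      using momentum by (simp_all add: field_simps power2_eq_square)
    show ?thesis unfolding distrib_left distrib_right mult.assoc[symmetric] \<nu>
      using momentum by (simp add: field_simps power2_eq_square)
  qed
  finally show ?thesis using momentum by (simp only: mult_le_cancel_left_pos)
qed

text \<open>
  The part of the tracking error that is caused by the movement of the workers' points. Splitting it off leaves the
  initial noise and the stationary noise, which have closed forms.
\<close>

primrec drift :: "nat \<Rightarrow> real" where
  "drift 0 = 0"
| "drift (Suc k) = (1 - \<nu>) * drift k + (2 / \<nu>) * L\<^sup>2 * move_sq k"

lemma drift_nonneg: "0 \<le> drift k"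
  using momentum sequences_nonneg by (induction k) auto

lemma tracking_err_le: "tracking_err k \<le> (1 - \<nu>) ^ k * tracking_err 0 + \<nu> * (\<sigma>\<^sup>2 / real b) + drift k"
proof (induction k)
  case 0
  show ?case using momentum by simp
next
  case (Suc k)
  let ?c = "\<sigma>\<^sup>2 / real b"
  have "tracking_err (Suc k) \<le> (1 - \<nu>) * tracking_err k + (2 / \<nu>) * L\<^sup>2 * move_sq k + \<nu>\<^sup>2 * ?c" by (rule tracking_err_step)
  also have "(1 - \<nu>) * tracking_err k \<le> (1 - \<nu>) * ((1 - \<nu>) ^ k * tracking_err 0 + \<nu> * ?c + drift k)"
    using Suc momentum by (intro mult_left_mono) auto
  also have "(1 - \<nu>) * (A * q + \<nu> * c + d) + z + \<nu>\<^sup>2 * c = (1 - \<nu>) * A * q + \<nu> * c + ((1 - \<nu>) * d + z)"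
    for A q c d z by (simp add: algebra_simps power2_eq_square)
  finally show ?case by simp
qed

lemma sum_drift: "\<nu>\<^sup>2 * (\<Sum>k\<le>N. drift k) \<le> 2 * L\<^sup>2 * (\<Sum>k\<le>N. move_sq k)"
proof -
  have "\<nu> * (\<Sum>k\<le>N. drift k) \<le> drift 0 + (\<Sum>k<N. (2 / \<nu>) * L\<^sup>2 * move_sq k)"
    using momentum drift_nonneg by (intro sum_geometric_recursion_le) auto
  also have "\<dots> \<le> (\<Sum>k\<le>N. (2 / \<nu>) * L\<^sup>2 * move_sq k)"
    using momentum sequences_nonneg by (auto intro!: sum_mono2)
  also have "\<dots> = (2 / \<nu>) * L\<^sup>2 * (\<Sum>k\<le>N. move_sq k)" by (simp add: sum_distrib_left)
  finally have "\<nu> * (\<nu> * (\<Sum>k\<le>N. drift k)) \<le> \<nu> * ((2 / \<nu>) * L\<^sup>2 * (\<Sum>k\<le>N. move_sq k))"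
    using momentum by (intro mult_left_mono) auto
  thus ?thesis using momentum by (simp add: power2_eq_square mult.assoc)
qed

text \<open>
  The part of the compression error that does not stem from the initial minibatches. It is summed with the
  factor \<open>1 / p\<close>, which the initial noise must avoid.
\<close>

primrec carry :: "nat \<Rightarrow> real" where
  "carry 0 = 0"
| "carry (Suc k) = (1 - p) * carry k + (1 - p) * (\<omega> / real CARD('n) *
     (3 * \<nu>\<^sup>2 * (\<sigma>\<^sup>2 / real b) + 2 * (\<nu>\<^sup>2 * drift k) + 2 * \<nu>\<^sup>2 * L\<^sup>2 * move_sq k))"

lemma carry_input_nonneg:
  "0 \<le> \<omega> / real CARD('n) * (3 * \<nu>\<^sup>2 * (\<sigma>\<^sup>2 / real b) + 2 * (\<nu>\<^sup>2 * drift k) + 2 * \<nu>\<^sup>2 * L\<^sup>2 * move_sq k)"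
  using \<omega>_nonneg drift_nonneg sequences_nonneg by (intro mult_nonneg_nonneg add_nonneg_nonneg) auto

lemma carry_nonneg: "0 \<le> carry k"
  by (induction k) (use p_bounds in \<open>auto intro!: add_nonneg_nonneg mult_nonneg_nonneg[OF _ carry_input_nonneg]
    simp del: times_divide_eq_left times_divide_eq_right\<close>)

text \<open>
  The inputs caused by the initial noise form a geometric series, so their total is bounded even if no
  synchronization ever removes them.
\<close>

lemma compress_err_le: "compress_err k \<le> carry k + 2 * \<omega> * \<nu> / real CARD('n) * tracking_err 0"
proof -
  let ?n = "real CARD('n)" and ?q = "tracking_err 0"
  \<comment> \<open>the partial sums of the geometric series of initial inputs\<close>
  define c where "c k = 2 * \<omega> * \<nu> / ?n * (1 - (1 - \<nu>) ^ k) * ?q" for k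
  have c0: "0 \<le> c k" for k
    using momentum \<omega>_nonneg sequences_nonneg by (auto simp: c_def power_le_one)
  have "compress_err k \<le> carry k + c k"
  proof (induction k)
    case 0
    show ?case by (simp add: start_zero c_def)
  next
    case (Suc k)
    let ?J = "3 * \<nu>\<^sup>2 * (\<sigma>\<^sup>2 / real b) + 2 * (\<nu>\<^sup>2 * drift k) + 2 * \<nu>\<^sup>2 * L\<^sup>2 * move_sq k"
    let ?I = "2 * \<nu>\<^sup>2 * ((1 - \<nu>) ^ k * ?q)"
    have "change_sq k \<le> ?I + ?J"
    proof -
      have "change_sq k \<le> \<nu>\<^sup>2 * (2 * tracking_err k + 2 * L\<^sup>2 * move_sq k + \<sigma>\<^sup>2 / real b)" by (rule change_sq_le)
      also have "\<dots> \<le> \<nu>\<^sup>2 * (2 * ((1 - \<nu>) ^ k * ?q + \<nu> * (\<sigma>\<^sup>2 / real b) + drift k) + 2 * L\<^sup>2 * move_sq k + \<sigma>\<^sup>2 / real b)"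
        using tracking_err_le by (intro mult_left_mono add_mono) auto
      also have "\<dots> \<le> \<nu>\<^sup>2 * (2 * ((1 - \<nu>) ^ k * ?q + 1 * (\<sigma>\<^sup>2 / real b) + drift k) + 2 * L\<^sup>2 * move_sq k + \<sigma>\<^sup>2 / real b)"
        using momentum by (intro mult_left_mono add_mono mult_right_mono) auto
      also have "\<dots> = ?I + ?J" by (simp add: algebra_simps)
      finally show ?thesis .
    qed
    hence "\<omega> / ?n * change_sq k \<le> \<omega> / ?n * (?I + ?J)" using \<omega>_nonneg by (intro mult_left_mono) auto
    with Suc have "compress_err k + \<omega> / ?n * change_sq k \<le> (carry k + c k) + \<omega> / ?n * (?I + ?J)" by (rule add_mono)
    from mult_left_mono[OF this, of "1 - p"]
    have "compress_err (Suc k) \<le> (1 - p) * ((carry k + c k) + \<omega> / ?n * (?I + ?J))"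
      using p_bounds order_trans[OF compress_err_step] by simp
    also have "\<dots> = carry (Suc k) + (1 - p) * (c k + \<omega> / ?n * ?I)"
      by (simp only: carry.simps distrib_left)
    also have "(1 - p) * (c k + \<omega> / ?n * ?I) \<le> 1 * (c k + \<omega> / ?n * ?I)"
      using p_bounds c0 \<omega>_nonneg momentum sequences_nonneg by (intro mult_right_mono add_nonneg_nonneg) auto
    also have "1 * (c k + \<omega> / ?n * ?I) = c (Suc k)"
      by (simp add: c_def field_simps power2_eq_square)
    finally show ?case by simp
  qed
  also have "c k \<le> 2 * \<omega> * \<nu> / ?n * 1 * ?q"
    unfolding c_def using momentum \<omega>_nonneg sequences_nonneg
    by (intro mult_right_mono mult_left_mono) auto
  finally show ?thesis by simp
qed

lemma sum_compress_err:
  "(\<Sum>k\<le>N. compress_err k) \<le> real (Suc N) * (2 * \<omega> * \<nu> / real CARD('n) * (\<sigma>\<^sup>2 / real (batch 0)))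
    + \<omega>\<^sup>2 / real CARD('n) * (real (Suc N) * (3 * \<nu>\<^sup>2 * (\<sigma>\<^sup>2 / real b)) +
        6 * L\<^sup>2 * ((24 + 6 * \<mu> * \<omega>\<^sub>s) * (\<Sum>k\<le>N. step_sq k)))"
proof -
  let ?n = "real CARD('n)"
  let ?c = "3 * \<nu>\<^sup>2 * (\<sigma>\<^sup>2 / real b)"
  let ?J = "\<lambda>k. ?c + 2 * (\<nu>\<^sup>2 * drift k) + 2 * \<nu>\<^sup>2 * L\<^sup>2 * move_sq k"
  have "p * (\<Sum>k\<le>N. carry k) \<le> carry 0 + (\<Sum>k<N. (1 - p) * (\<omega> / ?n * ?J k))"
    using p_bounds carry_nonneg by (intro sum_geometric_recursion_le) auto
  also have "\<dots> \<le> (\<Sum>k\<le>N. (1 - p) * (\<omega> / ?n * ?J k))"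
    unfolding carry.simps add_0 using p_bounds
    by (intro sum_mono2 mult_nonneg_nonneg[OF _ carry_input_nonneg]) auto
  also have "\<dots> = p * (\<omega>\<^sup>2 / ?n * (\<Sum>k\<le>N. ?J k))"
    unfolding sum_distrib_left[symmetric] coin_odds by (simp add: power2_eq_square)
  finally have "(\<Sum>k\<le>N. carry k) \<le> \<omega>\<^sup>2 / ?n * (\<Sum>k\<le>N. ?J k)"
    using p_bounds by (simp only: mult_le_cancel_left_pos)
  also have "(\<Sum>k\<le>N. ?J k) = real (Suc N) * ?c + 2 * (\<nu>\<^sup>2 * (\<Sum>k\<le>N. drift k)) + 2 * \<nu>\<^sup>2 * L\<^sup>2 * (\<Sum>k\<le>N. move_sq k)"
    by (simp only: sum.distrib sum_distrib_left[symmetric] sum_constant card_atMost)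
       (simp only: mult.left_commute mult.assoc)
  also have "\<omega>\<^sup>2 / ?n * \<dots> \<le> \<omega>\<^sup>2 / ?n * (real (Suc N) * ?c + 6 * L\<^sup>2 * ((24 + 6 * \<mu> * \<omega>\<^sub>s) * (\<Sum>k\<le>N. step_sq k)))"
  proof (rule mult_left_mono)
    have z: "0 \<le> (\<Sum>k\<le>N. move_sq k)" by (intro sum_nonneg sequences_nonneg)
    have "2 * \<nu>\<^sup>2 * L\<^sup>2 * (\<Sum>k\<le>N. move_sq k) \<le> 2 * 1 * L\<^sup>2 * (\<Sum>k\<le>N. move_sq k)"
      using z momentum by (intro mult_right_mono mult_left_mono) (auto simp: power_le_one)
    with sum_drift[of N]
    have "2 * (\<nu>\<^sup>2 * (\<Sum>k\<le>N. drift k)) + 2 * \<nu>\<^sup>2 * L\<^sup>2 * (\<Sum>k\<le>N. move_sq k) \<le> 6 * L\<^sup>2 * (\<Sum>k\<le>N. move_sq k)"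
      by linarith
    also have "\<dots> \<le> 6 * L\<^sup>2 * ((24 + 6 * \<mu> * \<omega>\<^sub>s) * (\<Sum>k\<le>N. step_sq k))"
      by (intro mult_left_mono sum_move_sq) auto
    finally show "real (Suc N) * ?c + 2 * (\<nu>\<^sup>2 * (\<Sum>k\<le>N. drift k)) + 2 * \<nu>\<^sup>2 * L\<^sup>2 * (\<Sum>k\<le>N. move_sq k) \<le>
       real (Suc N) * ?c + 6 * L\<^sup>2 * ((24 + 6 * \<mu> * \<omega>\<^sub>s) * (\<Sum>k\<le>N. step_sq k))" by linarith
  qed simp
  finally have carry: "(\<Sum>k\<le>N. carry k) \<le>
      \<omega>\<^sup>2 / ?n * (real (Suc N) * ?c + 6 * L\<^sup>2 * ((24 + 6 * \<mu> * \<omega>\<^sub>s) * (\<Sum>k\<le>N. step_sq k)))" .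
  have "(\<Sum>k\<le>N. compress_err k) \<le> (\<Sum>k\<le>N. carry k + 2 * \<omega> * \<nu> / ?n * (\<sigma>\<^sup>2 / real (batch 0)))"
  proof (rule sum_mono)
    fix k
    have "2 * \<omega> * \<nu> / ?n * tracking_err 0 \<le> 2 * \<omega> * \<nu> / ?n * (\<sigma>\<^sup>2 / real (batch 0))"
      using initial_noise(2) \<omega>_nonneg momentum by (intro mult_left_mono) auto
    thus "compress_err k \<le> carry k + 2 * \<omega> * \<nu> / ?n * (\<sigma>\<^sup>2 / real (batch 0))" using compress_err_le[of k] by linarith
  qed
  also have "\<dots> = (\<Sum>k\<le>N. carry k) + real (Suc N) * (2 * \<omega> * \<nu> / ?n * (\<sigma>\<^sup>2 / real (batch 0)))"
    by (simp only: sum.distrib sum_constant card_atMost)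
  finally show ?thesis using carry by linarith
qed

section \<open>Descent\<close>

abbreviation F :: "real ^ 'd \<Rightarrow> real" where "F \<equiv> \<lambda>a. worker_mean (\<lambda>i. f i a)"

lemma F_smooth: "smooth L F"
  by (rule smooth_worker_mean[OF f_smooth]) simp

lemma gradient_F: "gradient F a = worker_mean (\<lambda>i. gradient (f i) a)"
  by (rule gradient_worker_mean(2)[OF f_smooth])

lemma L2_gradient_F: "square_integrable M (\<lambda>\<xi>. gradient F (x k \<xi>))"
  unfolding gradient_F by (intro L2_intros)

text \<open>
  The descent inequality is telescoped for every outcome before the expectation is taken; so only
  squared norms have to be integrated.
\<close>

lemma sum_gradient_le:
  assumes "0 < \<gamma>" "\<And>a. fstar \<le> F a"
  shows "(\<Sum>k\<le>N. msq (\<lambda>\<xi>. gradient F (x k \<xi>))) \<le>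
    2 * (F x0 - fstar) / \<gamma> + (L / \<gamma> - 1 / \<gamma>\<^sup>2) * (\<Sum>k\<le>N. step_sq k) + 2 * (\<Sum>k\<le>N. compress_err k) + 2 * (\<Sum>k\<le>N. momentum_err k)"
proof -
  let ?E = "\<lambda>k \<xi>. g k \<xi> - gradient F (x k \<xi>)"
  have step: "F (x (Suc k) \<xi>) \<le> F (x k \<xi>) - \<gamma> / 2 * (norm (gradient F (x k \<xi>)))\<^sup>2
       + (L / 2 - 1 / (2 * \<gamma>)) * (norm (dx k \<xi>))\<^sup>2 + \<gamma> / 2 * (norm (?E k \<xi>))\<^sup>2" for k \<xi>
  proof -
    have "F (x (Suc k) \<xi>) \<le> F (x k \<xi>) + gradient F (x k \<xi>) \<bullet> dx k \<xi> + L / 2 * (norm (dx k \<xi>))\<^sup>2"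
      using smooth_upper_bound[OF F_smooth, of "x k \<xi>" "dx k \<xi>"] by (simp add: dx_def)
    also have "gradient F (x k \<xi>) \<bullet> dx k \<xi> = - \<gamma> / 2 * (norm (gradient F (x k \<xi>)))\<^sup>2
        - 1 / (2 * \<gamma>) * (norm (dx k \<xi>))\<^sup>2 + \<gamma> / 2 * (norm (?E k \<xi>))\<^sup>2"
    proof -
      have "(norm (- \<gamma> *\<^sub>R g k \<xi>))\<^sup>2 = \<gamma>\<^sup>2 * (norm (g k \<xi>))\<^sup>2" by (simp add: power_mult_distrib)
      hence sq: "1 / (2 * \<gamma>) * (norm (- \<gamma> *\<^sub>R g k \<xi>))\<^sup>2 = \<gamma> / 2 * (norm (g k \<xi>))\<^sup>2"
        using assms(1) by (simp add: power2_eq_square)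
      have ex: "(norm (?E k \<xi>))\<^sup>2 = (norm (g k \<xi>))\<^sup>2 - 2 * (gradient F (x k \<xi>) \<bullet> g k \<xi>) + (norm (gradient F (x k \<xi>)))\<^sup>2"
        by (simp add: power2_norm_eq_inner inner_diff_left inner_diff_right inner_commute)
      have "gradient F (x k \<xi>) \<bullet> (- \<gamma> *\<^sub>R g k \<xi>) = - \<gamma> * (gradient F (x k \<xi>) \<bullet> g k \<xi>)" by simp
      thus ?thesis unfolding dx_eq sq ex by (simp add: algebra_simps)
    qed
    finally show ?thesis by (simp add: algebra_simps)
  qed
  have tele: "F (x (Suc N) \<xi>) \<le> F x0 + (\<Sum>k\<le>N. - \<gamma> / 2 * (norm (gradient F (x k \<xi>)))\<^sup>2
       + (L / 2 - 1 / (2 * \<gamma>)) * (norm (dx k \<xi>))\<^sup>2 + \<gamma> / 2 * (norm (?E k \<xi>))\<^sup>2)" for \<xi>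
  proof (induction N)
    case 0
    show ?case using step[of 0 \<xi>] by (simp add: start)
  next
    case (Suc N)
    show ?case using step[of "Suc N" \<xi>] Suc by simp
  qed
  let ?S = "\<lambda>\<xi>. (\<Sum>k\<le>N. - \<gamma> / 2 * (norm (gradient F (x k \<xi>)))\<^sup>2
       + (L / 2 - 1 / (2 * \<gamma>)) * (norm (dx k \<xi>))\<^sup>2 + \<gamma> / 2 * (norm (?E k \<xi>))\<^sup>2)"
  have L2: "square_integrable M (\<lambda>\<xi>. gradient F (x k \<xi>))" "square_integrable M (dx k)"
    "square_integrable M (?E k)" for k
    by (rule L2_gradient_F) (intro L2_intros L2_gradient_F)+
  note int = L2[THEN square_integrable_integrable]
  have "fstar - F x0 \<le> expectation ?S"
  proof -
    have "expectation (\<lambda>_. fstar - F x0) \<le> expectation ?S"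
    proof (rule integral_mono)
      show "fstar - F x0 \<le> ?S \<xi>" for \<xi> using tele[of \<xi>] assms(2)[of "x (Suc N) \<xi>"] by linarith
    qed (use int in auto)
    thus ?thesis by (simp add: prob_space)
  qed
  also have "expectation ?S = (\<Sum>k\<le>N. - \<gamma> / 2 * msq (\<lambda>\<xi>. gradient F (x k \<xi>)) +
      (L / 2 - 1 / (2 * \<gamma>)) * step_sq k + \<gamma> / 2 * msq (?E k))"
    using int by (simp add: Bochner_Integration.integral_sum step_sq_def)
  also have "\<dots> \<le> (\<Sum>k\<le>N. - \<gamma> / 2 * msq (\<lambda>\<xi>. gradient F (x k \<xi>)) +
      (L / 2 - 1 / (2 * \<gamma>)) * step_sq k + \<gamma> / 2 * (2 * compress_err k + 2 * momentum_err k))"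
  proof (intro sum_mono add_left_mono mult_left_mono)
    fix k
    show "msq (?E k) \<le> 2 * compress_err k + 2 * momentum_err k"
      unfolding compress_err_def momentum_err_def
    proof (rule msq_le)
      fix \<xi>
      have "?E k \<xi> = (g k \<xi> - worker_mean (\<lambda>i. v k i \<xi>)) +
          (worker_mean (\<lambda>i. v k i \<xi>) - worker_mean (\<lambda>i. gradient (f i) (x k \<xi>)))"
        by (simp add: gradient_F)
      thus "(norm (?E k \<xi>))\<^sup>2 \<le> 2 * (norm (g k \<xi> - worker_mean (\<lambda>i. v k i \<xi>)))\<^sup>2 +
          2 * (norm (worker_mean (\<lambda>i. v k i \<xi>) - worker_mean (\<lambda>i. gradient (f i) (x k \<xi>))))\<^sup>2"
        by (simp only: norm_add_sq_le2)
    qed (rule L2 | intro L2_intros)+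
  qed (use assms in auto)
  also have "\<dots> = - (\<gamma> / 2) * (\<Sum>k\<le>N. msq (\<lambda>\<xi>. gradient F (x k \<xi>))) +
      (L / 2 - 1 / (2 * \<gamma>)) * (\<Sum>k\<le>N. step_sq k) + \<gamma> * ((\<Sum>k\<le>N. compress_err k) + (\<Sum>k\<le>N. momentum_err k))"
    by (simp add: sum.distrib sum_distrib_left sum_negf sum_subtractf distrib_left)
  finally have "\<gamma> / 2 * (\<Sum>k\<le>N. msq (\<lambda>\<xi>. gradient F (x k \<xi>))) \<le> (F x0 - fstar) +
      (L / 2 - 1 / (2 * \<gamma>)) * (\<Sum>k\<le>N. step_sq k) + \<gamma> * ((\<Sum>k\<le>N. compress_err k) + (\<Sum>k\<le>N. momentum_err k))"
    by linarith
  also have "\<dots> = \<gamma> / 2 * (2 * (F x0 - fstar) / \<gamma> + (L / \<gamma> - 1 / \<gamma>\<^sup>2) * (\<Sum>k\<le>N. step_sq k)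
       + 2 * (\<Sum>k\<le>N. compress_err k) + 2 * (\<Sum>k\<le>N. momentum_err k))"
    using assms(1) by (simp add: field_simps power2_eq_square)
  finally show ?thesis using assms(1) by simp
qed

text \<open>
  The errors of \<open>g\<close> cost at most \<open>360 * A\<close> times the sum of the squared steps, while the descent
  provides \<open>1 / \<gamma>\<^sup>2 - L / \<gamma>\<close>, where \<open>L / \<gamma>\<close> is at most one percent of \<open>1 / \<gamma>\<^sup>2\<close>. The remaining fractions
  of \<open>\<epsilon>\<close> add up to \<open>\<epsilon>\<close>: one quarter from the initial gap, one eighth from the initial minibatches in each
  of the two errors, one third from the stationary noise of the mean of the \<open>v\<close>, and one sixth from
  compressing the noise of the individual \<open>v\<close>.
\<close>

lemma average_gradient:
  fixes \<epsilon> \<eta> fstar A :: real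
  assumes "0 < \<gamma>" "\<And>a. fstar \<le> F a" "\<nu> = \<eta>" "\<mu> = \<eta>" "0 \<le> L\<^sub>A" "L\<^sub>A \<le> L" "0 \<le> L\<^sub>B" "L\<^sub>B \<le> L"
    and A: "A = \<omega>\<^sub>s * (\<omega>\<^sub>s + 1) * L\<^sub>A\<^sup>2 + \<omega>\<^sub>s / real CARD('n) * (\<omega>\<^sub>s + 1) * L\<^sub>B\<^sup>2
                   + (\<omega> * (\<omega> + 1) / real CARD('n) + 1 / \<eta>\<^sup>2) * L\<^sup>2"
    and step: "\<gamma>\<^sup>2 * A \<le> 1 / 10000"
    and e3: "\<eta> ^ 3 * (\<omega> * (\<omega> + 1) * \<omega>\<^sub>s) \<le> real CARD('n)"
    and e2: "\<eta> * (\<sigma>\<^sup>2 / (real b * real CARD('n))) \<le> \<epsilon> / 6"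
    and e1: "\<omega>\<^sup>2 / real CARD('n) * (3 * \<eta>\<^sup>2 * (\<sigma>\<^sup>2 / real b)) \<le> \<epsilon> / 12"
    and i1: "2 * \<omega> * \<eta> / real CARD('n) * (\<sigma>\<^sup>2 / real (batch 0)) \<le> \<epsilon> / 16"
    and i2: "\<sigma>\<^sup>2 / (real (batch 0) * real CARD('n)) / \<eta> \<le> real (Suc N) * (\<epsilon> / 16)"
    and D: "2 * (F x0 - fstar) / \<gamma> \<le> real (Suc N) * (\<epsilon> / 4)"
  shows "(\<Sum>k\<le>N. msq (\<lambda>\<xi>. gradient F (x k \<xi>))) \<le> real (Suc N) * \<epsilon>"
proof -
  let ?n = "real CARD('n)"
  let ?P = "\<Sum>k\<le>N. step_sq k" and ?T = "real (Suc N)"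
  define a1 a2 a3 a4 where "a1 = \<omega>\<^sub>s * (\<omega>\<^sub>s + 1) * L\<^sub>A\<^sup>2" and "a2 = \<omega>\<^sub>s / ?n * (\<omega>\<^sub>s + 1) * L\<^sub>B\<^sup>2"
    and "a3 = \<omega> * (\<omega> + 1) / ?n * L\<^sup>2" and "a4 = 1 / \<eta>\<^sup>2 * L\<^sup>2"
  have \<eta>: "0 < \<eta>" "\<eta> \<le> 1" using momentum assms by auto
  have A': "A = a1 + a2 + a3 + a4" by (simp add: A a1_def a2_def a3_def a4_def distrib_right)
  have a: "0 \<le> a1" "0 \<le> a2" "0 \<le> a3" "0 \<le> a4"
    using \<omega>_nonneg by (auto simp: a1_def a2_def a3_def a4_def)
  have P: "0 \<le> ?P" by (intro sum_nonneg sequences_nonneg)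
  have LAB: "L\<^sub>A\<^sup>2 \<le> L\<^sup>2" "L\<^sub>B\<^sup>2 \<le> L\<^sup>2" using assms by (auto intro: power_mono)
  have compress_err: "(\<Sum>k\<le>N. compress_err k) \<le> ?T * (\<epsilon> / 16) + (?T * (\<epsilon> / 12) + (144 * a3 + 36 * a4) * ?P)"
  proof -
    have "\<eta> ^ 3 * (\<omega>\<^sup>2 * \<omega>\<^sub>s) \<le> ?n"
    proof -
      have "\<omega>\<^sup>2 * \<omega>\<^sub>s \<le> \<omega> * (\<omega> + 1) * \<omega>\<^sub>s"
        using \<omega>_nonneg by (intro mult_right_mono) (auto simp: power2_eq_square distrib_left)
      hence "\<eta> ^ 3 * (\<omega>\<^sup>2 * \<omega>\<^sub>s) \<le> \<eta> ^ 3 * (\<omega> * (\<omega> + 1) * \<omega>\<^sub>s)"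
        using \<eta> by (intro mult_left_mono) auto
      thus ?thesis using e3 by linarith
    qed
    hence w1: "\<omega>\<^sup>2 / ?n * (\<eta> * \<omega>\<^sub>s) \<le> 1 / \<eta>\<^sup>2"
      using \<eta> by (simp add: field_simps power2_eq_square power3_eq_cube)
    have w2: "\<omega>\<^sup>2 / ?n \<le> \<omega> * (\<omega> + 1) / ?n"
      using \<omega>_nonneg by (intro divide_right_mono) (auto simp: power2_eq_square distrib_left)
    have "\<omega>\<^sup>2 / ?n * (6 * L\<^sup>2 * ((24 + 6 * \<eta> * \<omega>\<^sub>s) * ?P)) =
        (144 * (\<omega>\<^sup>2 / ?n) * L\<^sup>2 + 36 * (\<omega>\<^sup>2 / ?n * (\<eta> * \<omega>\<^sub>s)) * L\<^sup>2) * ?P"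
      by (simp add: algebra_simps)
    also have "\<dots> \<le> (144 * (\<omega> * (\<omega> + 1) / ?n) * L\<^sup>2 + 36 * (1 / \<eta>\<^sup>2) * L\<^sup>2) * ?P"
      using w1 w2 P by (intro mult_right_mono add_mono mult_left_mono) auto
    also have "\<dots> = (144 * a3 + 36 * a4) * ?P" by (simp add: a3_def a4_def)
    finally have q: "\<omega>\<^sup>2 / ?n * (6 * L\<^sup>2 * ((24 + 6 * \<eta> * \<omega>\<^sub>s) * ?P)) \<le> (144 * a3 + 36 * a4) * ?P" .
    have "\<omega>\<^sup>2 / ?n * (?T * (3 * \<eta>\<^sup>2 * (\<sigma>\<^sup>2 / real b)) + 6 * L\<^sup>2 * ((24 + 6 * \<eta> * \<omega>\<^sub>s) * ?P)) =
       ?T * (\<omega>\<^sup>2 / ?n * (3 * \<eta>\<^sup>2 * (\<sigma>\<^sup>2 / real b))) + \<omega>\<^sup>2 / ?n * (6 * L\<^sup>2 * ((24 + 6 * \<eta> * \<omega>\<^sub>s) * ?P))"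
      unfolding distrib_left by (simp only: mult.left_commute)
    also have "\<dots> \<le> ?T * (\<epsilon> / 12) + (144 * a3 + 36 * a4) * ?P"
      by (intro add_mono mult_left_mono e1 q) simp
    finally show ?thesis
      using sum_compress_err[of N] mult_left_mono[OF i1, of ?T] unfolding assms(3,4) by linarith
  qed
  have momentum_err: "(\<Sum>k\<le>N. momentum_err k) \<le> ?T * (\<epsilon> / 16) + (36 * a4 + 16 * a1 + 16 * a2) * ?P + ?T * (\<epsilon> / 6)"
  proof -
    have "4 / \<eta>\<^sup>2 * L\<^sup>2 + 16 * L\<^sub>A\<^sup>2 * (1 / \<eta>\<^sup>2 + \<omega>\<^sub>s * (\<omega>\<^sub>s + 1)) +
      16 * L\<^sub>B\<^sup>2 * (1 / \<eta>\<^sup>2 + \<omega>\<^sub>s / ?n * (\<omega>\<^sub>s + 1)) =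
      4 * a4 + (16 * (1 / \<eta>\<^sup>2 * L\<^sub>A\<^sup>2) + 16 * a1) + (16 * (1 / \<eta>\<^sup>2 * L\<^sub>B\<^sup>2) + 16 * a2)"
      unfolding a1_def a2_def a4_def by (simp add: algebra_simps)
    also have "\<dots> \<le> 4 * a4 + (16 * a4 + 16 * a1) + (16 * a4 + 16 * a2)"
      unfolding a4_def using LAB by (intro add_mono mult_left_mono order.refl) auto
    finally have "(4 / \<eta>\<^sup>2 * L\<^sup>2 + 16 * L\<^sub>A\<^sup>2 * (1 / \<eta>\<^sup>2 + \<omega>\<^sub>s * (\<omega>\<^sub>s + 1)) +
      16 * L\<^sub>B\<^sup>2 * (1 / \<eta>\<^sup>2 + \<omega>\<^sub>s / ?n * (\<omega>\<^sub>s + 1))) * ?P \<le> (36 * a4 + 16 * a1 + 16 * a2) * ?P"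
      using P by (intro mult_right_mono) auto
    thus ?thesis
      using sum_momentum_err[of N] i2 mult_left_mono[OF e2, of ?T] unfolding assms(3,4) by linarith
  qed
  have neg: "(L / \<gamma> - 1 / \<gamma>\<^sup>2 + 360 * A) * ?P \<le> 0"
  proof -
    have "L\<^sup>2 \<le> a4"
      using \<eta> by (simp add: a4_def field_simps power_le_one mult_left_le)
    hence "L\<^sup>2 \<le> A" using A' a by linarith
    hence "\<gamma>\<^sup>2 * L\<^sup>2 \<le> \<gamma>\<^sup>2 * A" by (rule mult_left_mono) simp
    hence "(\<gamma> * L)\<^sup>2 \<le> (1 / 100)\<^sup>2"
      unfolding power_mult_distrib using step by (simp add: power_divide)
    hence "\<gamma> * L \<le> 1 / 100" by (rule power2_le_imp_le) simp
    hence "(\<gamma> * L) * (1 / \<gamma>\<^sup>2) \<le> 1 / 100 * (1 / \<gamma>\<^sup>2)" by (rule mult_right_mono) simp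
    moreover have "(\<gamma> * L) * (1 / \<gamma>\<^sup>2) = L / \<gamma>" using assms(1) by (simp add: power2_eq_square)
    moreover have "\<gamma>\<^sup>2 * A * (1 / \<gamma>\<^sup>2) \<le> 1 / 10000 * (1 / \<gamma>\<^sup>2)" using step by (rule mult_right_mono) simp
    moreover have "\<gamma>\<^sup>2 * A * (1 / \<gamma>\<^sup>2) = A" using assms(1) by simp
    moreover have "0 \<le> 1 / \<gamma>\<^sup>2" by simp
    ultimately have "L / \<gamma> - 1 / \<gamma>\<^sup>2 + 360 * A \<le> 0" by linarith
    thus ?thesis using P by (rule mult_nonpos_nonneg)
  qed
  have "2 * ((144 * a3 + 36 * a4) * ?P) + 2 * ((36 * a4 + 16 * a1 + 16 * a2) * ?P) \<le> 360 * A * ?P"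
  proof -
    have "2 * (144 * a3 + 36 * a4) + 2 * (36 * a4 + 16 * a1 + 16 * a2) \<le> 360 * A"
      unfolding distrib_left A' using a by linarith
    from mult_right_mono[OF this P] show ?thesis by (simp only: distrib_right mult.assoc)
  qed
  moreover have "(L / \<gamma> - 1 / \<gamma>\<^sup>2 + 360 * A) * ?P = (L / \<gamma> - 1 / \<gamma>\<^sup>2) * ?P + 360 * A * ?P"
    by (rule distrib_right)
  moreover have "?T * (\<epsilon> / 4) + 2 * (?T * (\<epsilon> / 16) + ?T * (\<epsilon> / 12)) + 2 * (?T * (\<epsilon> / 16) + ?T * (\<epsilon> / 6)) = ?T * \<epsilon>"
    by (simp add: field_simps)
  ultimately show ?thesis
    using sum_gradient_le[OF assms(1,2), of N] compress_err momentum_err D neg by linarith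
qed

section \<open>Running time\<close>

text \<open>
  The elapsed time is dominated pointwise by a function of the coins. Since \<open>p * d = K\<close>, the full messages
  cost in expectation as much as one compressed message per iteration.
\<close>

lemma expected_time:
  fixes tg :: "nat \<Rightarrow> 'n \<Rightarrow> nat \<Rightarrow> 'w \<Rightarrow> real" and ts tw :: "nat \<Rightarrow> 'n \<Rightarrow> 'w \<Rightarrow> real" and h \<tau> \<kappa> :: real
  assumes pos: "0 < h" "0 < \<tau>" "0 < \<kappa>"
    and tg: "\<And>k i r \<xi>. \<xi> \<in> space M \<Longrightarrow> tg k i r \<xi> \<le> h"
    and ts: "\<And>k i \<xi>. \<xi> \<in> space M \<Longrightarrow> ts k i \<xi> \<le> \<kappa>"
    and tw: "\<And>k i \<xi>. \<xi> \<in> space M \<Longrightarrow> tw k i \<xi> \<le> \<tau>"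
  shows "expectation (m4_time K\<^sub>s K batch R tg ts tw N) \<le>
    (if N = 0 then 0 else real (batch 0) * h + real N * (2 * real K\<^sub>s * \<kappa> + real b * h + 2 * real K * \<tau>))"
proof (cases "N = 0")
  case True
  thus ?thesis by (simp add: m4_time_def[abs_def])
next
  case False
  define W where "W k \<xi> = (if server_coin R k \<xi> then real CARD('d) else real K\<^sub>s) * \<kappa> + real b * h +
    (if worker_coin R k \<xi> then real CARD('d) else real K) * \<tau>" for k \<xi>
  have Max_le: "(MAX i. u i) \<le> c" if "\<And>i. u i \<le> c" for u :: "'n \<Rightarrow> real" and c
    using that by (intro Max.boundedI) auto
  have grad: "gradient_time batch tg k \<xi> \<le> real (batch k) * h" if "\<xi> \<in> space M" for k \<xi>
  proof -
    have "(\<Sum>r = 1..batch k. tg k i r \<xi>) \<le> real (batch k) * h" for i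
      using sum_bounded_above[of "{1..batch k}" "\<lambda>r. tg k i r \<xi>" h] tg that by simp
    thus ?thesis unfolding gradient_time_def by (rule Max_le)
  qed
  have iter: "iteration_time K\<^sub>s K batch R tg ts tw k \<xi> \<le> W k \<xi>" if "\<xi> \<in> space M" for k \<xi>
    unfolding iteration_time_def W_def using grad[OF that, of "Suc k"] ts[OF that] tw[OF that]
    by (intro add_mono Max_le) (auto simp: batch(3) intro!: mult_left_mono)
  have W0: "0 \<le> W k \<xi>" for k \<xi>
    using pos by (auto simp: W_def intro!: add_nonneg_nonneg mult_nonneg_nonneg)
  have coin: "integrable M (\<lambda>\<xi>. if c \<xi> then u else v :: real)"
    "expectation (\<lambda>\<xi>. if c \<xi> then u else v) = q * u + (1 - q) * v"
    if [measurable]: "c \<in> M \<rightarrow>\<^sub>M count_space UNIV" and q: "prob {\<xi> \<in> space M. c \<xi>} = q" for c u v q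
  proof -
    have eq: "(if c \<xi> then u else v) = v + (u - v) * indicator {\<xi> \<in> space M. c \<xi>} \<xi>" if "\<xi> \<in> space M" for \<xi>
      using that by (auto simp: indicator_def)
    have i: "integrable M (\<lambda>\<xi>. v + (u - v) * indicator {\<xi> \<in> space M. c \<xi>} \<xi>)"
      by (auto intro!: integrable_real_indicator simp: emeasure_eq_measure)
    show "integrable M (\<lambda>\<xi>. if c \<xi> then u else v)"
      using i by (subst Bochner_Integration.integrable_cong[OF refl eq]) auto
    have "expectation (\<lambda>\<xi>. if c \<xi> then u else v) = v + (u - v) * prob {\<xi> \<in> space M. c \<xi>}"
      by (subst Bochner_Integration.integral_cong[OF refl eq])
         (auto simp: prob_space emeasure_eq_measure)
    thus "expectation (\<lambda>\<xi>. if c \<xi> then u else v) = q * u + (1 - q) * v" by (simp add: q algebra_simps)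
  qed
  note coins = coin[OF measurable_genD[OF server_coin_gen] prob_server_coin]
    coin[OF measurable_genD[OF worker_coin_gen] prob_worker_coin]
  have W: "integrable M (W k)" "expectation (W k) \<le> 2 * real K\<^sub>s * \<kappa> + real b * h + 2 * real K * \<tau>" for k
  proof -
    show "integrable M (W k)"
      unfolding W_def using coins by (auto simp: source_mem)
    have "expectation (W k) = (p\<^sub>s * real CARD('d) + (1 - p\<^sub>s) * real K\<^sub>s) * \<kappa> + real b * h +
        (p * real CARD('d) + (1 - p) * real K) * \<tau>"
      unfolding W_def using coins by (simp add: source_mem prob_space)
    also have "p\<^sub>s * real CARD('d) = real K\<^sub>s" using K by (simp add: \<omega>\<^sub>s)
    also have "p * real CARD('d) = real K" using K by (simp add: \<omega>)
    finally have "expectation (W k) = (real K\<^sub>s + (1 - p\<^sub>s) * real K\<^sub>s) * \<kappa> + real b * h + (real K + (1 - p) * real K) * \<tau>" .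
    also have "\<dots> \<le> (real K\<^sub>s + 1 * real K\<^sub>s) * \<kappa> + real b * h + (real K + 1 * real K) * \<tau>"
      using p_bounds pos by (intro add_mono mult_right_mono add_left_mono) auto
    finally show "expectation (W k) \<le> 2 * real K\<^sub>s * \<kappa> + real b * h + 2 * real K * \<tau>" by simp
  qed
  \<comment> \<open>only the dominating function has to be integrable, because the integral of a function that is not is \<open>0\<close>\<close>
  have "expectation (m4_time K\<^sub>s K batch R tg ts tw N) \<le> expectation (\<lambda>\<xi>. real (batch 0) * h + (\<Sum>k<N. W k \<xi>))"
  proof (rule integral_mono')
    show "integrable M (\<lambda>\<xi>. real (batch 0) * h + (\<Sum>k<N. W k \<xi>))" using W by auto
    fix \<xi> assume \<xi>: "\<xi> \<in> space M"
    show "m4_time K\<^sub>s K batch R tg ts tw N \<xi> \<le> real (batch 0) * h + (\<Sum>k<N. W k \<xi>)"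
      using False grad[OF \<xi>, of 0] iter[OF \<xi>] by (auto simp: m4_time_def intro!: add_mono sum_mono)
    show "0 \<le> real (batch 0) * h + (\<Sum>k<N. W k \<xi>)"
      using pos W0 by (auto intro!: add_nonneg_nonneg sum_nonneg)
  qed
  also have "\<dots> = real (batch 0) * h + (\<Sum>k<N. expectation (W k))"
    using W by (simp add: prob_space Bochner_Integration.integral_sum)
  also have "(\<Sum>k<N. expectation (W k)) \<le> real N * (2 * real K\<^sub>s * \<kappa> + real b * h + 2 * real K * \<tau>)"
    using sum_bounded_above[of "{..<N}" "\<lambda>k. expectation (W k)"] W(2) by simp
  finally show ?thesis using False by simp
qed

end

section \<open>The random output index\<close>

text \<open>
  By Fubini's theorem, integrating over the index first turns the mean squared gradient at the output into the
  average along the run.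
\<close>

lemma stationary_point_output:
  fixes X :: "nat \<Rightarrow> 'w \<Rightarrow> 'a::euclidean_space"
  assumes "prob_space M" and \<phi>: "gradient \<phi> \<in> borel_measurable borel"
    and X: "\<And>k. X k \<in> borel_measurable M"
    and int: "\<And>k. integrable M (\<lambda>\<omega>. (norm (gradient \<phi> (X k \<omega>)))\<^sup>2)"
    and le: "(\<Sum>k\<le>N. \<integral>\<omega>. (norm (gradient \<phi> (X k \<omega>)))\<^sup>2 \<partial>M) \<le> real (Suc N) * \<epsilon>"
  shows "stationary_point (output_space M N) \<phi> \<epsilon> (\<lambda>(\<omega>, k). X k \<omega>)"
proof -
  interpret M: prob_space M by fact
  let ?U = "measure_pmf (pmf_of_set {0..N})"
  interpret MU: pair_prob_space M ?U ..
  have sets_eq: "sets (M \<Otimes>\<^sub>M ?U) = sets (M \<Otimes>\<^sub>M count_space UNIV)"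
    by (rule sets_pair_measure_cong) simp_all
  have Xm: "(\<lambda>(\<omega>, k). X k \<omega>) \<in> borel_measurable (M \<Otimes>\<^sub>M ?U)"
    unfolding measurable_cong_sets[OF sets_eq refl] case_prod_unfold
    by (rule measurable_compose_countable[OF measurable_compose[OF measurable_fst X] measurable_snd])
  define q where "q = (\<lambda>x. (norm (gradient \<phi> ((\<lambda>(\<omega>, k). X k \<omega>) x)))\<^sup>2)"
  have qm: "q \<in> borel_measurable (M \<Otimes>\<^sub>M ?U)"
    unfolding q_def using measurable_compose[OF Xm \<phi>] by simp
  have q: "q (\<omega>, k) = (norm (gradient \<phi> (X k \<omega>)))\<^sup>2" for \<omega> k by (simp add: q_def)
  have U: "(\<integral>k. u k \<partial>?U) = (\<Sum>k\<le>N. u k) / real (Suc N)" for u :: "nat \<Rightarrow> real"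
    by (subst integral_pmf_of_set) (simp_all add: atMost_atLeast0)
  have qint: "integrable (M \<Otimes>\<^sub>M ?U) q"
  proof (rule MU.Fubini_integrable[OF qm])
    show "integrable M (\<lambda>\<omega>. \<integral>k. norm (q (\<omega>, k)) \<partial>?U)"
      unfolding U using int by (simp add: q)
    show "AE \<omega> in M. integrable ?U (\<lambda>k. q (\<omega>, k))"
      by (intro AE_I2 integrable_measure_pmf_finite) simp
  qed
  have "(\<integral>x. q x \<partial>(M \<Otimes>\<^sub>M ?U)) = (\<integral>\<omega>. (\<integral>k. q (\<omega>, k) \<partial>?U) \<partial>M)"
    by (rule MU.integral_fst'[OF qint, symmetric])
  also have "\<dots> = (\<Sum>k\<le>N. \<integral>\<omega>. (norm (gradient \<phi> (X k \<omega>)))\<^sup>2 \<partial>M) / real (Suc N)"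
    unfolding U using int by (simp add: q Bochner_Integration.integral_sum)
  also have "\<dots> \<le> \<epsilon>" using le by (simp add: field_simps)
  finally show ?thesis
    using Xm qint unfolding stationary_point_def output_space_def q_def by simp
qed

section \<open>The parameters\<close>

lemma nat_floor_bounds:
  fixes a :: real
  assumes "1 \<le> a"
  shows "1 \<le> nat \<lfloor>a\<rfloor>" "real (nat \<lfloor>a\<rfloor>) \<le> a" "a \<le> 2 * real (nat \<lfloor>a\<rfloor>)"
proof -
  have "1 \<le> \<lfloor>a\<rfloor>" using assms by simp
  thus "1 \<le> nat \<lfloor>a\<rfloor>" "real (nat \<lfloor>a\<rfloor>) \<le> a" "a \<le> 2 * real (nat \<lfloor>a\<rfloor>)" by linarith+
qed

text \<open>
  Either the budget \<open>t\<close> pays for all coordinates, and then there is no compression, or rounding down loses at most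
  a factor \<open>2\<close>, so that \<open>\<omega> + 1\<close> is at most \<open>2 * d * \<tau> / t\<close>.
\<close>

lemma compressor_budget:
  fixes t \<tau> \<omega> :: real and d K :: nat
  assumes "0 < \<tau>" "\<tau> \<le> t" "1 \<le> d" and K: "K = min d (nat \<lfloor>t / \<tau>\<rfloor>)" and \<omega>: "\<omega> = real d / real K - 1"
  shows "1 \<le> K" "K \<le> d" "real K * \<tau> \<le> t" "0 \<le> \<omega>" "\<omega> * t \<le> 2 * real d * \<tau>"
    "\<omega> * (\<omega> + 1) * t\<^sup>2 \<le> (2 * real d * \<tau>)\<^sup>2"
proof -
  have t: "0 < t" using assms by linarith
  note fl = nat_floor_bounds[of "t / \<tau>"]
  have ge1: "1 \<le> t / \<tau>" using assms by simp
  show K1: "1 \<le> K" "K \<le> d" using fl(1)[OF ge1] assms by auto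
  show "real K * \<tau> \<le> t"
  proof -
    have "real K \<le> t / \<tau>" using fl(2)[OF ge1] K by linarith
    thus ?thesis using assms by (simp add: field_simps)
  qed
  show \<omega>0: "0 \<le> \<omega>" using K1 by (simp add: \<omega> field_simps)
  have alt: "\<omega> = 0 \<or> (\<omega> + 1) * t \<le> 2 * real d * \<tau>"
  proof (cases "K = d")
    case True
    thus ?thesis using K1 by (simp add: \<omega>)
  next
    case False
    hence "t / \<tau> \<le> 2 * real K" using K fl(3)[OF ge1] by (simp add: min_def split: if_splits)
    hence "t \<le> 2 * real K * \<tau>" using assms by (simp add: field_simps)
    hence "real d * t \<le> real d * (2 * real K * \<tau>)" by (rule mult_left_mono) simp
    thus ?thesis using K1 by (simp add: \<omega> field_simps)
  qed
  show wt: "\<omega> * t \<le> 2 * real d * \<tau>"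
    using alt t assms(1) by (auto simp: distrib_right)
  show "\<omega> * (\<omega> + 1) * t\<^sup>2 \<le> (2 * real d * \<tau>)\<^sup>2"
  proof (cases "\<omega> = 0")
    case False
    hence "(\<omega> + 1) * t \<le> 2 * real d * \<tau>" using alt by blast
    from mult_mono[OF wt this] have "(\<omega> * t) * ((\<omega> + 1) * t) \<le> (2 * real d * \<tau>) * (2 * real d * \<tau>)"
      using t \<omega>0 assms(1) by simp
    thus ?thesis by (simp add: power2_eq_square mult_ac)
  qed simp
qed

text \<open>
  As a minimum, \<open>\<eta>\<close> is below each of its terms and equal to one of them. The quantity \<open>s\<close> is the number of
  samples per worker that reduce the variance of their mean to \<open>\<epsilon>\<close>.
\<close>

lemma momentum_bounds:
  fixes n b \<epsilon> \<sigma> \<omega> \<omega>\<^sub>s :: real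
  assumes pos: "0 < n" "0 < b" "0 < \<epsilon>" "0 < \<sigma>" "0 \<le> \<omega>" "0 \<le> \<omega>\<^sub>s"
    and \<eta>: "\<eta> = m4_eta n b \<epsilon> \<sigma> \<omega> \<omega>\<^sub>s" and s: "s = \<sigma>\<^sup>2 / (n * \<epsilon>)"
  shows "0 < \<eta>" "\<eta> \<le> 1" "6 * \<eta> * s \<le> b" "36 * \<eta>\<^sup>2 * (\<omega> * (\<omega> + 1)) * s \<le> b"
    "\<eta> ^ 3 * (\<omega> * (\<omega> + 1) * \<omega>\<^sub>s) \<le> n"
    "1 / \<eta> \<le> 1 + 6 * (s / b) + 6 * sqrt (\<omega> * (\<omega> + 1) * s / b) + root 3 (\<omega> * (\<omega> + 1) * \<omega>\<^sub>s / n)"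
proof -
  let ?w = "\<omega> * (\<omega> + 1)"
  let ?S = "quotient_terms (\<lambda>q. 1 / 6 * sqrt q) (b * n * \<epsilon>) (\<omega> * (\<omega> + 1) * \<sigma>\<^sup>2) \<union>
          quotient_terms (\<lambda>q. q) (b * n * \<epsilon>) (6 * \<sigma>\<^sup>2) \<union>
          quotient_terms (root 3) n (\<omega> * (\<omega> + 1) * \<omega>\<^sub>s) \<union> {1}"
  have fin: "finite ?S" "?S \<noteq> {}" by (auto simp: quotient_terms_def)
  have \<eta>S: "\<eta> \<in> ?S" and \<eta>le: "\<And>y. y \<in> ?S \<Longrightarrow> \<eta> \<le> y"
    unfolding \<eta> m4_eta_def using Min_in[OF fin] Min_le[OF fin(1)] by blast+
  have w0: "0 \<le> ?w" using pos by simp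
  have s0: "0 < s" using pos by (simp add: s)
  have q1: "b * n * \<epsilon> / (?w * \<sigma>\<^sup>2) = b / (?w * s)" "b * n * \<epsilon> / (6 * \<sigma>\<^sup>2) = b / (6 * s)"
    using pos by (simp_all add: s field_simps)
  consider (w) "\<eta> = 1 / 6 * sqrt (b / (?w * s))" "?w \<noteq> 0" | (s) "\<eta> = b / (6 * s)"
    | (root) "\<eta> = root 3 (n / (?w * \<omega>\<^sub>s))" "?w * \<omega>\<^sub>s \<noteq> 0" | (one) "\<eta> = 1"
    using \<eta>S unfolding q1 Un_iff quotient_terms_def by (auto split: if_splits)
  note cases = this
  show \<eta>pos: "0 < \<eta>"
  proof (cases rule: cases)
    case w
    hence "0 < ?w" using w0 by linarith
    hence "0 < ?w * s" using s0 by (rule mult_pos_pos)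
    thus ?thesis unfolding w(1) using pos by simp
  next
    case root
    hence "0 < ?w * \<omega>\<^sub>s" using mult_nonneg_nonneg[OF w0 pos(6)] by linarith
    thus ?thesis unfolding root(1) using pos by simp
  qed (use pos s0 in simp_all)
  show "\<eta> \<le> 1" by (rule \<eta>le) simp
  have "\<eta> \<le> b * n * \<epsilon> / (6 * \<sigma>\<^sup>2)" using pos by (intro \<eta>le) (simp add: quotient_terms_def)
  thus "6 * \<eta> * s \<le> b" unfolding q1 using s0 by (simp add: field_simps)
  show "36 * \<eta>\<^sup>2 * ?w * s \<le> b"
  proof (cases "?w = 0")
    case False
    have "\<eta> \<le> 1 / 6 * sqrt (b * n * \<epsilon> / (?w * \<sigma>\<^sup>2))"
      using pos False by (intro \<eta>le) (simp add: quotient_terms_def)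
    hence "6 * \<eta> \<le> sqrt (b / (?w * s))" unfolding q1 by simp
    hence "(6 * \<eta>)\<^sup>2 \<le> (sqrt (b / (?w * s)))\<^sup>2" using \<eta>pos by (intro power_mono) auto
    also have "\<dots> = b / (?w * s)" using pos w0 s0 by simp
    finally have "(6 * \<eta>)\<^sup>2 * (?w * s) \<le> b"
      using w0 s0 False by (simp add: pos_le_divide_eq)
    moreover have "(6 * \<eta>)\<^sup>2 * (?w * s) = 36 * \<eta>\<^sup>2 * ?w * s" unfolding power_mult_distrib by simp
    ultimately show ?thesis by simp
  qed (use pos in simp)
  show "\<eta> ^ 3 * (?w * \<omega>\<^sub>s) \<le> n"
  proof (cases "?w * \<omega>\<^sub>s = 0")
    case True
    thus ?thesis unfolding True using pos by simp
  next
    case False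
    hence p: "0 < ?w * \<omega>\<^sub>s" using w0 pos mult_nonneg_nonneg[of ?w \<omega>\<^sub>s] by linarith
    have "\<eta> \<le> root 3 (n / (?w * \<omega>\<^sub>s))" using False by (intro \<eta>le) (simp add: quotient_terms_def)
    hence "\<eta> ^ 3 \<le> root 3 (n / (?w * \<omega>\<^sub>s)) ^ 3" using \<eta>pos by (intro power_mono) auto
    also have "\<dots> = n / (?w * \<omega>\<^sub>s)" using pos p by (intro real_root_pow_pos2) auto
    finally show ?thesis using p by (simp only: pos_le_divide_eq)
  qed
  have nn: "0 \<le> 6 * (s / b)" "0 \<le> 6 * sqrt (?w * s / b)" "0 \<le> root 3 (?w * \<omega>\<^sub>s / n)"
    using pos s0 w0 by auto
  show "1 / \<eta> \<le> 1 + 6 * (s / b) + 6 * sqrt (?w * s / b) + root 3 (?w * \<omega>\<^sub>s / n)"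
  proof (cases rule: cases)
    case w
    hence "1 / \<eta> = 6 * sqrt (?w * s / b)" by (simp add: real_sqrt_divide)
    thus ?thesis using nn by linarith
  next
    case s
    hence "1 / \<eta> = 6 * (s / b)" by simp
    thus ?thesis using nn by linarith
  next
    case root
    hence "1 / \<eta> = root 3 (?w * \<omega>\<^sub>s / n)" by (simp add: real_root_divide)
    thus ?thesis using nn by linarith
  next
    case one
    thus ?thesis using nn by simp
  qed
qed

text \<open>
  Each of the four candidates for \<open>1 / \<eta>\<close>, multiplied by \<open>t\<close>, is compared with a term of the complexity. The
  term with the square root is the one for which \<open>t\<close> contains a cube root: its square is at most
  \<open>8 * (d\<^sup>2 * \<tau>\<^sup>2 * h * s) / t\<close>, hence at most \<open>8 * t\<^sup>2\<close>.
\<close>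

lemma momentum_time:
  fixes t h \<tau> \<kappa> d n b s \<omega> \<omega>\<^sub>s \<eta> X :: real
  assumes pos: "0 < t" "0 < h" "0 < \<tau>" "0 < \<kappa>" "0 < d" "0 < n" "0 < b" "0 \<le> s" "0 \<le> \<omega>" "0 \<le> \<omega>\<^sub>s"
    and t: "t \<le> X" "t \<le> 2 * b * h" "d\<^sup>2 * \<tau>\<^sup>2 * h * s \<le> t ^ 3"
    and X: "s * h \<le> X" "root 3 (d ^ 3 * \<tau>\<^sup>2 * \<kappa> / n) \<le> X"
    and \<omega>: "\<omega> * (\<omega> + 1) * t\<^sup>2 \<le> (2 * d * \<tau>)\<^sup>2" "\<omega>\<^sub>s * t \<le> 2 * d * \<kappa>"
    and \<eta>: "1 / \<eta> \<le> 1 + 6 * (s / b) + 6 * sqrt (\<omega> * (\<omega> + 1) * s / b) + root 3 (\<omega> * (\<omega> + 1) * \<omega>\<^sub>s / n)"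
  shows "t / \<eta> \<le> 33 * X"
proof -
  let ?w = "\<omega> * (\<omega> + 1)"
  have w0: "0 \<le> ?w" using pos by simp
  have tb: "t / b \<le> 2 * h" using t(2) pos by (simp add: field_simps)
  have 1: "t * (s / b) \<le> 2 * X"
  proof -
    have "t * (s / b) = (t / b) * s" by simp
    also have "\<dots> \<le> 2 * h * s" using tb pos by (intro mult_right_mono) auto
    also have "\<dots> = 2 * (s * h)" by simp
    finally show ?thesis using X(1) by linarith
  qed
  have 2: "t * sqrt (?w * s / b) \<le> 3 * X"
  proof -
    have "(t * sqrt (?w * s / b))\<^sup>2 = (?w * t\<^sup>2) * (s / b)"
      using w0 pos by (simp add: power_mult_distrib)
    also have "\<dots> \<le> (2 * d * \<tau>)\<^sup>2 * (s / b)" using \<omega>(1) pos by (intro mult_right_mono) auto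
    also have "\<dots> = 4 * d\<^sup>2 * \<tau>\<^sup>2 * s * (t / b) / t" using pos by (simp add: power_mult_distrib)
    also have "\<dots> \<le> 4 * d\<^sup>2 * \<tau>\<^sup>2 * s * (2 * h) / t"
      using tb pos by (intro divide_right_mono mult_left_mono) auto
    also have "\<dots> = 8 * (d\<^sup>2 * \<tau>\<^sup>2 * h * s) / t" by simp
    also have "\<dots> \<le> 8 * t ^ 3 / t" using t(3) pos by (intro divide_right_mono) auto
    also have "\<dots> = 8 * t\<^sup>2" using pos by (simp add: power2_eq_square power3_eq_cube)
    also have "\<dots> \<le> (3 * t)\<^sup>2" by (simp add: power_mult_distrib)
    finally have "t * sqrt (?w * s / b) \<le> 3 * t" using pos by (rule_tac power2_le_imp_le) auto
    thus ?thesis using t(1) by linarith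
  qed
  have 3: "t * root 3 (?w * \<omega>\<^sub>s / n) \<le> 2 * X"
  proof -
    have "t * root 3 (?w * \<omega>\<^sub>s / n) = root 3 (t ^ 3 * (?w * \<omega>\<^sub>s / n))"
      using pos by (subst real_root_mult) (simp add: real_root_power_cancel)
    also have "\<dots> \<le> root 3 (2 ^ 3 * (d ^ 3 * \<tau>\<^sup>2 * \<kappa> / n))"
    proof (subst real_root_le_iff)
      have "t ^ 3 * (?w * \<omega>\<^sub>s / n) = (?w * t\<^sup>2) * (\<omega>\<^sub>s * t) / n"
        by (simp add: power2_eq_square power3_eq_cube)
      also have "\<dots> \<le> (2 * d * \<tau>)\<^sup>2 * (2 * d * \<kappa>) / n"
        using \<omega> pos w0 by (intro divide_right_mono mult_mono[OF \<omega>]) auto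
      also have "\<dots> = 2 ^ 3 * (d ^ 3 * \<tau>\<^sup>2 * \<kappa> / n)"
        by (simp add: power_mult_distrib power2_eq_square power3_eq_cube)
      finally show "t ^ 3 * (?w * \<omega>\<^sub>s / n) \<le> 2 ^ 3 * (d ^ 3 * \<tau>\<^sup>2 * \<kappa> / n)" .
    qed simp
    also have "\<dots> = 2 * root 3 (d ^ 3 * \<tau>\<^sup>2 * \<kappa> / n)"
      by (subst real_root_mult) (simp add: real_root_power_cancel)
    finally show ?thesis using X(2) by linarith
  qed
  have "t / \<eta> = t * (1 / \<eta>)" by simp
  also have "\<dots> \<le> t * (1 + 6 * (s / b) + 6 * sqrt (?w * s / b) + root 3 (?w * \<omega>\<^sub>s / n))"
    using \<eta> pos by (intro mult_left_mono) auto
  also have "\<dots> = t + 6 * (t * (s / b)) + 6 * (t * sqrt (?w * s / b)) + t * root 3 (?w * \<omega>\<^sub>s / n)"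
    by (simp add: distrib_left)
  finally show ?thesis using 1 2 3 t(1) by linarith
qed

text \<open>
  The root of the sum is split into the sum of the roots, and each compressor parameter is then replaced by its
  budget.
\<close>

lemma step_size_time:
  fixes t \<tau> \<kappa> d n \<omega> \<omega>\<^sub>s \<eta> X L L\<^sub>A L\<^sub>B :: real
  assumes pos: "0 < t" "0 < \<tau>" "0 < \<kappa>" "0 < d" "0 < n" "0 \<le> \<omega>" "0 \<le> \<omega>\<^sub>s" "0 < \<eta>"
    and L: "0 \<le> L\<^sub>A" "0 \<le> L\<^sub>B" "L\<^sub>B \<le> L"
    and X: "d * \<kappa> / sqrt n \<le> X" "d * \<tau> / sqrt n \<le> X" and \<eta>: "t / \<eta> \<le> 33 * X"
    and \<omega>: "\<omega> * (\<omega> + 1) * t\<^sup>2 \<le> (2 * d * \<tau>)\<^sup>2" "\<omega>\<^sub>s * (\<omega>\<^sub>s + 1) * t\<^sup>2 \<le> (2 * d * \<kappa>)\<^sup>2"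
  shows "sqrt (\<omega>\<^sub>s * (\<omega>\<^sub>s + 1) * L\<^sub>A\<^sup>2 + \<omega>\<^sub>s / n * (\<omega>\<^sub>s + 1) * L\<^sub>B\<^sup>2
            + (\<omega> * (\<omega> + 1) / n + 1 / \<eta>\<^sup>2) * L\<^sup>2) * t \<le> 2 * (d * \<kappa> * L\<^sub>A) + 37 * (X * L)"
proof -
  have st: "sqrt w * t \<le> 2 * d * c" if "w * t\<^sup>2 \<le> (2 * d * c)\<^sup>2" "0 \<le> w" "0 < c" for w c
  proof (rule power2_le_imp_le)
    show "(sqrt w * t)\<^sup>2 \<le> (2 * d * c)\<^sup>2" using that by (simp add: power_mult_distrib)
  qed (use pos that in simp)
  have w0: "0 \<le> \<omega> * (\<omega> + 1)" "0 \<le> \<omega>\<^sub>s * (\<omega>\<^sub>s + 1)" using pos by auto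
  note s1 = st[OF \<omega>(1) w0(1) pos(2)] and s2 = st[OF \<omega>(2) w0(2) pos(3)]
  have X0: "0 \<le> X" by (rule order_trans[OF _ X(1)]) (use pos in simp)
  have "sqrt (\<omega>\<^sub>s * (\<omega>\<^sub>s + 1) * L\<^sub>A\<^sup>2 + \<omega>\<^sub>s / n * (\<omega>\<^sub>s + 1) * L\<^sub>B\<^sup>2
            + (\<omega> * (\<omega> + 1) / n + 1 / \<eta>\<^sup>2) * L\<^sup>2)
      = sqrt (\<omega>\<^sub>s * (\<omega>\<^sub>s + 1) * L\<^sub>A\<^sup>2 + (\<omega>\<^sub>s * (\<omega>\<^sub>s + 1) / n * L\<^sub>B\<^sup>2
            + (\<omega> * (\<omega> + 1) / n * L\<^sup>2 + 1 / \<eta>\<^sup>2 * L\<^sup>2)))"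
    by (simp add: distrib_right add.assoc)
  also have "\<dots> \<le> sqrt (\<omega>\<^sub>s * (\<omega>\<^sub>s + 1) * L\<^sub>A\<^sup>2) + (sqrt (\<omega>\<^sub>s * (\<omega>\<^sub>s + 1) / n * L\<^sub>B\<^sup>2)
            + (sqrt (\<omega> * (\<omega> + 1) / n * L\<^sup>2) + sqrt (1 / \<eta>\<^sup>2 * L\<^sup>2)))"
    using w0 pos
    by (intro order_trans[OF sqrt_add_le_add_sqrt] add_left_mono add_nonneg_nonneg mult_nonneg_nonneg divide_nonneg_nonneg)
       auto
  also have "\<dots> = sqrt (\<omega>\<^sub>s * (\<omega>\<^sub>s + 1)) * L\<^sub>A + (sqrt (\<omega>\<^sub>s * (\<omega>\<^sub>s + 1)) / sqrt n * L\<^sub>B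
            + (sqrt (\<omega> * (\<omega> + 1)) / sqrt n * L + 1 / \<eta> * L))"
    using L pos by (simp add: real_sqrt_mult real_sqrt_divide)
  finally have "sqrt (\<omega>\<^sub>s * (\<omega>\<^sub>s + 1) * L\<^sub>A\<^sup>2 + \<omega>\<^sub>s / n * (\<omega>\<^sub>s + 1) * L\<^sub>B\<^sup>2
            + (\<omega> * (\<omega> + 1) / n + 1 / \<eta>\<^sup>2) * L\<^sup>2) * t \<le> \<dots> * t"
    using pos by (intro mult_right_mono) auto
  also have "\<dots> = (sqrt (\<omega>\<^sub>s * (\<omega>\<^sub>s + 1)) * t) * L\<^sub>A + ((sqrt (\<omega>\<^sub>s * (\<omega>\<^sub>s + 1)) * t) / sqrt n * L\<^sub>B
            + ((sqrt (\<omega> * (\<omega> + 1)) * t) / sqrt n * L + t / \<eta> * L))"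
    by (simp add: algebra_simps)
  also have "\<dots> \<le> (2 * d * \<kappa>) * L\<^sub>A + ((2 * d * \<kappa>) / sqrt n * L
            + ((2 * d * \<tau>) / sqrt n * L + 33 * X * L))"
    by (intro add_mono mult_right_mono[OF s2 L(1)] mult_mono[OF divide_right_mono[OF s2] L(3)]
        mult_right_mono[OF divide_right_mono[OF s1]] mult_right_mono[OF \<eta>]) (use L pos in auto)
  also have "\<dots> = 2 * (d * \<kappa> * L\<^sub>A) + (2 * (d * \<kappa> / sqrt n * L) + (2 * (d * \<tau> / sqrt n * L) + 33 * (X * L)))"
    by simp
  also have "\<dots> \<le> 2 * (d * \<kappa> * L\<^sub>A) + (2 * (X * L) + (2 * (X * L) + 33 * (X * L)))"
    using X L by (intro add_mono mult_left_mono mult_right_mono order.refl) auto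
  finally show ?thesis by linarith
qed

section \<open>Time complexity of M4\<close>

theorem theorem3p5:
  fixes M :: "'w measure"
    and R :: "('w, 'n::finite, 'd::finite, 'z) m4_random"
    and D :: "'n \<Rightarrow> 'z measure"
    and f :: "'n \<Rightarrow> real ^ 'd \<Rightarrow> real" and F :: "real ^ 'd \<Rightarrow> real"
    and G :: "'n \<Rightarrow> real ^ 'd \<Rightarrow> 'z \<Rightarrow> real ^ 'd"
    and x0 :: "real ^ 'd"
    and L :: real and Li :: "'n \<Rightarrow> real" and L\<^sub>A L\<^sub>B L\<^sub>m\<^sub>a\<^sub>x fstar \<Delta> \<epsilon> \<sigma> h \<tau> \<kappa> :: real
    and d n t \<omega> \<omega>\<^sub>s \<eta> p\<^sub>s p \<gamma> c\<^sub>\<gamma> C\<^sub>b :: real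
    and K K\<^sub>s b b\<^sub>i\<^sub>n\<^sub>i\<^sub>t :: nat and batch :: "nat \<Rightarrow> nat"
    and tg :: "nat \<Rightarrow> 'n \<Rightarrow> nat \<Rightarrow> 'w \<Rightarrow> real"
    and ts tw :: "nat \<Rightarrow> 'n \<Rightarrow> 'w \<Rightarrow> real"
  assumes dims: "d = real CARD('d)" "n = real CARD('n)"
    and pos: "0 < \<epsilon>" "0 < \<sigma>" "0 < h" "0 < \<tau>" "0 < \<kappa>" "0 \<le> L\<^sub>A" "0 \<le> L\<^sub>B"
    and F_def: "F = (\<lambda>x. worker_mean (\<lambda>i. f i x))"
    and F_smooth: "smooth L F"
    and f_smooth: "\<And>i. smooth (Li i) (f i)"
    and F_bounded: "\<And>x. fstar \<le> F x"
    and \<Delta>_def: "\<Delta> = F x0 - fstar"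
    and similarity: "functional_similarity f L\<^sub>A L\<^sub>B"
    and L\<^sub>m\<^sub>a\<^sub>x_def: "L\<^sub>m\<^sub>a\<^sub>x = Max {MAX i. Li i, L\<^sub>A, L\<^sub>B}"
    and stoch_grad: "\<And>i. stochastic_gradient (D i) \<sigma> (f i) (G i)"
    and t_def: "t = Max {h, \<tau>, \<kappa>, root 3 (d\<^sup>2 * \<tau>\<^sup>2 * h * \<sigma>\<^sup>2 / (n * \<epsilon>))}"
    and K_def: "K = min CARD('d) (nat \<lfloor>t / \<tau>\<rfloor>)" "\<omega> = d / real K - 1"
    and K\<^sub>s_def: "K\<^sub>s = min CARD('d) (nat \<lfloor>t / \<kappa>\<rfloor>)" "\<omega>\<^sub>s = d / real K\<^sub>s - 1"
    and b_def: "b = nat \<lfloor>t / h\<rfloor>"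
    and \<eta>_def: "\<eta> = m4_eta n (real b) \<epsilon> \<sigma> \<omega> \<omega>\<^sub>s"
    and p_def: "p\<^sub>s = 1 / (\<omega>\<^sub>s + 1)" "p = 1 / (\<omega> + 1)"
    and b_init: "theta 100 C\<^sub>b (real b\<^sub>i\<^sub>n\<^sub>i\<^sub>t) (sqrt (real b / \<eta> * (1 + \<sigma>\<^sup>2 / (n * \<epsilon>))))"
    and step_size: "0 < \<gamma>"
      "theta c\<^sub>\<gamma> (1 / 100) \<gamma>
        (1 / sqrt (\<omega>\<^sub>s * (\<omega>\<^sub>s + 1) * L\<^sub>A\<^sup>2 + \<omega>\<^sub>s / n * (\<omega>\<^sub>s + 1) * L\<^sub>B\<^sup>2
                   + (\<omega> * (\<omega> + 1) / n + 1 / \<eta>\<^sup>2) * L\<^sub>m\<^sub>a\<^sub>x\<^sup>2))"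
    and batch_def: "batch = (\<lambda>k. if k = 0 then b\<^sub>i\<^sub>n\<^sub>i\<^sub>t else b)"
    and randomness: "m4_randomness M D p\<^sub>s p K\<^sub>s K batch R"
    and times_measurable: "\<And>k i r. tg k i r \<in> borel_measurable M"
      "\<And>k i. ts k i \<in> borel_measurable M" "\<And>k i. tw k i \<in> borel_measurable M"
    and times_bounded: "\<And>k i r \<omega>. \<omega> \<in> space M \<Longrightarrow> 0 \<le> tg k i r \<omega> \<and> tg k i r \<omega> \<le> h"
      "\<And>k i \<omega>. \<omega> \<in> space M \<Longrightarrow> 0 \<le> ts k i \<omega> \<and> ts k i \<omega> \<le> \<kappa>"
      "\<And>k i \<omega>. \<omega> \<in> space M \<Longrightarrow> 0 \<le> tw k i \<omega> \<and> tw k i \<omega> \<le> \<tau>"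
  shows "\<exists>N. (\<epsilon> \<le> L\<^sub>m\<^sub>a\<^sub>x * \<Delta> \<longrightarrow> 0 < N) \<and>
             stationary_point (output_space M N) F \<epsilon>
               (\<lambda>(\<omega>, k). m4_iterate \<gamma> \<eta> \<eta> K\<^sub>s K batch G R x0 k \<omega>) \<and>
             (\<integral>\<omega>. m4_time K\<^sub>s K batch R tg ts tw N \<omega> \<partial>M) \<le>
               10000 * (1 / c\<^sub>\<gamma> + C\<^sub>b) *
               (Max {h, \<tau>, \<kappa>, d * \<kappa> / sqrt n, d * \<tau> / sqrt n,
                     root 3 (d ^ 3 * \<tau>\<^sup>2 * \<kappa> / n),
                     root 3 (d\<^sup>2 * \<tau>\<^sup>2 * h * \<sigma>\<^sup>2 / (n * \<epsilon>)),
                     \<sigma>\<^sup>2 * h / (n * \<epsilon>)} * (L\<^sub>m\<^sub>a\<^sub>x * \<Delta> / \<epsilon>)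
                + d * \<kappa> * L\<^sub>A * \<Delta> / \<epsilon>)"
proof -
  define s where "s = \<sigma>\<^sup>2 / (n * \<epsilon>)"
  define S where "S = sqrt (\<omega>\<^sub>s * (\<omega>\<^sub>s + 1) * L\<^sub>A\<^sup>2 + \<omega>\<^sub>s / n * (\<omega>\<^sub>s + 1) * L\<^sub>B\<^sup>2
                   + (\<omega> * (\<omega> + 1) / n + 1 / \<eta>\<^sup>2) * L\<^sub>m\<^sub>a\<^sub>x\<^sup>2)"
  define X where "X = Max {h, \<tau>, \<kappa>, d * \<kappa> / sqrt n, d * \<tau> / sqrt n,
                     root 3 (d ^ 3 * \<tau>\<^sup>2 * \<kappa> / n),
                     root 3 (d\<^sup>2 * \<tau>\<^sup>2 * h * \<sigma>\<^sup>2 / (n * \<epsilon>)),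
                     \<sigma>\<^sup>2 * h / (n * \<epsilon>)}"
  have dn: "0 < d" "0 < n" by (simp_all add: dims)
  have s0: "0 < s" using pos dn by (simp add: s_def)
  have t_ge: "h \<le> t" "\<tau> \<le> t" "\<kappa> \<le> t" "root 3 (d\<^sup>2 * \<tau>\<^sup>2 * h * s) \<le> t"
    by (auto simp: t_def s_def intro!: Max_ge)
  have t0: "0 < t" using t_ge(1) pos by linarith
  have t3: "d\<^sup>2 * \<tau>\<^sup>2 * h * s \<le> t ^ 3"
  proof -
    have nn: "0 \<le> d\<^sup>2 * \<tau>\<^sup>2 * h * s" using pos s0 by simp
    have "root 3 (d\<^sup>2 * \<tau>\<^sup>2 * h * s) ^ 3 \<le> t ^ 3" using t_ge(4) nn by (intro power_mono) auto
    thus ?thesis using nn by simp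
  qed
  have X_ge: "a \<le> X" if "a \<in> {h, \<tau>, \<kappa>, d * \<kappa> / sqrt n, d * \<tau> / sqrt n,
                     root 3 (d ^ 3 * \<tau>\<^sup>2 * \<kappa> / n),
                     root 3 (d\<^sup>2 * \<tau>\<^sup>2 * h * \<sigma>\<^sup>2 / (n * \<epsilon>)),
                     \<sigma>\<^sup>2 * h / (n * \<epsilon>)}" for a
    unfolding X_def by (rule Max_ge[OF _ that]) simp
  have "s * h = \<sigma>\<^sup>2 * h / (n * \<epsilon>)" by (simp add: s_def)
  also have "\<dots> \<le> X" by (rule X_ge) simp
  finally have "s * h \<le> X" .
  hence X: "h \<le> X" "s * h \<le> X" "d * \<kappa> / sqrt n \<le> X" "d * \<tau> / sqrt n \<le> X"
      "root 3 (d ^ 3 * \<tau>\<^sup>2 * \<kappa> / n) \<le> X"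
    using X_ge by simp_all
  have tX: "t \<le> X"
    unfolding t_def X_def by (rule Max_mono) auto
  have X0: "0 < X" using tX t0 by linarith
  have d1: "1 \<le> CARD('d)" by simp
  note wk = compressor_budget[OF pos(4) t_ge(2) d1 K_def(1) K_def(2)[unfolded dims]]
  note sv = compressor_budget[OF pos(5) t_ge(3) d1 K\<^sub>s_def(1) K\<^sub>s_def(2)[unfolded dims]]
  have fl: "1 \<le> b" "real b * h \<le> t" "t \<le> 2 * real b * h"
  proof -
    have "1 \<le> t / h" using t_ge(1) pos(3) by simp
    note nat_floor_bounds[OF this, folded b_def]
    thus "1 \<le> b" "real b * h \<le> t" "t \<le> 2 * real b * h"
      using pos(3) by (simp_all only: pos_le_divide_eq pos_divide_le_eq)
  qed
  have b0: "0 < real b" using fl(1) by simp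
  note \<eta> = momentum_bounds[OF dn(2) b0 pos(1,2) wk(4) sv(4) \<eta>_def s_def]
  have t\<eta>: "t / \<eta> \<le> 33 * X"
    by (rule momentum_time[OF t0 pos(3-5) dn b0 less_imp_le[OF s0] wk(4) sv(4) tX fl(3) t3 X(2,5) _ _ \<eta>(6)])
       (use wk(6) sv(5) in \<open>simp_all add: dims\<close>)
  have L_ge: "Li i \<le> L\<^sub>m\<^sub>a\<^sub>x" "L\<^sub>A \<le> L\<^sub>m\<^sub>a\<^sub>x" "L\<^sub>B \<le> L\<^sub>m\<^sub>a\<^sub>x" for i
  proof -
    have "Li i \<le> (MAX i. Li i)" by (rule Max_ge) auto
    also have "\<dots> \<le> L\<^sub>m\<^sub>a\<^sub>x" unfolding L\<^sub>m\<^sub>a\<^sub>x_def by (rule Max_ge) auto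
    finally show "Li i \<le> L\<^sub>m\<^sub>a\<^sub>x" .
  qed (auto simp: L\<^sub>m\<^sub>a\<^sub>x_def intro!: Max_ge)
  have L0: "0 \<le> L\<^sub>m\<^sub>a\<^sub>x" using L_ge(2) pos(6) by linarith
  have c\<gamma>: "0 < c\<^sub>\<gamma>" "c\<^sub>\<gamma> / S \<le> \<gamma>" "\<gamma> \<le> 1 / 100 / S"
    using step_size(2) by (simp_all add: theta_def S_def)
  \<comment> \<open>\<open>S = 0\<close> would make the quotient in the bound on the step size \<open>0\<close>, but the step size is positive\<close>
  have S0: "0 < S"
  proof (rule ccontr)
    assume "\<not> 0 < S"
    hence "1 / 100 / S \<le> 0" by (simp add: divide_nonneg_nonpos)
    thus False using c\<gamma>(3) step_size(1) by linarith
  qed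
  have \<gamma>S: "\<gamma> * S \<le> 1 / 100" using c\<gamma>(3) S0 by (simp add: field_simps)
  have S2: "S\<^sup>2 = \<omega>\<^sub>s * (\<omega>\<^sub>s + 1) * L\<^sub>A\<^sup>2 + \<omega>\<^sub>s / n * (\<omega>\<^sub>s + 1) * L\<^sub>B\<^sup>2
                   + (\<omega> * (\<omega> + 1) / n + 1 / \<eta>\<^sup>2) * L\<^sub>m\<^sub>a\<^sub>x\<^sup>2" (is "_ = ?A")
    unfolding S_def using wk(4) sv(4) dn
    by (intro real_sqrt_pow2 add_nonneg_nonneg mult_nonneg_nonneg divide_nonneg_nonneg) simp_all
  have L_pos: "0 < L\<^sub>m\<^sub>a\<^sub>x"
  proof (rule ccontr)
    assume "\<not> 0 < L\<^sub>m\<^sub>a\<^sub>x"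
    hence "L\<^sub>m\<^sub>a\<^sub>x = 0" "L\<^sub>A = 0" "L\<^sub>B = 0" using L0 L_ge(2,3) pos(6,7) by linarith+
    hence "S = 0" by (simp add: S_def)
    thus False using S0 by simp
  qed
  have LS: "L\<^sub>m\<^sub>a\<^sub>x / \<eta> \<le> S"
  proof (rule power2_le_imp_le)
    have "(L\<^sub>m\<^sub>a\<^sub>x / \<eta>)\<^sup>2 = 1 / \<eta>\<^sup>2 * L\<^sub>m\<^sub>a\<^sub>x\<^sup>2" by (simp add: power_divide)
    also have "\<dots> \<le> (\<omega> * (\<omega> + 1) / n + 1 / \<eta>\<^sup>2) * L\<^sub>m\<^sub>a\<^sub>x\<^sup>2"
      using wk(4) dn by (intro mult_right_mono) auto
    also have "\<dots> \<le> S\<^sup>2" unfolding S2 using sv(4) dn by simp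
    finally show "(L\<^sub>m\<^sub>a\<^sub>x / \<eta>)\<^sup>2 \<le> S\<^sup>2" .
  qed (use S0 in simp)
  define z where "z = sqrt (real b / \<eta> * (1 + s))"
  have C\<^sub>b: "100 * z \<le> real b\<^sub>i\<^sub>n\<^sub>i\<^sub>t" "real b\<^sub>i\<^sub>n\<^sub>i\<^sub>t \<le> C\<^sub>b * z"
    using b_init by (simp_all add: theta_def z_def s_def)
  have z0: "0 < z" unfolding z_def using b0 \<eta>(1) s0 by simp
  have C\<^sub>b0: "0 \<le> C\<^sub>b"
  proof -
    have "100 * z \<le> C\<^sub>b * z" using C\<^sub>b by linarith
    thus ?thesis using z0 by (simp add: mult_le_cancel_right_pos)
  qed
  have binit1: "1 \<le> b\<^sub>i\<^sub>n\<^sub>i\<^sub>t" using C\<^sub>b(1) z0 by (cases b\<^sub>i\<^sub>n\<^sub>i\<^sub>t) auto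
  have z2: "z\<^sup>2 = real b / \<eta> * (1 + s)" unfolding z_def using b0 \<eta>(1) s0 by simp

  have smooth_max: "smooth L\<^sub>m\<^sub>a\<^sub>x (f i)" for i
    using f_smooth[of i] lipschitz_on_le[OF _ L_ge(1)] by (auto simp: smooth_def)
  interpret run: m4_run M R D f G x0 \<gamma> \<eta> \<eta> \<sigma> p p\<^sub>s \<omega> \<omega>\<^sub>s L\<^sub>m\<^sub>a\<^sub>x L\<^sub>A L\<^sub>B K K\<^sub>s b batch
  proof (rule m4_run.intro)
    show "\<omega> = real CARD('d) / real K - 1" "\<omega>\<^sub>s = real CARD('d) / real K\<^sub>s - 1"
      using K_def(2) K\<^sub>s_def(2) by (simp_all only: dims)
    show "1 \<le> batch 0" "\<And>k. batch (Suc k) = b" using binit1 by (simp_all add: batch_def)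
  qed (fact randomness stoch_grad smooth_max similarity wk(1,2) sv(1,2) p_def fl(1) \<eta>(1,2))+
  have F: "F = run.F" by (simp add: F_def)
  have iterate: "m4_iterate \<gamma> \<eta> \<eta> K\<^sub>s K batch G R x0 k \<xi> = run.x k \<xi>" for k \<xi>
    by (rule run.iterate_eq)
  have stationary: "stationary_point (output_space M N) F \<epsilon>
      (\<lambda>(\<omega>, k). m4_iterate \<gamma> \<eta> \<eta> K\<^sub>s K batch G R x0 k \<omega>)"
    if "(\<Sum>k\<le>N. \<integral>\<omega>. (norm (gradient F (run.x k \<omega>)))\<^sup>2 \<partial>M) \<le> real (Suc N) * \<epsilon>" for N
    unfolding iterate
  proof (rule stationary_point_output[OF run.prob_space_axioms])
    have "L\<^sub>m\<^sub>a\<^sub>x-lipschitz_on UNIV (gradient F)" using run.F_smooth by (simp add: smooth_def F)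
    thus "gradient F \<in> borel_measurable borel"
      by (intro borel_measurable_continuous_onI lipschitz_on_continuous_on)
    show "run.x k \<in> borel_measurable M" for k
      by (intro square_integrable_measurable run.L2_intros)
    show "integrable M (\<lambda>\<omega>. (norm (gradient F (run.x k \<omega>)))\<^sup>2)" for k
      unfolding F by (rule square_integrable_integrable[OF run.L2_gradient_F])
  qed (use that in simp)
  have grad0: "(norm (gradient F x0))\<^sup>2 \<le> 2 * L\<^sub>m\<^sub>a\<^sub>x * \<Delta>"
    unfolding \<Delta>_def F by (rule smooth_gradient_bound[OF run.F_smooth L_pos]) (use F_bounded F in simp)
  have \<Delta>0: "0 \<le> \<Delta>" using F_bounded[of x0] by (simp add: \<Delta>_def)
  note time = run.expected_time[OF pos(3-5), of tg ts tw]
  have time: "(\<integral>\<omega>. m4_time K\<^sub>s K batch R tg ts tw N \<omega> \<partial>M) \<le>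
      (if N = 0 then 0 else real b\<^sub>i\<^sub>n\<^sub>i\<^sub>t * h + real N * (5 * t))" for N
  proof -
    have "2 * real K\<^sub>s * \<kappa> + real b * h + 2 * real K * \<tau> \<le> 5 * t" using wk(3) sv(3) fl(2) by linarith
    hence le: "real N * (2 * real K\<^sub>s * \<kappa> + real b * h + 2 * real K * \<tau>) \<le> real N * (5 * t)"
      by (rule mult_left_mono) simp
    have batch0: "batch 0 = b\<^sub>i\<^sub>n\<^sub>i\<^sub>t" by (simp add: batch_def)
    have base: "(\<integral>\<omega>. m4_time K\<^sub>s K batch R tg ts tw N \<omega> \<partial>M) \<le> (if N = 0 then 0
        else real b\<^sub>i\<^sub>n\<^sub>i\<^sub>t * h + real N * (2 * real K\<^sub>s * \<kappa> + real b * h + 2 * real K * \<tau>))"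
      using time[of N, unfolded batch0] times_bounded by blast
    show ?thesis
    proof (cases "N = 0")
      case False
      thus ?thesis using add_left_mono[OF le, of "real b\<^sub>i\<^sub>n\<^sub>i\<^sub>t * h"] base by (simp only: if_False)
    qed (use base in simp)
  qed
  define RHS where "RHS = X * (L\<^sub>m\<^sub>a\<^sub>x * \<Delta> / \<epsilon>) + d * \<kappa> * L\<^sub>A * \<Delta> / \<epsilon>"
  have RHS0: "0 \<le> X * (L\<^sub>m\<^sub>a\<^sub>x * \<Delta> / \<epsilon>)" "0 \<le> d * \<kappa> * L\<^sub>A * \<Delta> / \<epsilon>"
    using X0 L0 \<Delta>0 pos dn by simp_all
  show ?thesis
    unfolding X_def[symmetric] RHS_def[symmetric]
  proof (cases "2 * L\<^sub>m\<^sub>a\<^sub>x * \<Delta> \<le> \<epsilon>")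
    case True
    \<comment> \<open>the starting point is already stationary, and it costs no time\<close>
    have "(\<Sum>k\<le>0. \<integral>\<omega>. (norm (gradient F (run.x k \<omega>)))\<^sup>2 \<partial>M) \<le> real (Suc 0) * \<epsilon>"
      using grad0 True by (simp add: run.start run.prob_space)
    moreover have "\<not> \<epsilon> \<le> L\<^sub>m\<^sub>a\<^sub>x * \<Delta>" using True pos(1) by linarith
    moreover have "0 \<le> 10000 * (1 / c\<^sub>\<gamma> + C\<^sub>b) * RHS"
      using c\<gamma>(1) C\<^sub>b0 RHS0 by (simp add: RHS_def)
    ultimately show "\<exists>N. (\<epsilon> \<le> L\<^sub>m\<^sub>a\<^sub>x * \<Delta> \<longrightarrow> 0 < N) \<and>
             stationary_point (output_space M N) F \<epsilon>
               (\<lambda>(\<omega>, k). m4_iterate \<gamma> \<eta> \<eta> K\<^sub>s K batch G R x0 k \<omega>) \<and>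
             (\<integral>\<omega>. m4_time K\<^sub>s K batch R tg ts tw N \<omega> \<partial>M) \<le> 10000 * (1 / c\<^sub>\<gamma> + C\<^sub>b) * RHS"
      using stationary[of 0] time[of 0] by (intro exI[of _ 0]) auto
  next
    case False
    hence gap: "1 \<le> 2 * (L\<^sub>m\<^sub>a\<^sub>x * \<Delta> / \<epsilon>)" and \<Delta>pos: "0 < \<Delta>"
      using pos(1) L_pos \<Delta>0 by (auto simp: field_simps less_le)
    define u where "u = \<Delta> / (\<gamma> * \<epsilon>)"
    \<comment> \<open>the step size is at most \<open>\<eta> / (100 * L\<^sub>m\<^sub>a\<^sub>x)\<close>, so the run is long compared with the memory \<open>1 / \<eta>\<close> of the
      momentum; this makes the initial noise and the rounding of the number of iterations harmless\<close>
    have u_ge: "50 / \<eta> \<le> u"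
    proof -
      have "\<gamma> * (L\<^sub>m\<^sub>a\<^sub>x / \<eta>) \<le> 1 / 100"
        using \<gamma>S mult_left_mono[OF LS, of \<gamma>] step_size(1) by linarith
      hence "100 * L\<^sub>m\<^sub>a\<^sub>x / \<eta> \<le> 1 / \<gamma>" using step_size(1) by (simp add: field_simps)
      hence "100 * L\<^sub>m\<^sub>a\<^sub>x / \<eta> * (\<Delta> / \<epsilon>) \<le> 1 / \<gamma> * (\<Delta> / \<epsilon>)"
        using \<Delta>0 pos by (intro mult_right_mono) auto
      hence "50 / \<eta> * (2 * (L\<^sub>m\<^sub>a\<^sub>x * \<Delta> / \<epsilon>)) \<le> u" by (simp add: u_def)
      moreover have "50 / \<eta> * 1 \<le> 50 / \<eta> * (2 * (L\<^sub>m\<^sub>a\<^sub>x * \<Delta> / \<epsilon>))"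
        using gap \<eta>(1) by (intro mult_left_mono) auto
      ultimately show ?thesis by linarith
    qed
    have inv\<eta>: "1 \<le> 1 / \<eta>" using \<eta>(1,2) by simp
    hence u1: "1 \<le> u" using u_ge by linarith
    define N where "N = nat \<lceil>8 * u\<rceil>"
    have N: "8 * u \<le> real N" "real N \<le> 9 * u" "0 < N"
      unfolding N_def using u1 by linarith+
    have T: "1 / \<eta> \<le> real (Suc N)" "8 * u \<le> real (Suc N)"
      using N u_ge inv\<eta> by linarith+
    have batch0: "batch 0 = b\<^sub>i\<^sub>n\<^sub>i\<^sub>t" by (simp add: batch_def)
    \<comment> \<open>the form in which the lower bound on the initial batch is used\<close>
    have Bz: "10000 * (real b / \<eta> * s) \<le> (real b\<^sub>i\<^sub>n\<^sub>i\<^sub>t)\<^sup>2"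
    proof -
      have "10000 * (real b / \<eta> * s) \<le> 10000 * (real b / \<eta> * (1 + s))"
        using b0 \<eta>(1) by (intro mult_left_mono) auto
      also have "\<dots> = (100 * z)\<^sup>2" by (simp add: power_mult_distrib z2)
      also have "\<dots> \<le> (real b\<^sub>i\<^sub>n\<^sub>i\<^sub>t)\<^sup>2" using C\<^sub>b(1) z0 by (intro power_mono) auto
      finally show ?thesis .
    qed
    have binit0: "0 < real b\<^sub>i\<^sub>n\<^sub>i\<^sub>t" using binit1 by simp
    have \<sigma>s: "\<sigma>\<^sup>2 = s * n * \<epsilon>" using dn pos by (simp add: s_def)
    have w2: "\<omega>\<^sup>2 \<le> \<omega> * (\<omega> + 1)" using wk(4) by (simp add: power2_eq_square distrib_left)
    have w2s: "36 * \<eta>\<^sup>2 * \<omega>\<^sup>2 * s \<le> real b"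
    proof -
      have "36 * \<eta>\<^sup>2 * \<omega>\<^sup>2 * s \<le> 36 * \<eta>\<^sup>2 * (\<omega> * (\<omega> + 1)) * s"
        using w2 s0 by (intro mult_right_mono mult_left_mono) auto
      thus ?thesis using \<eta>(4) by linarith
    qed
    have avg: "(\<Sum>k\<le>N. \<integral>\<omega>. (norm (gradient run.F (run.x k \<omega>)))\<^sup>2 \<partial>M) \<le> real (Suc N) * \<epsilon>"
    proof (rule run.average_gradient[OF step_size(1) _ refl refl pos(6) L_ge(2) pos(7) L_ge(3) refl])
      show "fstar \<le> run.F a" for a using F_bounded[of a] by (simp add: F)
      show "\<gamma>\<^sup>2 * (\<omega>\<^sub>s * (\<omega>\<^sub>s + 1) * L\<^sub>A\<^sup>2 + \<omega>\<^sub>s / real CARD('n) * (\<omega>\<^sub>s + 1) * L\<^sub>B\<^sup>2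
                   + (\<omega> * (\<omega> + 1) / real CARD('n) + 1 / \<eta>\<^sup>2) * L\<^sub>m\<^sub>a\<^sub>x\<^sup>2) \<le> 1 / 10000"
      proof -
        have "(\<gamma> * S)\<^sup>2 \<le> (1 / 100)\<^sup>2" using \<gamma>S S0 step_size(1) by (intro power_mono) auto
        thus ?thesis unfolding power_mult_distrib S2 dims by (simp add: power_divide)
      qed
      show "\<eta> ^ 3 * (\<omega> * (\<omega> + 1) * \<omega>\<^sub>s) \<le> real CARD('n)" using \<eta>(5) by (simp add: dims)
      show "\<eta> * (\<sigma>\<^sup>2 / (real b * real CARD('n))) \<le> \<epsilon> / 6"
      proof -
        have "\<eta> * (\<sigma>\<^sup>2 / (real b * n)) = (6 * \<eta> * s) / real b * (\<epsilon> / 6)"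
          using dn b0 by (simp add: \<sigma>s)
        also have "\<dots> \<le> 1 * (\<epsilon> / 6)" using \<eta>(3) b0 pos by (intro mult_right_mono) auto
        finally show ?thesis by (simp add: dims)
      qed
      show "\<omega>\<^sup>2 / real CARD('n) * (3 * \<eta>\<^sup>2 * (\<sigma>\<^sup>2 / real b)) \<le> \<epsilon> / 12"
      proof -
        have "\<omega>\<^sup>2 / n * (3 * \<eta>\<^sup>2 * (\<sigma>\<^sup>2 / real b)) = (36 * \<eta>\<^sup>2 * \<omega>\<^sup>2 * s) / real b * (\<epsilon> / 12)"
          using dn b0 by (simp add: \<sigma>s)
        also have "\<dots> \<le> 1 * (\<epsilon> / 12)" using w2s b0 pos by (intro mult_right_mono) auto
        finally show ?thesis by (simp add: dims)
      qed
      show "2 * \<omega> * \<eta> / real CARD('n) * (\<sigma>\<^sup>2 / real (batch 0)) \<le> \<epsilon> / 16"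
      proof -
        have "32 * \<omega> * \<eta> * s \<le> real b\<^sub>i\<^sub>n\<^sub>i\<^sub>t"
        proof (rule power2_le_imp_le)
          have "(32 * \<omega> * \<eta> * s)\<^sup>2 = 1024 / 36 * (36 * \<eta>\<^sup>2 * \<omega>\<^sup>2 * s) * s"
            by (simp add: power2_eq_square)
          also have "\<dots> \<le> 1024 / 36 * real b * s"
            using w2s s0 by (intro mult_right_mono mult_left_mono) auto
          also have "\<dots> \<le> 10000 * (real b * s) * 1" using b0 s0 by simp
          also have "\<dots> \<le> 10000 * (real b * s) * (1 / \<eta>)" using inv\<eta> b0 s0 by (intro mult_left_mono) auto
          also have "\<dots> = 10000 * (real b / \<eta> * s)" by simp
          also note Bz
          finally show "(32 * \<omega> * \<eta> * s)\<^sup>2 \<le> (real b\<^sub>i\<^sub>n\<^sub>i\<^sub>t)\<^sup>2" .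
        qed simp
        hence "(32 * \<omega> * \<eta> * s) / real b\<^sub>i\<^sub>n\<^sub>i\<^sub>t * (\<epsilon> / 16) \<le> 1 * (\<epsilon> / 16)"
          using binit0 pos by (intro mult_right_mono) auto
        moreover have "2 * \<omega> * \<eta> / n * (\<sigma>\<^sup>2 / real b\<^sub>i\<^sub>n\<^sub>i\<^sub>t) = (32 * \<omega> * \<eta> * s) / real b\<^sub>i\<^sub>n\<^sub>i\<^sub>t * (\<epsilon> / 16)"
          using dn by (simp add: \<sigma>s)
        ultimately show ?thesis by (simp add: dims batch0)
      qed
      show "\<sigma>\<^sup>2 / (real (batch 0) * real CARD('n)) / \<eta> \<le> real (Suc N) * (\<epsilon> / 16)"
      proof -
        have "16 * s \<le> real b\<^sub>i\<^sub>n\<^sub>i\<^sub>t"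
        proof (rule power2_le_imp_le)
          have "(16 * s)\<^sup>2 = 256 * s * s" by (simp add: power2_eq_square)
          also have "s \<le> real b / \<eta>" using \<eta>(1,3) s0 by (simp add: field_simps)
          hence "256 * s * s \<le> 256 * (real b / \<eta>) * s" using s0 by (intro mult_right_mono mult_left_mono) auto
          also have "\<dots> \<le> 10000 * (real b / \<eta> * s)"
            unfolding mult.assoc using b0 \<eta>(1) s0 by (intro mult_right_mono) auto
          also note Bz
          finally show "(16 * s)\<^sup>2 \<le> (real b\<^sub>i\<^sub>n\<^sub>i\<^sub>t)\<^sup>2" .
        qed simp
        hence "(16 * s) / real b\<^sub>i\<^sub>n\<^sub>i\<^sub>t * (1 / \<eta>) * (\<epsilon> / 16) \<le> 1 * real (Suc N) * (\<epsilon> / 16)"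
          using binit0 pos T(1) \<eta>(1) s0 by (intro mult_right_mono mult_mono) auto
        moreover have "\<sigma>\<^sup>2 / (real b\<^sub>i\<^sub>n\<^sub>i\<^sub>t * n) / \<eta> = (16 * s) / real b\<^sub>i\<^sub>n\<^sub>i\<^sub>t * (1 / \<eta>) * (\<epsilon> / 16)"
          using dn by (simp add: \<sigma>s)
        ultimately show ?thesis by (simp add: dims batch0)
      qed
      show "2 * (run.F x0 - fstar) / \<gamma> \<le> real (Suc N) * (\<epsilon> / 4)"
      proof -
        have "2 * \<Delta> / \<gamma> = 8 * u * (\<epsilon> / 4)" using pos step_size(1) by (simp add: u_def)
        also have "\<dots> \<le> real (Suc N) * (\<epsilon> / 4)" using T(2) pos by (intro mult_right_mono) auto
        finally show ?thesis by (simp add: \<Delta>_def F)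
      qed
    qed
    have "real b\<^sub>i\<^sub>n\<^sub>i\<^sub>t * h + real N * (5 * t) \<le> 10000 * (1 / c\<^sub>\<gamma> + C\<^sub>b) * RHS"
    proof -
      have St: "S * t \<le> 2 * (d * \<kappa> * L\<^sub>A) + 37 * (X * L\<^sub>m\<^sub>a\<^sub>x)"
        unfolding S_def
        by (rule step_size_time[OF t0 pos(4,5) dn wk(4) sv(4) \<eta>(1) pos(6,7) L_ge(3) X(3,4) t\<eta>])
           (use wk(6) sv(6) in \<open>simp_all add: dims\<close>)
      have below: "90 * (d * \<kappa> * L\<^sub>A * \<Delta> / \<epsilon>) + 1665 * (X * (L\<^sub>m\<^sub>a\<^sub>x * \<Delta> / \<epsilon>)) \<le> 10000 * RHS"
        "18 * (X * (L\<^sub>m\<^sub>a\<^sub>x * \<Delta> / \<epsilon>)) \<le> 10000 * RHS"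
      proof -
        have "90 * q + 1665 * r \<le> 10000 * (r + q)" "18 * r \<le> 10000 * (r + q)"
          if "0 \<le> r" "0 \<le> q" for q r :: real
          using that unfolding distrib_left by linarith+
        from this[OF RHS0] show "90 * (d * \<kappa> * L\<^sub>A * \<Delta> / \<epsilon>) + 1665 * (X * (L\<^sub>m\<^sub>a\<^sub>x * \<Delta> / \<epsilon>)) \<le> 10000 * RHS"
          "18 * (X * (L\<^sub>m\<^sub>a\<^sub>x * \<Delta> / \<epsilon>)) \<le> 10000 * RHS" unfolding RHS_def .
      qed
      have "real N * (5 * t) \<le> 9 * u * (5 * t)" using N(2) t0 by (intro mult_right_mono) auto
      also have "\<dots> = 45 * (t * (\<Delta> / \<epsilon>)) * (1 / \<gamma>)" by (simp add: u_def mult.commute)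
      also have "\<dots> \<le> 45 * (t * (\<Delta> / \<epsilon>)) * (S / c\<^sub>\<gamma>)"
      proof (rule mult_left_mono)
        show "1 / \<gamma> \<le> S / c\<^sub>\<gamma>" using c\<gamma>(1,2) S0 step_size(1) by (simp add: field_simps)
      qed (use t0 \<Delta>0 pos in simp)
      also have "\<dots> = 45 / c\<^sub>\<gamma> * (\<Delta> / \<epsilon>) * (S * t)" by (simp add: mult_ac)
      also have "\<dots> \<le> 45 / c\<^sub>\<gamma> * (\<Delta> / \<epsilon>) * (2 * (d * \<kappa> * L\<^sub>A) + 37 * (X * L\<^sub>m\<^sub>a\<^sub>x))"
        using St c\<gamma>(1) \<Delta>0 pos by (intro mult_left_mono) auto
      also have "\<dots> = 1 / c\<^sub>\<gamma> * (90 * (d * \<kappa> * L\<^sub>A * \<Delta> / \<epsilon>) + 1665 * (X * (L\<^sub>m\<^sub>a\<^sub>x * \<Delta> / \<epsilon>)))"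
        using pos c\<gamma>(1) by (simp add: field_simps)
      also have "\<dots> \<le> 1 / c\<^sub>\<gamma> * (10000 * RHS)"
        using below(1) c\<gamma>(1) by (intro mult_left_mono) auto
      finally have run_time: "real N * (5 * t) \<le> 1 / c\<^sub>\<gamma> * (10000 * RHS)" .
      have zh: "z * h \<le> 9 * X"
      proof (rule power2_le_imp_le)
        have "(z * h)\<^sup>2 = (real b * h) / \<eta> * (h + s * h)"
          unfolding power_mult_distrib z2 by (simp add: power2_eq_square algebra_simps)
        also have "\<dots> \<le> t / \<eta> * (X + X)"
          using fl(2) X(1,2) \<eta>(1) s0 pos t0 by (intro mult_mono divide_right_mono add_mono) auto
        also have "\<dots> \<le> 33 * X * (X + X)" using t\<eta> X0 by (intro mult_right_mono) auto
        also have "\<dots> \<le> (9 * X)\<^sup>2" by (simp add: power2_eq_square)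
        finally show "(z * h)\<^sup>2 \<le> (9 * X)\<^sup>2" .
      qed (use X0 in simp)
      have "real b\<^sub>i\<^sub>n\<^sub>i\<^sub>t * h \<le> C\<^sub>b * z * h" using C\<^sub>b(2) pos by (intro mult_right_mono) auto
      also have "\<dots> = C\<^sub>b * (z * h)" by simp
      also have "\<dots> \<le> C\<^sub>b * (9 * X)" using zh C\<^sub>b0 by (intro mult_left_mono) auto
      also have "\<dots> \<le> C\<^sub>b * (9 * X * (2 * (L\<^sub>m\<^sub>a\<^sub>x * \<Delta> / \<epsilon>)))"
        using mult_left_mono[OF gap, of "9 * X"] X0 C\<^sub>b0 by (intro mult_left_mono) auto
      also have "\<dots> = C\<^sub>b * (18 * (X * (L\<^sub>m\<^sub>a\<^sub>x * \<Delta> / \<epsilon>)))" by simp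
      also have "\<dots> \<le> C\<^sub>b * (10000 * RHS)"
        using below(2) C\<^sub>b0 by (intro mult_left_mono) auto
      finally have "real b\<^sub>i\<^sub>n\<^sub>i\<^sub>t * h \<le> C\<^sub>b * (10000 * RHS)" .
      with run_time have "real b\<^sub>i\<^sub>n\<^sub>i\<^sub>t * h + real N * (5 * t) \<le> C\<^sub>b * (10000 * RHS) + 1 / c\<^sub>\<gamma> * (10000 * RHS)"
        by (rule add_mono[rotated])
      thus ?thesis by (simp add: algebra_simps)
    qed
    hence "(\<integral>\<omega>. m4_time K\<^sub>s K batch R tg ts tw N \<omega> \<partial>M) \<le> 10000 * (1 / c\<^sub>\<gamma> + C\<^sub>b) * RHS"
      using time[of N] N(3) by simp
    thus "\<exists>N. (\<epsilon> \<le> L\<^sub>m\<^sub>a\<^sub>x * \<Delta> \<longrightarrow> 0 < N) \<and>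
             stationary_point (output_space M N) F \<epsilon>
               (\<lambda>(\<omega>, k). m4_iterate \<gamma> \<eta> \<eta> K\<^sub>s K batch G R x0 k \<omega>) \<and>
             (\<integral>\<omega>. m4_time K\<^sub>s K batch R tg ts tw N \<omega> \<partial>M) \<le> 10000 * (1 / c\<^sub>\<gamma> + C\<^sub>b) * RHS"
      using stationary[of N] avg N(3) unfolding F by blast
  qed
qed

end
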